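(* Let $d\ge1$ and let $is_1,\dots,is_d$ be the eigenvalues (listed with multiplicity) of $A\in\mathfrak{u}(d)$. Assume that $s_j<0$ and that there are $p_j\in\mathbb{Z}$ and $x\in\mathbb{R}$ such that $s_j=p_jx$, for each $1\le j\le d$. Choose $x>0$ and let $q$ be the least common multiple of $-p_1,\dots,-p_d$. Let $N_A(r)=\#\{\lambda\in\sigma(H_A)\mid\lambda\le r\}$ be the counting function of the eigenvalues of $H_A$ (counted with multiplicity). Then there is a polynomial $p(k)=\sum_{j=0}^d c_jk^j$ such that $$p\Big(\big[(r-\tfrac{i}{2}\operatorname{tr}(A))(qx)^{-1}\big]\Big)\le N_A(r)\le p\Big(\big[(r-\tfrac{i}{2}\operatorname{tr}(A))(qx)^{-1}\big]+1\Big),$$ where $[t]$ denotes the integer part of $t$, for any $t\in\mathbb{R}$. The left-hand inequality becomes an equality whenever $(r-\frac{i}{2}\operatorname{tr}(A))(qx)^{-1}\in\mathbb{N}_0$. Moreover, if $\mathcal{P}=\{y\in\mathbb{R}^d\mid y\ge0,\ -\sum_j y_jp_j\le q\}$ (where $y\ge 0$ means $y_j\ge0$ for all $j$), then $c_0=1$, $c_d=|\mathcal{P}|$ is the volume of $\mathcal{P}$, and $c_{d-1}=\frac12|\partial\mathcal{P}|$ is one half of the sum of the $(d-1)$-volumes of the faces of $\mathcal{P}$.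
   Context: $\mathfrak{u}(d)$ is the Lie algebra of anti-Hermitian complex $d\times d$ matrices. Under the identification $\mathbb{R}^{2d}\ni(x,\xi)\mapsto x+i\xi\in\mathbb{C}^d$, an element $A\in\mathfrak{u}(d)$ is written $A=\begin{pmatrix} B & C\\ -C & B\end{pmatrix}$, i.e. $A=B-iC$ as a complex matrix, with $B,C$ real $d\times d$ matrices, $B^{*}=-B$, $C^{*}=C$. Eigenvalues and trace of $A$ are those of the complex $d\times d$ matrix; thus $\frac{i}{2}\operatorname{tr}(A)=-\frac12\sum_j s_j$. The operator $H_A$ on $L^2(\mathbb{R}^d)$, with domain the Schwartz space $S(\mathbb{R}^d)$, is $$H_A=\frac12\sum_{j,k} C_{jk}\Big(-\frac{\partial^2}{\partial x_j\partial x_k}+x_jx_k\Big)+\frac{i}{2}\sum_{j,k} B_{jk}\Big(x_k\frac{\partial}{\partial x_j}-x_j\frac{\partial}{\partial x_k}\Big).$$ It is essentially selfadjoint, and its spectrum $\sigma(H_A)$ and eigenvalues are those of its closure. Under the stated hypotheses $\sigma(H_A)$ consists of isolated eigenvalues of finite multiplicity. The argument $r$ of $N_A$ is a real number. The faces of $\mathcal{P}$ in the last sentence are the $(d-1)$-dimensional ones. $\mathbb{N}_0=\{0,1,2,\dots\}$.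
   Formalization: The two-sided inequality is stated for r ≥ (i/2)tr(A) only (it fails for very negative r), and the (d-1)-volumes of the faces are normalized by the lattice of integer vectors parallel to each face (with Euclidean volumes the formula for c_{d-1} fails for d ≥ 2). *)

theory Defs
  imports "HOL-Analysis.Analysis"
begin

definition square_integrable :: "('a::euclidean_space \<Rightarrow> complex) \<Rightarrow> bool" where
  "square_integrable f \<longleftrightarrow>
     f \<in> borel_measurable lborel \<and> integrable lborel (\<lambda>x. (cmod (f x))\<^sup>2)"

lemma square_integrable_zero: "square_integrable (\<lambda>x. 0)"
  by (simp add: square_integrable_def)

lemma square_integrable_add:
  assumes "square_integrable f" "square_integrable g"
  shows "square_integrable (\<lambda>x. f x + g x)"
proof -
  have m: "f \<in> borel_measurable lborel" "g \<in> borel_measurable lborel"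
    and i: "integrable lborel (\<lambda>x. (cmod (f x))\<^sup>2)" "integrable lborel (\<lambda>x. (cmod (g x))\<^sup>2)"
    using assms by (auto simp: square_integrable_def)
  have bnd: "(cmod (a + b))\<^sup>2 \<le> 2 * (cmod a)\<^sup>2 + 2 * (cmod b)\<^sup>2" for a b :: complex
  proof -
    have "(cmod (a + b))\<^sup>2 \<le> (cmod a + cmod b)\<^sup>2"
      by (intro power_mono norm_triangle_ineq) auto
    also have "\<dots> \<le> 2 * (cmod a)\<^sup>2 + 2 * (cmod b)\<^sup>2"
      using sum_squares_bound[of "cmod a" "cmod b"] by (simp add: power2_sum)
    finally show ?thesis .
  qed
  have "integrable lborel (\<lambda>x. (cmod (f x + g x))\<^sup>2)"
  proof (rule Bochner_Integration.integrable_bound)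
    show "integrable lborel (\<lambda>x. 2 * (cmod (f x))\<^sup>2 + 2 * (cmod (g x))\<^sup>2)"
      using i by simp
    show "(\<lambda>x. (cmod (f x + g x))\<^sup>2) \<in> borel_measurable lborel"
      using m by measurable
    show "AE x in lborel. norm ((cmod (f x + g x))\<^sup>2)
            \<le> norm (2 * (cmod (f x))\<^sup>2 + 2 * (cmod (g x))\<^sup>2)"
      by (rule AE_I2) (use bnd in simp)
  qed
  with m show ?thesis
    by (simp add: square_integrable_def)
qed

lemma square_integrable_cmult:
  assumes "square_integrable f"
  shows "square_integrable (\<lambda>x. c * f x)"
  using assms by (auto simp: square_integrable_def norm_mult power_mult_distrib)

lemma square_integrable_inner:
  assumes "square_integrable f" "square_integrable g"
  shows "integrable lborel (\<lambda>x. f x \<bullet> g x)"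
proof -
  have m: "f \<in> borel_measurable lborel" "g \<in> borel_measurable lborel"
    and i: "integrable lborel (\<lambda>x. (cmod (f x))\<^sup>2)" "integrable lborel (\<lambda>x. (cmod (g x))\<^sup>2)"
    using assms by (auto simp: square_integrable_def)
  have bnd: "\<bar>a \<bullet> b\<bar> \<le> (cmod a)\<^sup>2 + (cmod b)\<^sup>2" for a b :: complex
  proof -
    have "\<bar>a \<bullet> b\<bar> \<le> cmod a * cmod b"
      by (rule Cauchy_Schwarz_ineq2)
    also have "\<dots> \<le> (cmod a)\<^sup>2 + (cmod b)\<^sup>2"
      using sum_squares_bound[of "cmod a" "cmod b"] mult_nonneg_nonneg[OF norm_ge_zero norm_ge_zero, of a b]
      by linarith
    finally show ?thesis .
  qed
  show ?thesis
  proof (rule Bochner_Integration.integrable_bound)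
    show "integrable lborel (\<lambda>x. (cmod (f x))\<^sup>2 + (cmod (g x))\<^sup>2)"
      using i by simp
    show "(\<lambda>x. f x \<bullet> g x) \<in> borel_measurable lborel"
      using m by measurable
    show "AE x in lborel. norm (f x \<bullet> g x) \<le> norm ((cmod (f x))\<^sup>2 + (cmod (g x))\<^sup>2)"
      by (rule AE_I2) (use bnd in simp)
  qed
qed

lemmas square_integrable_intros =
  square_integrable_zero square_integrable_add square_integrable_cmult

definition l2_rel :: "('a::euclidean_space \<Rightarrow> complex) \<Rightarrow> ('a \<Rightarrow> complex) \<Rightarrow> bool" where
  "l2_rel f g \<longleftrightarrow>
     square_integrable f \<and> square_integrable g \<and> (AE x in lborel. f x = g x)"

lemma part_equivp_l2_rel: "part_equivp l2_rel"
proof (rule part_equivpI)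
  show "\<exists>f :: 'a \<Rightarrow> complex. l2_rel f f"
    using square_integrable_zero by (auto simp: l2_rel_def)
  show "symp (l2_rel :: ('a \<Rightarrow> complex) \<Rightarrow> _)"
    by (auto simp: symp_def l2_rel_def eq_commute)
  show "transp (l2_rel :: ('a \<Rightarrow> complex) \<Rightarrow> _)"
  proof (rule transpI)
    fix f g h :: "'a \<Rightarrow> complex"
    assume "l2_rel f g" "l2_rel g h"
    then have "square_integrable f" "square_integrable h"
      "AE x in lborel. f x = g x" "AE x in lborel. g x = h x"
      by (simp_all add: l2_rel_def)
    from this(3,4) have "AE x in lborel. f x = h x"
      by eventually_elim simp
    with \<open>square_integrable f\<close> \<open>square_integrable h\<close> show "l2_rel f h"
      by (simp add: l2_rel_def)
  qed
qed

lemma l2_rel_cmult: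
  assumes "l2_rel f f'"
  shows "l2_rel (\<lambda>x. c * f x) (\<lambda>x. c * f' x)"
proof -
  have "AE x in lborel. f x = f' x" using assms by (simp add: l2_rel_def)
  then have "AE x in lborel. c * f x = c * f' x" by eventually_elim simp
  with assms show ?thesis by (simp add: l2_rel_def square_integrable_cmult)
qed

lemma l2_rel_add:
  assumes "l2_rel f f'" "l2_rel g g'"
  shows "l2_rel (\<lambda>x. f x + g x) (\<lambda>x. f' x + g' x)"
proof -
  have "AE x in lborel. f x = f' x" "AE x in lborel. g x = g' x"
    using assms by (simp_all add: l2_rel_def)
  then have "AE x in lborel. f x + g x = f' x + g' x" by eventually_elim simp
  with assms show ?thesis by (simp add: l2_rel_def square_integrable_add)
qed

quotient_type (overloaded) 'a l2 = "'a::euclidean_space \<Rightarrow> complex" / partial: l2_rel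
  by (rule part_equivp_l2_rel)

instantiation l2 :: (euclidean_space) real_inner
begin

lift_definition zero_l2 :: "'a l2" is "\<lambda>x. 0"
  by (simp add: l2_rel_def square_integrable_zero)

lift_definition plus_l2 :: "'a l2 \<Rightarrow> 'a l2 \<Rightarrow> 'a l2" is "\<lambda>f g x. f x + g x"
  by (rule l2_rel_add)

lift_definition uminus_l2 :: "'a l2 \<Rightarrow> 'a l2" is "\<lambda>f x. - f x"
  using l2_rel_cmult[where c = "-1"] by simp

definition minus_l2 :: "'a l2 \<Rightarrow> 'a l2 \<Rightarrow> 'a l2" where
  "minus_l2 u v = u + (- v)"

lift_definition scaleR_l2 :: "real \<Rightarrow> 'a l2 \<Rightarrow> 'a l2" is "\<lambda>c f x. complex_of_real c * f x"
  by (rule l2_rel_cmult)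

text \<open>\<open>\<bullet>\<close> on \<^typ>\<open>complex\<close> is the real part of the Hermitian product, so this is the real
  part of the usual inner product; it induces the usual norm (see \<open>norm_l2_eq\<close> below).\<close>

lift_definition inner_l2 :: "'a l2 \<Rightarrow> 'a l2 \<Rightarrow> real" is
  "\<lambda>f g. LINT x|lborel. f x \<bullet> g x"
proof -
  fix f f' g g' :: "'a \<Rightarrow> complex"
  assume *: "l2_rel f f'" "l2_rel g g'"
  then have "AE x in lborel. f x = f' x" "AE x in lborel. g x = g' x"
    by (simp_all add: l2_rel_def)
  then have "AE x in lborel. f x \<bullet> g x = f' x \<bullet> g' x"
    by eventually_elim simp
  moreover have "integrable lborel (\<lambda>x. f x \<bullet> g x)" "integrable lborel (\<lambda>x. f' x \<bullet> g' x)"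
    using * by (auto simp: l2_rel_def intro: square_integrable_inner)
  ultimately show "(LINT x|lborel. f x \<bullet> g x) = (LINT x|lborel. f' x \<bullet> g' x)"
    by (intro integral_cong_AE) auto
qed

definition norm_l2 :: "'a l2 \<Rightarrow> real" where
  "norm_l2 u = sqrt (u \<bullet> u)"

definition sgn_l2 :: "'a l2 \<Rightarrow> 'a l2" where
  "sgn_l2 u = scaleR (inverse (norm u)) u"

definition dist_l2 :: "'a l2 \<Rightarrow> 'a l2 \<Rightarrow> real" where
  "dist_l2 u v = norm (u - v)"

definition uniformity_l2 :: "('a l2 \<times> 'a l2) filter" where
  "uniformity_l2 = (INF e\<in>{0 <..}. principal {(x, y). dist x y < e})"

definition open_l2 :: "'a l2 set \<Rightarrow> bool" where
  "open_l2 U = (\<forall>x\<in>U. eventually (\<lambda>(x', y). x' = x \<longrightarrow> y \<in> U) uniformity)"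

instance
proof
  fix a b :: real and u v w :: "'a l2"
  show "u + v + w = u + (v + w)"
    by transfer (simp add: l2_rel_def square_integrable_intros add.assoc)
  show "u + v = v + u"
    by transfer (simp add: l2_rel_def square_integrable_intros add.commute)
  show "0 + u = u"
    by transfer (simp add: l2_rel_def square_integrable_intros)
  show "- u + u = 0"
    by transfer (simp add: l2_rel_def square_integrable_intros)
  show "a *\<^sub>R (u + v) = a *\<^sub>R u + a *\<^sub>R v"
    by transfer (simp add: l2_rel_def square_integrable_intros distrib_left)
  show "(a + b) *\<^sub>R u = a *\<^sub>R u + b *\<^sub>R u"
    by transfer (simp add: l2_rel_def square_integrable_intros distrib_right)
  show "a *\<^sub>R b *\<^sub>R u = (a * b) *\<^sub>R u"
    by transfer (simp add: l2_rel_def square_integrable_intros mult.assoc)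
  show "1 *\<^sub>R u = u"
    by transfer (simp add: l2_rel_def square_integrable_intros)
  show "u - v = u + - v"
    by (simp add: minus_l2_def)
  show "dist u v = norm (u - v)" by (simp add: dist_l2_def)
  show "sgn u = inverse (norm u) *\<^sub>R u" by (simp add: sgn_l2_def)
  show "norm u = sqrt (u \<bullet> u)" by (simp add: norm_l2_def)
  show "u \<bullet> v = v \<bullet> u"
    by transfer (simp add: inner_commute)
  show "(u + v) \<bullet> w = u \<bullet> w + v \<bullet> w"
    by transfer (auto simp: l2_rel_def inner_add_left square_integrable_inner
        intro!: Bochner_Integration.integral_add)
  show "(a *\<^sub>R u) \<bullet> v = a * (u \<bullet> v)"
  proof transfer
    fix c :: real and f g :: "'a \<Rightarrow> complex"
    have "(complex_of_real c * y) \<bullet> z = c * (y \<bullet> z)" for y z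
      by (metis inner_scaleR_left scaleR_conv_of_real)
    then show "(LINT x|lborel. (complex_of_real c * f x) \<bullet> g x) = c * (LINT x|lborel. f x \<bullet> g x)"
      by simp
  qed
  show "0 \<le> u \<bullet> u"
    by transfer simp
  show "u \<bullet> u = 0 \<longleftrightarrow> u = 0"
  proof transfer
    fix f :: "'a \<Rightarrow> complex"
    assume "l2_rel f f"
    then have f: "square_integrable f" by (simp add: l2_rel_def)
    have "(LINT x|lborel. f x \<bullet> f x) = 0 \<longleftrightarrow> (AE x in lborel. f x \<bullet> f x = 0)"
      by (intro integral_nonneg_eq_0_iff_AE square_integrable_inner f) auto
    then show "(LINT x|lborel. f x \<bullet> f x) = 0 \<longleftrightarrow> l2_rel f (\<lambda>x. 0)"
      using f by (simp add: l2_rel_def square_integrable_zero)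
  qed
qed (simp_all add: uniformity_l2_def open_l2_def)

end

text \<open>The class of a function; unspecified unless the function is square integrable.\<close>

definition to_l2 :: "('a::euclidean_space \<Rightarrow> complex) \<Rightarrow> 'a l2" where
  "to_l2 = abs_l2"

lift_definition scaleC_l2 :: "complex \<Rightarrow> 'a::euclidean_space l2 \<Rightarrow> 'a l2" is "\<lambda>c f x. c * f x"
  by (rule l2_rel_cmult)

interpretation l2: vector_space "scaleC_l2 :: complex \<Rightarrow> 'a::euclidean_space l2 \<Rightarrow> 'a l2"
proof
  fix a b :: complex and u v :: "'a l2"
  show "scaleC_l2 a (u + v) = scaleC_l2 a u + scaleC_l2 a v"
    by transfer (simp add: l2_rel_def square_integrable_intros distrib_left)
  show "scaleC_l2 (a + b) u = scaleC_l2 a u + scaleC_l2 b u"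
    by transfer (simp add: l2_rel_def square_integrable_intros distrib_right)
  show "scaleC_l2 a (scaleC_l2 b u) = scaleC_l2 (a * b) u"
    by transfer (simp add: l2_rel_def square_integrable_intros mult.assoc)
  show "scaleC_l2 1 u = u"
    by transfer (simp add: l2_rel_def square_integrable_intros)
qed

lemma norm_l2_eq:
  assumes "square_integrable f"
  shows "norm (to_l2 f) = sqrt (LINT x|lborel. (cmod (f x))\<^sup>2)"
  using assms
  by (simp add: norm_l2_def to_l2_def inner_l2.abs_eq l2_rel_def power2_norm_eq_inner)

text \<open>An operator in \<open>L\<^sup>2\<close> is represented by its graph, a set of pairs \<open>(u, T u)\<close>; the graph of
  the closure of a closable operator is the topological closure of the graph.\<close>

definition resolvent_set :: "('a::euclidean_space l2 \<times> 'a l2) set \<Rightarrow> complex set" where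
  "resolvent_set G = {z. \<exists>R. bounded_linear R \<and>
     (\<forall>v. (R v, v + scaleC_l2 z (R v)) \<in> G) \<and>
     (\<forall>(u, w) \<in> G. R (w - scaleC_l2 z u) = u)}"

definition spectrum :: "('a::euclidean_space l2 \<times> 'a l2) set \<Rightarrow> complex set" where
  "spectrum G = - resolvent_set G"

definition eigenspace :: "('a::euclidean_space l2 \<times> 'a l2) set \<Rightarrow> complex \<Rightarrow> 'a l2 set" where
  "eigenspace G z = {u. (u, scaleC_l2 z u) \<in> G}"

text \<open>The complex dimension of the eigenspace. The library's \<^const>\<open>vector_space.dim\<close> is \<open>0\<close> in
  infinite dimension, hence the supremum in \<^typ>\<open>enat\<close>.\<close>

definition multiplicity_of :: "('a::euclidean_space l2 \<times> 'a l2) set \<Rightarrow> complex \<Rightarrow> enat" where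
  "multiplicity_of G z =
     (SUP B \<in> {B. finite B \<and> B \<subseteq> eigenspace G z \<and> l2.independent B}. enat (card B))"

text \<open>Meaningful for operators whose spectrum consists of real eigenvalues: a spectral value that is
  not an eigenvalue would contribute \<open>0\<close>. The value is \<open>\<infinity>\<close> if infinitely many eigenvalues (with
  multiplicity) are at most \<open>r\<close>.\<close>

definition counting_function :: "('a::euclidean_space l2 \<times> 'a l2) set \<Rightarrow> real \<Rightarrow> enat" where
  "counting_function G r =
     (\<Sum>\<^sub>\<infinity>l \<in> {l::real. complex_of_real l \<in> spectrum G \<and> l \<le> r}. multiplicity_of G (of_real l))"

definition anti_hermitian :: "complex^'d^'d \<Rightarrow> bool" where
  "anti_hermitian A \<longleftrightarrow> (\<forall>j k. cnj (A $ k $ j) = - (A $ j $ k))"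

text \<open>Algebraic multiplicity, i.e. as roots of the characteristic polynomial.\<close>

definition eigenvalue_list :: "complex^'d^'d \<Rightarrow> ('d \<Rightarrow> complex) \<Rightarrow> bool" where
  "eigenvalue_list A e \<longleftrightarrow> (\<forall>z. det (mat z - A) = (\<Prod>j\<in>UNIV. z - e j))"

definition partial_deriv :: "'d \<Rightarrow> (real^'d \<Rightarrow> complex) \<Rightarrow> real^'d \<Rightarrow> complex" where
  "partial_deriv j f x = vector_derivative (\<lambda>t. f (x + t *\<^sub>R axis j 1)) (at 0)"

abbreviation iterated_partial :: "'d list \<Rightarrow> (real^'d \<Rightarrow> complex) \<Rightarrow> real^'d \<Rightarrow> complex" where
  "iterated_partial js f \<equiv> foldr partial_deriv js f"

text \<open>A function is smooth iff all its iterated partial derivatives are (totally)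
  differentiable, since differentiable functions are continuous.\<close>

definition schwartz :: "(real^'d \<Rightarrow> complex) set" where
  "schwartz = {f. \<forall>js.
     (\<forall>x. iterated_partial js f differentiable (at x)) \<and>
     (\<forall>\<alpha> :: 'd \<Rightarrow> nat.
        bounded (range (\<lambda>x. (\<Prod>i\<in>UNIV. (x $ i) ^ \<alpha> i) *\<^sub>R iterated_partial js f x)))}"

text \<open>The real matrices \<open>B\<close> and \<open>C\<close> are given by \<open>A = B - \<i>C\<close>. The domain of the
  operator is \<^const>\<open>schwartz\<close>; its closure is \<open>H_graph\<close> below.\<close>

definition H_op :: "complex^'d^'d \<Rightarrow> (real^'d \<Rightarrow> complex) \<Rightarrow> real^'d \<Rightarrow> complex" where
  "H_op A f x =
    (let B = (\<lambda>j k. complex_of_real (Re (A $ j $ k)));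
         C = (\<lambda>j k. complex_of_real (- Im (A $ j $ k)));
         X = (\<lambda>j. complex_of_real (x $ j))
     in 1 / 2 * (\<Sum>j\<in>UNIV. \<Sum>k\<in>UNIV.
            C j k * (- partial_deriv j (partial_deriv k f) x + X j * X k * f x))
        + \<i> / 2 * (\<Sum>j\<in>UNIV. \<Sum>k\<in>UNIV.
            B j k * (X k * partial_deriv j f x - X j * partial_deriv k f x)))"

definition H_graph :: "complex^'d^'d \<Rightarrow> ((real^'d) l2 \<times> (real^'d) l2) set" where
  "H_graph A = closure ((\<lambda>f. (to_l2 f, to_l2 (H_op A f))) ` schwartz)"

text \<open>For \<open>F\<close> spanning an affine hyperplane, the Euclidean \<open>(d-1)\<close>-dimensional volume is the
  Lebesgue measure of the right prism of height \<open>1\<close> over \<open>F\<close>.\<close>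

definition direction_space :: "(real^'d) set \<Rightarrow> (real^'d) set" where
  "direction_space F = span {y - z | y z. y \<in> F \<and> z \<in> F}"

definition prism :: "(real^'d) set \<Rightarrow> real^'d \<Rightarrow> (real^'d) set" where
  "prism F n = {y + t *\<^sub>R n | y t. y \<in> F \<and> 0 \<le> t \<and> t \<le> 1}"

definition hyperplane_volume :: "(real^'d) set \<Rightarrow> (real^'d) set \<Rightarrow> real" where
  "hyperplane_volume L F = measure lebesgue
     (prism F (SOME n. norm n = 1 \<and> (\<forall>v\<in>L. n \<bullet> v = 0)))"

text \<open>\<open>V\<close> is a \<open>\<int>\<close>-basis of the lattice of integer points of the subspace \<open>L\<close>.\<close>

definition lattice_basis :: "(real^'d) set \<Rightarrow> (real^'d) set \<Rightarrow> bool" where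
  "lattice_basis L V \<longleftrightarrow> independent V \<and>
     {y \<in> L. \<forall>i. y $ i \<in> \<int>} = {\<Sum>v\<in>V. of_int (a v) *\<^sub>R v | a :: real^'d \<Rightarrow> int. True}"

definition fundamental_cell :: "(real^'d) set \<Rightarrow> (real^'d) set" where
  "fundamental_cell V = {\<Sum>v\<in>V. t v *\<^sub>R v | t. \<forall>v\<in>V. 0 \<le> t v \<and> t v \<le> 1}"

text \<open>The \<open>(d-1)\<close>-volume of a facet of a rational polytope, in the normalization of Ehrhart
  theory: a fundamental cell of the lattice of integer vectors parallel to the facet has volume
  \<open>1\<close>. (For facets in coordinate hyperplanes this is the Euclidean volume. For the others it is
  not, and the Euclidean volume would not give the second Ehrhart coefficient: the triangle with
  vertices \<open>(0,0)\<close>, \<open>(1,0)\<close>, \<open>(0,1)\<close> has Ehrhart polynomial \<open>(k+1)(k+2)/2\<close>.)\<close>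

definition facet_volume :: "(real^'d) set \<Rightarrow> real" where
  "facet_volume F = (let L = direction_space F in
     hyperplane_volume L F / hyperplane_volume L (fundamental_cell (SOME V. lattice_basis L V)))"

definition boundary_volume :: "(real^'d) set \<Rightarrow> real" where
  "boundary_volume P = (\<Sum>F | F facet_of P. facet_volume F)"

definition weighted_simplex :: "('d \<Rightarrow> int) \<Rightarrow> int \<Rightarrow> (real^'d) set" where
  "weighted_simplex p q =
     {y. (\<forall>j. 0 \<le> y $ j) \<and> - (\<Sum>j\<in>UNIV. y $ j * of_int (p j)) \<le> of_int q}"

end

theory Submission
  imports Defs "HOL-Probability.Probability"
begin

text \<open>Diagonalising \<open>i A\<close> by a unitary matrix turns \<open>H\<^sub>A\<close> into \<open>\<Sum>j. - s\<^sub>j b\<^sub>j\<^sup>* b\<^sub>j + e\<close>, where the \<open>b\<^sub>j\<close> are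
  annihilation operators and \<open>e = i tr(A) / 2\<close>. The states obtained from the Gaussian by applying the
  \<open>b\<^sub>j\<^sup>*\<close> are eigenfunctions indexed by multisets; they span all polynomials times the Gaussian, which
  are dense in \<open>L\<^sup>2\<close> by uniqueness of Fourier transforms. Hence \<open>N\<^sub>A(r)\<close> counts the
  \<open>n \<in> \<nat>\<^sub>0\<^sup>d\<close> with \<open>- \<Sum>j. p\<^sub>j n\<^sub>j \<le> q t\<close>, and it remains to count lattice points in integer dilates
  of the simplex. Writing \<open>n\<^sub>j = m\<^sub>j q / (- p\<^sub>j) + r\<^sub>j\<close> with \<open>0 \<le> r\<^sub>j < q / (- p\<^sub>j)\<close> splits the count into
  sums of binomial coefficients, polynomial in the dilation factor. The second coefficient depends on
  the average of \<open>\<lceil>- \<Sum>j. p\<^sub>j r\<^sub>j / q\<rceil>\<close>, which follows from the symmetry \<open>r \<mapsto> - r\<close> up to the proportion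
  of residue vectors whose weight is divisible by \<open>q\<close>; that proportion accounts for the slanted
  facet, whose volume is measured relative to the lattice of its hyperplane.\<close>

subsection \<open>The Hilbert space \<open>L\<^sup>2\<close>\<close>

text \<open>The diagonalising unitary has complex entries, so it acts on \<open>real^'d\<close> by
  no change of variables; it is applied to the creation and annihilation operators instead
  (\<open>raise\<close>, \<open>lower\<close>), and the same Gaussian stays the common ground state.
  The spectrum is read off the closed graph itself: if a closed graph contains the finite
  combinations of a complete orthonormal system of eigenvectors, and pairing with each eigenvector
  turns the operator into multiplication by its eigenvalue, then the resolvent is the multiplier 1 /
  (mu - z), and the eigenspaces are visible in the coefficients. The pairing condition rests on
  integration by parts between a polynomial times the Gaussian and a Schwartz function, where the
  first factor supplies all the decay. In the arithmetic part, the second Ehrhart coefficient and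
  the boundary volume are brought independently to one closed form in the sides q / (- p_j) and gcd
  / q. The gcd enters the count as the step between attained levels modulo q, and the geometry as
  the divisor that makes the normal vector of the slanted facet primitive.\<close>

lemma obtain_to_l2:
  obtains f where "square_integrable f" "u = to_l2 f"
proof -
  have "l2_rel (rep_l2 u) (rep_l2 u)" and "abs_l2 (rep_l2 u) = u"
    using Quotient3_abs_rep[OF Quotient3_l2] Quotient3_rep_reflp[OF Quotient3_l2] by blast+
  then show thesis
    using that[of "rep_l2 u"] by (simp add: to_l2_def l2_rel_def)
qed

lemma l2_rel_refl: "square_integrable f \<Longrightarrow> l2_rel f f"
  by (simp add: l2_rel_def)

lemma to_l2_add:
  "square_integrable f \<Longrightarrow> square_integrable g \<Longrightarrow> to_l2 f + to_l2 g = to_l2 (\<lambda>x. f x + g x)"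
  unfolding to_l2_def by (rule plus_l2.abs_eq) (simp_all add: l2_rel_refl)

lemma to_l2_cmult:
  "square_integrable f \<Longrightarrow> scaleC_l2 c (to_l2 f) = to_l2 (\<lambda>x. c * f x)"
  unfolding to_l2_def by (rule scaleC_l2.abs_eq) (simp add: l2_rel_refl)

lemma to_l2_zero: "to_l2 (\<lambda>x. 0) = 0"
  unfolding to_l2_def by (rule zero_l2.abs_eq[symmetric])

lemma square_integrable_diff:
  "square_integrable f \<Longrightarrow> square_integrable g \<Longrightarrow> square_integrable (\<lambda>x. f x - g x)"
  using square_integrable_add[of f "\<lambda>x. - 1 * g x"] square_integrable_cmult[of g "-1"] by simp

lemma scaleR_eq_scaleC_l2: "scaleR r u = scaleC_l2 (of_real r) u"
  by transfer (simp add: l2_rel_def square_integrable_cmult)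

lemma to_l2_diff:
  assumes "square_integrable f" "square_integrable g"
  shows "to_l2 f - to_l2 g = to_l2 (\<lambda>x. f x - g x)"
proof -
  have "to_l2 (\<lambda>x. f x - g x) + to_l2 g = to_l2 f"
    using assms by (simp add: to_l2_add square_integrable_diff)
  then show ?thesis by (rule eq_diff_eq[THEN iffD2, symmetric])
qed

lemma to_l2_eq_0_iff:
  "square_integrable f \<Longrightarrow> to_l2 f = 0 \<longleftrightarrow> (AE x in lborel. f x = 0)"
  unfolding to_l2_zero[symmetric] to_l2_def
  using Quotient3_rel_abs[OF Quotient3_l2] Quotient3_rel[OF Quotient3_l2, of f "\<lambda>x. 0"]
  by (auto simp: l2_rel_def square_integrable_zero)

lemma norm_to_l2_power2:
  "square_integrable f \<Longrightarrow> (norm (to_l2 f))\<^sup>2 = (LINT x|lborel. (cmod (f x))\<^sup>2)"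
  by (simp add: norm_l2_eq integral_nonneg_AE)

lemma nn_integral_to_l2:
  assumes "square_integrable f"
  shows "(\<integral>\<^sup>+x. ennreal ((cmod (f x))\<^sup>2) \<partial>lborel) = ennreal ((norm (to_l2 f))\<^sup>2)"
  using assms unfolding norm_to_l2_power2[OF assms]
  by (intro nn_integral_eq_integral) (auto simp: square_integrable_def)

lemma borel_measurable_cnj [measurable]: "cnj \<in> borel_measurable borel"
  by (intro borel_measurable_continuous_onI continuous_intros)

text \<open>The class inner product is only the real part. Complex coefficients and complex
  dimensions require the full Hermitian product, here conjugate-linear in its first
  argument.\<close>

lift_definition cinner_l2 :: "'a::euclidean_space l2 \<Rightarrow> 'a l2 \<Rightarrow> complex" is
  "\<lambda>f g. LINT x|lborel. cnj (f x) * g x"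
proof -
  fix f f' g g' :: "'a \<Rightarrow> complex"
  assume *: "l2_rel f f'" "l2_rel g g'"
  then have "AE x in lborel. f x = f' x" "AE x in lborel. g x = g' x"
    by (simp_all add: l2_rel_def)
  then have "AE x in lborel. cnj (f x) * g x = cnj (f' x) * g' x"
    by eventually_elim simp
  moreover have "f \<in> borel_measurable borel" "f' \<in> borel_measurable borel"
    "g \<in> borel_measurable borel" "g' \<in> borel_measurable borel"
    using * by (auto simp: l2_rel_def square_integrable_def)
  ultimately show "(LINT x|lborel. cnj (f x) * g x) = (LINT x|lborel. cnj (f' x) * g' x)"
    by (intro integral_cong_AE) (simp_all, measurable)
qed

lemma square_integrable_cnj_mult:
  assumes "square_integrable f" "square_integrable g"
  shows "integrable lborel (\<lambda>x. cnj (f x) * g x)"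
proof -
  \<comment> \<open>Both parts of \<open>cnj a * b\<close> are real inner products: the imaginary
    part is that of \<open>\<i> * a\<close> with \<open>b\<close>.\<close>
  have "integrable lborel (\<lambda>x. f x \<bullet> g x)" "integrable lborel (\<lambda>x. (\<i> * f x) \<bullet> g x)"
    using assms by (auto intro: square_integrable_inner square_integrable_cmult)
  then have "integrable lborel (\<lambda>x. complex_of_real (f x \<bullet> g x) + \<i> * complex_of_real ((\<i> * f x) \<bullet> g x))"
    by auto
  moreover have "complex_of_real (a \<bullet> b) + \<i> * complex_of_real ((\<i> * a) \<bullet> b) = cnj a * b" for a b
    by (simp add: complex_eq_iff inner_complex_def)
  ultimately show ?thesis by simp
qed

lemma cinner_to_l2:
  "square_integrable f \<Longrightarrow> square_integrable g \<Longrightarrow>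
     cinner_l2 (to_l2 f) (to_l2 g) = (LINT x|lborel. cnj (f x) * g x)"
  unfolding to_l2_def by (rule cinner_l2.abs_eq) (simp_all add: l2_rel_refl)

lemma cinner_add_right: "cinner_l2 u (v + w) = cinner_l2 u v + cinner_l2 u w"
  by transfer (simp add: l2_rel_def distrib_left square_integrable_cnj_mult)

lemma cinner_scale_right: "cinner_l2 u (scaleC_l2 c v) = c * cinner_l2 u v"
  by transfer (simp add: mult.left_commute)

lemma cinner_cnj: "cnj (cinner_l2 u v) = cinner_l2 v u"
proof transfer
  fix f g :: "'a \<Rightarrow> complex"
  show "cnj (LINT x|lborel. cnj (f x) * g x) = (LINT x|lborel. cnj (g x) * f x)"
    using Bochner_Integration.integral_cnj[of lborel "\<lambda>x. cnj (f x) * g x"] by (simp add: mult.commute)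
qed

lemma cinner_scale_left: "cinner_l2 (scaleC_l2 c v) u = cnj c * cinner_l2 v u"
  by (metis cinner_scale_right cinner_cnj complex_cnj_mult)

lemma Re_cinner: "Re (cinner_l2 u v) = u \<bullet> v"
proof transfer
  fix f g :: "'a \<Rightarrow> complex" assume "l2_rel f f" "l2_rel g g"
  then have "integrable lborel (\<lambda>x. cnj (f x) * g x)"
    by (simp add: l2_rel_def square_integrable_cnj_mult)
  then have "Re (LINT x|lborel. cnj (f x) * g x) = (LINT x|lborel. Re (cnj (f x) * g x))"
    by (rule integral_Re[symmetric])
  then show "Re (LINT x|lborel. cnj (f x) * g x) = (LINT x|lborel. f x \<bullet> g x)"
    by (simp add: inner_complex_def)
qed

lemma cinner_self: "cinner_l2 u u = of_real ((norm u)\<^sup>2)"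
  by (metis Re_cinner Reals_cnj_iff cinner_cnj complex_is_Real_iff of_real_Re power2_norm_eq_inner)

lemma norm_scaleC_l2: "norm (scaleC_l2 c u) = cmod c * norm u"
proof -
  have "complex_of_real ((norm (scaleC_l2 c u))\<^sup>2) = cnj c * c * of_real ((norm u)\<^sup>2)"
    by (simp only: cinner_self[symmetric] cinner_scale_left cinner_scale_right mult.assoc)
       (simp add: cinner_self mult_ac)
  also have "cnj c * c = of_real ((cmod c)\<^sup>2)"
    by (metis complex_norm_square mult.commute)
  finally have "complex_of_real ((norm (scaleC_l2 c u))\<^sup>2) = of_real ((cmod c * norm u)\<^sup>2)"
    by (simp add: power_mult_distrib)
  then have "(norm (scaleC_l2 c u))\<^sup>2 = (cmod c * norm u)\<^sup>2"
    using of_real_eq_iff by blast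
  then show ?thesis
    by (simp add: power2_eq_iff_nonneg)
qed

text \<open>Multiplying \<open>u\<close> by the phase of the product makes the product real and
  nonnegative, which reduces the claim to the real Cauchy-Schwarz inequality.\<close>

lemma cmod_cinner_le: "cmod (cinner_l2 u v) \<le> norm u * norm v"
proof (cases "cinner_l2 u v = 0")
  case False
  define c where "c = cinner_l2 u v / cmod (cinner_l2 u v)"
  have c: "cmod c = 1" using False by (simp add: c_def norm_divide)
  have "cinner_l2 (scaleC_l2 c u) v = cmod (cinner_l2 u v)"
    using False
    by (simp add: cinner_scale_left c_def complex_norm_square[symmetric] power2_eq_square
        field_simps)
  then have "cmod (cinner_l2 u v) = scaleC_l2 c u \<bullet> v"
    by (metis Re_cinner Re_complex_of_real)
  also have "\<dots> \<le> norm (scaleC_l2 c u) * norm v"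
    by (rule norm_cauchy_schwarz)
  finally show ?thesis by (simp add: norm_scaleC_l2 c)
qed simp

lemma bounded_linear_cinner_right: "bounded_linear (cinner_l2 u)"
proof (rule bounded_linear_intro)
  show "cmod (cinner_l2 u v) \<le> norm v * norm u" for v
    using cmod_cinner_le[of u v] by (simp add: mult.commute)
qed (simp_all add: cinner_add_right scaleR_eq_scaleC_l2 cinner_scale_right scaleR_conv_of_real)

lemma bounded_linear_scaleC_l2: "bounded_linear (scaleC_l2 c :: 'a::euclidean_space l2 \<Rightarrow> _)"
proof (rule bounded_linear_intro)
  show "norm (scaleC_l2 c v) \<le> norm v * cmod c" for v :: "'a l2"
    by (simp add: norm_scaleC_l2 mult.commute)
qed (simp_all add: l2.scale_right_distrib scaleR_eq_scaleC_l2 mult.commute)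

lemma cinner_sum_right: "cinner_l2 u (sum f F) = (\<Sum>i\<in>F. cinner_l2 u (f i))"
  by (rule linear_sum) (simp add: bounded_linear.linear bounded_linear_cinner_right)

text \<open>Riesz--Fischer: along a subsequence with \<open>\<parallel>f\<^sub>k\<^sub>+\<^sub>1 - f\<^sub>k\<parallel> \<le> 4\<^sup>-\<^sup>k\<close> the sum
  \<open>\<Sum>k. 4\<^sup>k |f\<^sub>k\<^sub>+\<^sub>1 - f\<^sub>k|\<^sup>2\<close> has finite integral, so the functions converge almost everywhere;
  Fatou's lemma then gives convergence in norm.\<close>

lemma square_integrable_AE_lim:
  fixes f :: "nat \<Rightarrow> 'a::euclidean_space \<Rightarrow> complex"
  assumes f: "\<And>k. square_integrable (f k)"
    and le: "\<And>k. norm (to_l2 (f (Suc k)) - to_l2 (f k)) \<le> (1/4) ^ k"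
  shows "AE x in lborel. convergent (\<lambda>k. f k x)"
proof -
  have fm [measurable]: "f k \<in> borel_measurable borel" for k
    using f[of k] by (simp add: square_integrable_def)
  have "(\<integral>\<^sup>+x. (\<Sum>k. ennreal (4 ^ k * (cmod (f (Suc k) x - f k x))\<^sup>2)) \<partial>lborel)
      = (\<Sum>k. \<integral>\<^sup>+x. ennreal (4 ^ k * (cmod (f (Suc k) x - f k x))\<^sup>2) \<partial>lborel)"
    by (rule nn_integral_suminf) simp
  also have "\<dots> \<le> (\<Sum>k. ennreal ((1/4) ^ k))"
  proof (intro suminf_le allI summableI)
    fix k
    have "(\<integral>\<^sup>+x. ennreal (4 ^ k * (cmod (f (Suc k) x - f k x))\<^sup>2) \<partial>lborel)
        = ennreal (4 ^ k) * (\<integral>\<^sup>+x. ennreal ((cmod (f (Suc k) x - f k x))\<^sup>2) \<partial>lborel)"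
      by (subst nn_integral_cmult[symmetric]) (auto simp: ennreal_mult intro!: nn_integral_cong)
    also have "\<dots> = ennreal (4 ^ k * (norm (to_l2 (f (Suc k)) - to_l2 (f k)))\<^sup>2)"
      by (subst nn_integral_to_l2)
         (auto simp: square_integrable_diff f to_l2_diff ennreal_mult)
    also have "\<dots> \<le> ennreal (4 ^ k * ((1/4) ^ k)\<^sup>2)"
      by (intro ennreal_leI mult_left_mono power_mono le) auto
    also have "(4::real) ^ k * ((1/4) ^ k)\<^sup>2 = (1/4) ^ k"
      by (simp add: power2_eq_square power_mult_distrib[symmetric] mult.assoc[symmetric])
    finally show "(\<integral>\<^sup>+x. ennreal (4 ^ k * (cmod (f (Suc k) x - f k x))\<^sup>2) \<partial>lborel)
        \<le> ennreal ((1/4) ^ k)" .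
  qed
  also have "\<dots> = ennreal (\<Sum>k. (1/4) ^ k)"
    by (rule suminf_ennreal2) (auto intro!: summable_geometric)
  finally have "(\<integral>\<^sup>+x. (\<Sum>k. ennreal (4 ^ k * (cmod (f (Suc k) x - f k x))\<^sup>2)) \<partial>lborel) \<noteq> \<infinity>"
    by (auto simp: top_unique)
  then have "AE x in lborel. (\<Sum>k. ennreal (4 ^ k * (cmod (f (Suc k) x - f k x))\<^sup>2)) \<noteq> \<infinity>"
    by (intro nn_integral_PInf_AE) simp_all
  then show ?thesis
  proof eventually_elim
    fix x
    assume "(\<Sum>k. ennreal (4 ^ k * (cmod (f (Suc k) x - f k x))\<^sup>2)) \<noteq> \<infinity>"
    then have "summable (\<lambda>k. 4 ^ k * (cmod (f (Suc k) x - f k x))\<^sup>2)"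
      by (intro summable_suminf_not_top) auto
    then have "(\<lambda>k. 4 ^ k * (cmod (f (Suc k) x - f k x))\<^sup>2) \<longlonglongrightarrow> 0"
      by (rule summable_LIMSEQ_zero)
    then have "eventually (\<lambda>k. 4 ^ k * (cmod (f (Suc k) x - f k x))\<^sup>2 < 1) sequentially"
      by (rule order_tendstoD) simp
    then have "eventually (\<lambda>k. norm (f (Suc k) x - f k x) \<le> (1/2) ^ k) sequentially"
    proof eventually_elim
      fix k assume *: "4 ^ k * (cmod (f (Suc k) x - f k x))\<^sup>2 < 1"
      have "(2 ^ k * cmod (f (Suc k) x - f k x))\<^sup>2 = 4 ^ k * (cmod (f (Suc k) x - f k x))\<^sup>2"
        by (simp add: power_mult_distrib power2_eq_square flip: power_mult_distrib[of 2 2 k])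
      then have "(2 ^ k * cmod (f (Suc k) x - f k x))\<^sup>2 \<le> 1\<^sup>2" using * by simp
      then have "2 ^ k * cmod (f (Suc k) x - f k x) \<le> 1"
        by (rule power2_le_imp_le) simp
      then show "norm (f (Suc k) x - f k x) \<le> (1/2) ^ k"
        by (simp add: power_one_over field_simps)
    qed
    then have "summable (\<lambda>k. f (Suc k) x - f k x)"
      by (rule summable_comparison_test_ev) (auto intro!: summable_geometric)
    then have "convergent (\<lambda>n. \<Sum>k<n. f (Suc k) x - f k x)"
      by (simp add: summable_iff_convergent)
    then have "convergent (\<lambda>n. f 0 x + (f n x - f 0 x))"
      by (subst (asm) sum_lessThan_telescope) (intro convergent_add convergent_const)
    then show "convergent (\<lambda>n. f n x)" by simp
  qed
qed

lemma l2_Cauchy_convergent: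
  fixes X :: "nat \<Rightarrow> 'a::euclidean_space l2"
  assumes "Cauchy X"
  shows "convergent X"
proof -
  have "\<exists>s. strict_mono s \<and> (\<forall>k. \<forall>m\<ge>s k. \<forall>n\<ge>s k. norm (X m - X n) < (1/4::real) ^ k)"
  proof -
    have "\<exists>M>N. \<forall>m\<ge>M. \<forall>n\<ge>M. norm (X m - X n) < (1/4::real) ^ k" for k N
    proof -
      have "(0::real) < (1/4) ^ k" by simp
      from CauchyD[OF assms this]
      obtain M where "\<forall>m\<ge>M. \<forall>n\<ge>M. norm (X m - X n) < (1/4) ^ k" by blast
      then show ?thesis by (intro exI[of _ "Suc (max M N)"]) auto
    qed
    then have "\<exists>h. \<forall>k N. h k N > N \<and>
        (\<forall>m\<ge>h k N. \<forall>n\<ge>h k N. norm (X m - X n) < (1/4::real) ^ k)"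
      by (intro choice allI) blast
    then obtain h where h: "\<And>k N. h k N > N"
      "\<And>k N m n. m \<ge> h k N \<Longrightarrow> n \<ge> h k N \<Longrightarrow> norm (X m - X n) < (1/4::real) ^ k"
      by blast
    \<comment> \<open>As \<open>h k N > N\<close>, the recursion is strictly increasing, and its
      k-th value controls the whole tail of \<open>X\<close> at accuracy 4^(-k).\<close>
    define s where "s = rec_nat (h 0 0) (\<lambda>k. h (Suc k))"
    have "strict_mono s" by (rule strict_monoI_Suc) (simp add: s_def h)
    moreover have "norm (X m - X n) < (1/4) ^ k" if "m \<ge> s k" "n \<ge> s k" for k m n
    proof (cases k)
      case 0
      then show ?thesis using that h(2)[of 0 0 m n] by (simp add: s_def)
    next
      case (Suc j)
      then show ?thesis using that h(2)[of "Suc j" "s j" m n] by (simp add: s_def)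
    qed
    ultimately show ?thesis by blast
  qed
  then obtain s where s: "strict_mono s"
    and sX: "\<And>k m n. m \<ge> s k \<Longrightarrow> n \<ge> s k \<Longrightarrow> norm (X m - X n) < (1/4::real) ^ k"
    by blast
  have "\<forall>k. \<exists>f. square_integrable f \<and> X (s k) = to_l2 f"
    by (metis obtain_to_l2)
  then obtain f where f: "\<And>k. square_integrable (f k)" and Xf: "\<And>k. X (s k) = to_l2 (f k)"
    by metis
  have smono: "s k \<le> s m" if "k \<le> m" for k m
    using that s by (simp add: strict_mono_less_eq)
  have fd: "norm (to_l2 (f m) - to_l2 (f k)) \<le> (1/4) ^ k" if "k \<le> m" for k m
    using sX[OF smono[OF that] order.refl] by (simp add: Xf less_imp_le)
  have fm [measurable]: "f k \<in> borel_measurable borel" for k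
    using f[of k] by (simp add: square_integrable_def)
  have conv: "AE x in lborel. convergent (\<lambda>k. f k x)"
    using f fd by (intro square_integrable_AE_lim) auto
  \<comment> \<open>\<open>lim\<close> is arbitrary where the sequence diverges; by
    \<open>conv\<close> this happens only on a null set.\<close>
  define g where "g x = lim (\<lambda>k. f k x)" for x
  have gm [measurable]: "g \<in> borel_measurable borel"
    unfolding g_def by (rule borel_measurable_lim_metric) simp
  have fat: "(\<integral>\<^sup>+x. ennreal ((cmod (g x - f k x))\<^sup>2) \<partial>lborel) \<le> ennreal (((1/4) ^ k)\<^sup>2)" for k
  proof -
    have "(\<integral>\<^sup>+x. ennreal ((cmod (g x - f k x))\<^sup>2) \<partial>lborel)
        = (\<integral>\<^sup>+x. liminf (\<lambda>m. ennreal ((cmod (f m x - f k x))\<^sup>2)) \<partial>lborel)"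
    proof (rule nn_integral_cong_AE)
      show "AE x in lborel. ennreal ((cmod (g x - f k x))\<^sup>2)
              = liminf (\<lambda>m. ennreal ((cmod (f m x - f k x))\<^sup>2))"
        using conv
      proof eventually_elim
        fix x assume "convergent (\<lambda>k. f k x)"
        then have "(\<lambda>k. f k x) \<longlonglongrightarrow> g x" by (simp add: convergent_LIMSEQ_iff g_def)
        then have "(\<lambda>m. ennreal ((cmod (f m x - f k x))\<^sup>2)) \<longlonglongrightarrow> ennreal ((cmod (g x - f k x))\<^sup>2)"
          by (intro tendsto_ennrealI tendsto_intros)
        then show "ennreal ((cmod (g x - f k x))\<^sup>2)
                 = liminf (\<lambda>m. ennreal ((cmod (f m x - f k x))\<^sup>2))"
          by (intro lim_imp_Liminf[symmetric]) auto
      qed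
    qed
    also have "\<dots> \<le> liminf (\<lambda>m. \<integral>\<^sup>+x. ennreal ((cmod (f m x - f k x))\<^sup>2) \<partial>lborel)"
      by (rule nn_integral_liminf) simp
    also have "\<dots> \<le> liminf (\<lambda>m. ennreal (((1/4) ^ k)\<^sup>2))"
    proof (rule Liminf_mono)
      show "eventually (\<lambda>m. (\<integral>\<^sup>+x. ennreal ((cmod (f m x - f k x))\<^sup>2) \<partial>lborel)
                \<le> ennreal (((1/4) ^ k)\<^sup>2)) sequentially"
        using eventually_ge_at_top[of k]
      proof eventually_elim
        fix m assume "k \<le> m"
        then show "(\<integral>\<^sup>+x. ennreal ((cmod (f m x - f k x))\<^sup>2) \<partial>lborel) \<le> ennreal (((1/4) ^ k)\<^sup>2)"
          using fd[of k m]
          by (subst nn_integral_to_l2)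
             (auto simp: square_integrable_diff f to_l2_diff intro!: ennreal_leI power_mono)
      qed
    qed
    finally show ?thesis by (subst (asm) Liminf_const) simp_all
  qed
  have gf: "square_integrable (\<lambda>x. g x - f k x)" for k
    unfolding square_integrable_def
  proof
    show "integrable lborel (\<lambda>x. (cmod (g x - f k x))\<^sup>2)"
      using fat[of k] by (intro integrableI_bounded) (auto simp: less_top[symmetric] top_unique intro: le_less_trans)
  qed simp
  have g: "square_integrable g"
    using square_integrable_add[OF gf[of 0] f[of 0]] by simp
  have "norm (X (s k) - to_l2 g) \<le> (1/4) ^ k" for k
  proof -
    have "ennreal ((norm (to_l2 (\<lambda>x. g x - f k x)))\<^sup>2) \<le> ennreal (((1/4) ^ k)\<^sup>2)"
      using fat[of k] by (simp add: nn_integral_to_l2[OF gf])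
    then have "(norm (to_l2 (\<lambda>x. g x - f k x)))\<^sup>2 \<le> ((1/4) ^ k)\<^sup>2" by simp
    then have "norm (to_l2 (\<lambda>x. g x - f k x)) \<le> (1/4) ^ k" by (rule power2_le_imp_le) simp
    then show ?thesis using f g by (simp add: Xf to_l2_diff[symmetric] norm_minus_commute)
  qed
  then have "(\<lambda>k. X (s k) - to_l2 g) \<longlonglongrightarrow> 0"
    by (intro Lim_null_comparison[OF _ LIMSEQ_power_zero[of "1/4::real"]] always_eventually) auto
  then have "(X \<circ> s) \<longlonglongrightarrow> to_l2 g" by (simp add: LIM_zero_iff o_def)
  then show ?thesis
    using Cauchy_converges_subseq[OF assms s] convergentI by (metis comp_def)
qed

text \<open>Completeness turns the Cauchy nets of finite partial sums in
  \<open>summable_lincomb\<close> into convergent ones.\<close>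

instance l2 :: (euclidean_space) complete_space
  by standard (rule l2_Cauchy_convergent)

section \<open>Orthonormal expansions and closed diagonal operators\<close>

lemma cinner_diff_right: "cinner_l2 u (v - w) = cinner_l2 u v - cinner_l2 u w"
  by (rule linear_diff) (simp add: bounded_linear.linear bounded_linear_cinner_right)

lemma cinner_zero_right [simp]: "cinner_l2 u 0 = 0"
  by (rule linear_0) (simp add: bounded_linear.linear bounded_linear_cinner_right)

text \<open>Completeness of the system is expressed as triviality of the orthogonal complement, the
  form in which the Fourier argument of \<open>poly_gauss_total\<close> delivers it.\<close>

locale orthonormal_l2 =
  fixes \<phi> :: "'i \<Rightarrow> 'a::euclidean_space l2"
  assumes orthonormal: "cinner_l2 (\<phi> i) (\<phi> j) = (if i = j then 1 else 0)"
    and total: "(\<And>i. cinner_l2 (\<phi> i) v = 0) \<Longrightarrow> v = 0"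
begin

lemma cinner_lincomb:
  "finite F \<Longrightarrow> cinner_l2 (\<phi> j) (\<Sum>i\<in>F. scaleC_l2 (a i) (\<phi> i)) = (if j \<in> F then a j else 0)"
  by (simp add: cinner_sum_right cinner_scale_right orthonormal if_distrib cong: if_cong)

lemma norm_lincomb:
  assumes "finite F"
  shows "(norm (\<Sum>i\<in>F. scaleC_l2 (a i) (\<phi> i)))\<^sup>2 = (\<Sum>i\<in>F. (cmod (a i))\<^sup>2)"
proof -
  let ?w = "\<Sum>i\<in>F. scaleC_l2 (a i) (\<phi> i)"
  have "cinner_l2 ?w ?w = (\<Sum>i\<in>F. a i * cinner_l2 ?w (\<phi> i))"
    by (subst cinner_sum_right) (simp add: cinner_scale_right)
  also have "\<dots> = (\<Sum>i\<in>F. a i * cnj (a i))"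
    by (intro sum.cong) (simp_all add: cinner_lincomb assms cinner_cnj[of "\<phi> _", symmetric])
  also have "\<dots> = of_real (\<Sum>i\<in>F. (cmod (a i))\<^sup>2)"
    by (simp add: complex_norm_square[symmetric] del: of_real_power)
  finally show ?thesis
    unfolding cinner_self using of_real_eq_iff by blast
qed

text \<open>The partial expansion w satisfies v \<bullet> w = |w|^2, so Cauchy-Schwarz gives |w|
  \<le> |v|.\<close>

lemma bessel:
  assumes "finite F"
  shows "(\<Sum>i\<in>F. (cmod (cinner_l2 (\<phi> i) v))\<^sup>2) \<le> (norm v)\<^sup>2"
proof -
  let ?w = "\<Sum>i\<in>F. scaleC_l2 (cinner_l2 (\<phi> i) v) (\<phi> i)"
  let ?s = "\<Sum>i\<in>F. (cmod (cinner_l2 (\<phi> i) v))\<^sup>2"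
  have "cinner_l2 v ?w = (\<Sum>i\<in>F. cinner_l2 (\<phi> i) v * cnj (cinner_l2 (\<phi> i) v))"
    by (simp add: cinner_sum_right cinner_scale_right cinner_cnj)
  also have "\<dots> = of_real ?s"
    by (simp add: complex_norm_square[symmetric] del: of_real_power)
  finally have "v \<bullet> ?w = ?s"
    by (metis Re_cinner Re_complex_of_real)
  then have "?s \<le> norm v * norm ?w"
    using norm_cauchy_schwarz[of v ?w] by simp
  then have "(norm ?w)\<^sup>2 \<le> norm v * norm ?w"
    by (simp add: norm_lincomb assms)
  then have "norm ?w \<le> norm v"
    by (cases "norm ?w = 0") (simp_all add: power2_eq_square)
  then have "(norm ?w)\<^sup>2 \<le> (norm v)\<^sup>2" by (simp add: power_mono)
  then show ?thesis by (simp add: norm_lincomb assms)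
qed

lemma summable_coeffs: "(\<lambda>i. (cmod (cinner_l2 (\<phi> i) v))\<^sup>2) summable_on UNIV"
  by (rule nonneg_bdd_above_summable_on) (auto intro!: bdd_aboveI2[of _ _ "(norm v)\<^sup>2"] bessel)

text \<open>By Pythagoras the squared distance between two nested partial sums is a partial sum of
  the squared coefficients, so the net of finite partial sums is Cauchy.\<close>

lemma summable_lincomb:
  assumes "(\<lambda>i. (cmod (a i))\<^sup>2) summable_on UNIV"
  shows "(\<lambda>i. scaleC_l2 (a i) (\<phi> i)) summable_on UNIV"
proof -
  let ?f = "\<lambda>i. scaleC_l2 (a i) (\<phi> i)"
  have "\<exists>P. eventually P (finite_subsets_at_top UNIV) \<and>
          (\<forall>F1 F2. P F1 \<and> P F2 \<longrightarrow> dist (sum ?f F1) (sum ?f F2) < e)" if "e > 0" for e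
  proof -
    obtain s where s: "((\<lambda>i. (cmod (a i))\<^sup>2) has_sum s) UNIV"
      using assms summable_on_def by blast
    \<comment> \<open>Two sums of squares within half of (e/2)^2 of the limit \<open>s\<close>
      differ by less than (e/2)^2. Every larger partial sum is then within e/2 of the one over
      \<open>F0\<close>, and any two are within \<open>e\<close>.\<close>
    have pos: "0 < (e/2)\<^sup>2 / 2" using that by simp
    have "eventually (\<lambda>F. dist (\<Sum>i\<in>F. (cmod (a i))\<^sup>2) s < (e/2)\<^sup>2 / 2)
                 (finite_subsets_at_top UNIV)"
      by (rule tendstoD[OF s[unfolded has_sum_def] pos])
    then have "\<exists>F0. finite F0 \<and> (\<forall>F. finite F \<and> F0 \<subseteq> F \<longrightarrow>
        \<bar>(\<Sum>i\<in>F. (cmod (a i))\<^sup>2) - s\<bar> < (e/2)\<^sup>2 / 2)"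
      by (simp only: eventually_finite_subsets_at_top dist_real_def subset_UNIV simp_thms)
    then obtain F0 where F0: "finite F0"
      and "\<forall>F. finite F \<and> F0 \<subseteq> F \<longrightarrow> \<bar>(\<Sum>i\<in>F. (cmod (a i))\<^sup>2) - s\<bar> < (e/2)\<^sup>2 / 2"
      by (elim exE conjE)
    then have d: "\<bar>(\<Sum>i\<in>F. (cmod (a i))\<^sup>2) - s\<bar> < (e/2)\<^sup>2 / 2" if "finite F" "F0 \<subseteq> F" for F
      using that by simp
    have lin: "\<bar>a - s\<bar> < E/2 \<Longrightarrow> \<bar>b - s\<bar> < E/2 \<Longrightarrow> a - b < E" for a b E :: real
      by linarith
    have near: "dist (sum ?f F) (sum ?f F0) < e / 2" if F: "finite F" "F0 \<subseteq> F" for F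
    proof -
      have "sum ?f F - sum ?f F0 = sum ?f (F - F0)"
        using F by (simp add: sum_diff)
      then have "(norm (sum ?f F - sum ?f F0))\<^sup>2 = (\<Sum>i\<in>F - F0. (cmod (a i))\<^sup>2)"
        using F by (simp add: norm_lincomb)
      also have "\<dots> = (\<Sum>i\<in>F. (cmod (a i))\<^sup>2) - (\<Sum>i\<in>F0. (cmod (a i))\<^sup>2)"
        using F by (simp add: sum_diff)
      also have "\<dots> < (e/2)\<^sup>2"
        by (rule lin[OF d[OF F] d[OF F0 order.refl]])
      finally show ?thesis
        unfolding dist_norm by (rule power2_less_imp_less) (use \<open>e > 0\<close> in simp)
    qed
    have "dist (sum ?f F1) (sum ?f F2) < e"
      if "finite F1 \<and> F0 \<subseteq> F1" "finite F2 \<and> F0 \<subseteq> F2" for F1 F2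
      using near[of F1] near[of F2] that dist_triangle_half_l by blast
    moreover have "eventually (\<lambda>F. finite F \<and> F0 \<subseteq> F) (finite_subsets_at_top UNIV)"
      using F0 by (auto simp: eventually_finite_subsets_at_top)
    ultimately show ?thesis by blast
  qed
  then have "cauchy_filter (filtermap (sum ?f) (finite_subsets_at_top UNIV))"
    by (simp add: cauchy_filter_metric_filtermap)
  then obtain L where "(sum ?f \<longlongrightarrow> L) (finite_subsets_at_top UNIV)"
    using complete_uniform[THEN iffD1, OF complete_UNIV[where 'a="'a l2"]] by (force simp add: filterlim_def)
  then show ?thesis
    using summable_on_def has_sum_def by blast
qed

lemma cinner_has_sum:
  assumes "((\<lambda>i. scaleC_l2 (a i) (\<phi> i)) has_sum w) UNIV"
  shows "cinner_l2 (\<phi> j) w = a j"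
proof -
  have "((\<lambda>i. cinner_l2 (\<phi> j) (scaleC_l2 (a i) (\<phi> i))) has_sum cinner_l2 (\<phi> j) w) UNIV"
    using has_sum_bounded_linear[OF bounded_linear_cinner_right assms] by (simp add: o_def)
  then have "((\<lambda>i. if i = j then a i else 0) has_sum cinner_l2 (\<phi> j) w) UNIV"
    by (rule has_sum_cong[THEN iffD1, rotated]) (auto simp: cinner_scale_right orthonormal)
  moreover have "((\<lambda>i. if i = j then a i else 0) has_sum a j) UNIV"
    using has_sum_finite_neutralI[of "{j}" UNIV "\<lambda>i. if i = j then a i else 0" "a j"] by simp
  ultimately show ?thesis by (rule has_sum_unique)
qed

text \<open>Bessel's inequality makes the series converge; its limit has the same coefficients as
  \<open>v\<close>, and \<open>total\<close> removes the difference.\<close>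

lemma expansion: "((\<lambda>i. scaleC_l2 (cinner_l2 (\<phi> i) v) (\<phi> i)) has_sum v) UNIV"
proof -
  obtain w where w: "((\<lambda>i. scaleC_l2 (cinner_l2 (\<phi> i) v) (\<phi> i)) has_sum w) UNIV"
    using summable_lincomb[OF summable_coeffs, of v] summable_on_def by blast
  have "cinner_l2 (\<phi> j) (w - v) = 0" for j
    using cinner_has_sum[OF w, of j] by (simp add: cinner_diff_right)
  then have "w - v = 0" by (rule total)
  then have "w = v" by (rule eq_iff_diff_eq_0[THEN iffD2])
  with w show ?thesis by (simp only:)
qed

lemma eqI_cinner:
  assumes "\<And>i. cinner_l2 (\<phi> i) v = cinner_l2 (\<phi> i) w"
  shows "v = w"
proof -
  have "v - w = 0"
    by (rule total) (simp add: cinner_diff_right assms)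
  then show ?thesis by (rule eq_iff_diff_eq_0[THEN iffD2])
qed

lemma parseval: "(\<Sum>\<^sub>\<infinity>i. (cmod (cinner_l2 (\<phi> i) v))\<^sup>2) = (norm v)\<^sup>2"
proof -
  have "((\<lambda>F. (norm (\<Sum>i\<in>F. scaleC_l2 (cinner_l2 (\<phi> i) v) (\<phi> i)))\<^sup>2) \<longlongrightarrow> (norm v)\<^sup>2)
          (finite_subsets_at_top UNIV)"
    using expansion[of v] unfolding has_sum_def by (intro tendsto_power tendsto_norm)
  then have "((\<lambda>F. \<Sum>i\<in>F. (cmod (cinner_l2 (\<phi> i) v))\<^sup>2) \<longlongrightarrow> (norm v)\<^sup>2)
          (finite_subsets_at_top UNIV)"
    by (rule Lim_transform_eventually)
       (rule eventually_finite_subsets_at_top_weakI, simp add: norm_lincomb)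
  then have "((\<lambda>i. (cmod (cinner_l2 (\<phi> i) v))\<^sup>2) has_sum (norm v)\<^sup>2) UNIV"
    by (unfold has_sum_def)
  then show ?thesis by (rule infsumI)
qed

text \<open>Bounded factors preserve square summability, and Parseval's identity bounds the norm by
  \<open>K\<close>. Resolvents arise in this form; the third conclusion exposes the series, so that
  closedness of a graph can be applied to its partial sums.\<close>

lemma multiplier:
  assumes g: "\<And>i. cmod (g i) \<le> K"
  obtains R where "bounded_linear R"
    "\<And>v i. cinner_l2 (\<phi> i) (R v) = g i * cinner_l2 (\<phi> i) v"
    "\<And>v. ((\<lambda>i. scaleC_l2 (g i * cinner_l2 (\<phi> i) v) (\<phi> i)) has_sum R v) UNIV"
proof -
  have K: "K \<ge> 0" using g[of undefined] norm_ge_zero order_trans by blast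
  have bnd: "(cmod (g i * cinner_l2 (\<phi> i) v))\<^sup>2 \<le> K\<^sup>2 * (cmod (cinner_l2 (\<phi> i) v))\<^sup>2" for i v
    unfolding power_mult_distrib[symmetric] norm_mult
    by (intro power_mono mult_right_mono g) auto
  have s2: "(\<lambda>i. (cmod (g i * cinner_l2 (\<phi> i) v))\<^sup>2) summable_on UNIV" for v
    by (rule summable_on_comparison_test[OF summable_on_cmult_right[OF summable_coeffs, of "K\<^sup>2" v]])
       (use bnd in auto)
  define R where "R v = (\<Sum>\<^sub>\<infinity>i. scaleC_l2 (g i * cinner_l2 (\<phi> i) v) (\<phi> i))" for v
  have R: "((\<lambda>i. scaleC_l2 (g i * cinner_l2 (\<phi> i) v) (\<phi> i)) has_sum R v) UNIV" for v
    unfolding R_def by (intro has_sum_infsum summable_lincomb s2)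
  have c: "cinner_l2 (\<phi> i) (R v) = g i * cinner_l2 (\<phi> i) v" for i v
    by (rule cinner_has_sum[OF R])
  have "bounded_linear R"
  proof (rule bounded_linear_intro)
    show "R (v + w) = R v + R w" for v w
      by (rule eqI_cinner) (simp add: c cinner_add_right distrib_left)
    show "R (scaleR r v) = scaleR r (R v)" for r v
      by (rule eqI_cinner) (simp add: c scaleR_eq_scaleC_l2 cinner_scale_right)
    fix v
    have "(\<Sum>\<^sub>\<infinity>i. (cmod (cinner_l2 (\<phi> i) (R v)))\<^sup>2) \<le> (\<Sum>\<^sub>\<infinity>i. K\<^sup>2 * (cmod (cinner_l2 (\<phi> i) v))\<^sup>2)"
      unfolding c by (intro infsum_mono s2 summable_on_cmult_right summable_coeffs bnd)
    then have "(norm (R v))\<^sup>2 \<le> (K * norm v)\<^sup>2"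
      by (simp only: infsum_cmult_right' parseval power_mult_distrib)
    then have "norm (R v) \<le> K * norm v"
      by (rule power2_le_imp_le) (use K in simp)
    then show "norm (R v) \<le> norm v * K" by (simp add: mult.commute)
  qed
  with R c that show thesis by blast
qed

end

text \<open>\<open>lincomb_graph\<close> makes the graph large enough for a resolvent to map into
  it, and \<open>symmetric\<close> keeps it small enough for that resolvent to be a left inverse.
  \<open>finite_le\<close> makes the eigenvalues discrete and the counts finite.\<close>

locale diagonal_operator_l2 = orthonormal_l2 \<phi> for \<phi> :: "'i \<Rightarrow> 'a::euclidean_space l2" +
  fixes G :: "('a l2 \<times> 'a l2) set" and \<mu> :: "'i \<Rightarrow> real"
  assumes closed_graph: "closed G"
    and lincomb_graph: "finite F \<Longrightarrow>
      (\<Sum>i\<in>F. scaleC_l2 (a i) (\<phi> i), \<Sum>i\<in>F. scaleC_l2 (a i * of_real (\<mu> i)) (\<phi> i)) \<in> G"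
    and symmetric: "(u, w) \<in> G \<Longrightarrow> cinner_l2 (\<phi> i) w = of_real (\<mu> i) * cinner_l2 (\<phi> i) u"
    and finite_le: "finite {i. \<mu> i \<le> r}"
begin

lemma has_sum_graph:
  assumes u: "((\<lambda>i. scaleC_l2 (a i) (\<phi> i)) has_sum u) UNIV"
    and w: "((\<lambda>i. scaleC_l2 (a i * of_real (\<mu> i)) (\<phi> i)) has_sum w) UNIV"
  shows "(u, w) \<in> G"
proof (rule Lim_in_closed_set[OF closed_graph])
  show "((\<lambda>F. (\<Sum>i\<in>F. scaleC_l2 (a i) (\<phi> i), \<Sum>i\<in>F. scaleC_l2 (a i * of_real (\<mu> i)) (\<phi> i)))
           \<longlongrightarrow> (u, w)) (finite_subsets_at_top UNIV)"
    using u w unfolding has_sum_def by (rule tendsto_Pair)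
  show "eventually (\<lambda>F. (\<Sum>i\<in>F. scaleC_l2 (a i) (\<phi> i),
           \<Sum>i\<in>F. scaleC_l2 (a i * of_real (\<mu> i)) (\<phi> i)) \<in> G) (finite_subsets_at_top UNIV)"
    using lincomb_graph by (auto simp: eventually_finite_subsets_at_top)
qed simp

lemma eigenvector_graph: "(\<phi> i, scaleC_l2 (of_real (\<mu> i)) (\<phi> i)) \<in> G"
  using lincomb_graph[of "{i}" "\<lambda>_. 1"] by simp

text \<open>Only finitely many indices satisfy \<mu> i \<le> Re z + 1; all others are at distance at
  least 1 from \<open>z\<close>, so a minimum over a finite set that includes 1 serves as
  bound.\<close>

lemma dist_spectrum:
  assumes "z \<notin> range (\<lambda>i. complex_of_real (\<mu> i))"
  obtains \<delta> where "\<delta> > 0" "\<And>i. cmod (of_real (\<mu> i) - z) \<ge> \<delta>"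
proof -
  let ?I = "{i. \<mu> i \<le> Re z + 1}"
  define D where "D = insert 1 ((\<lambda>i. cmod (of_real (\<mu> i) - z)) ` ?I)"
  have D: "finite D" using finite_le by (simp add: D_def)
  have "Min D > 0"
    using assms by (subst Min_gr_iff) (auto simp: D finite_le D_def)
  moreover have "cmod (of_real (\<mu> i) - z) \<ge> Min D" for i
  proof (cases "i \<in> ?I")
    case True
    then show ?thesis using D by (intro Min_le) (auto simp: D_def)
  next
    case False
    then have "1 \<le> Re (of_real (\<mu> i) - z)" by simp
    also have "\<dots> \<le> cmod (of_real (\<mu> i) - z)" by (rule complex_Re_le_cmod)
    finally have "1 \<le> cmod (of_real (\<mu> i) - z)" .
    moreover have "Min D \<le> 1" using D by (intro Min_le) (simp_all add: D_def)
    ultimately show ?thesis by (rule order_trans[rotated])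
  qed
  ultimately show thesis by (rule that)
qed

text \<open>At an eigenvalue the required left inverse would send 0 to the eigenvector. Elsewhere
  the multiplier by 1 / (\<mu> i - z) is a right inverse because the graph is closed, and a left
  inverse by comparison of coefficients.\<close>

lemma spectrum_eq: "spectrum G = range (\<lambda>i. complex_of_real (\<mu> i))"
proof -
  have "complex_of_real (\<mu> i) \<notin> resolvent_set G" for i
  proof
    assume "complex_of_real (\<mu> i) \<in> resolvent_set G"
    then obtain R where "bounded_linear R"
      and R: "\<And>u w. (u, w) \<in> G \<Longrightarrow> R (w - scaleC_l2 (of_real (\<mu> i)) u) = u"
      unfolding resolvent_set_def by blast
    from R[OF eigenvector_graph, of i] have "\<phi> i = 0"
      by (simp add: linear_simps(3)[OF \<open>bounded_linear R\<close>])
    then show False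
      using orthonormal[of i i] by simp
  qed
  moreover have "z \<in> resolvent_set G" if z: "z \<notin> range (\<lambda>i. complex_of_real (\<mu> i))" for z
  proof -
    obtain \<delta> where \<delta>: "\<delta> > 0" "\<And>i. cmod (of_real (\<mu> i) - z) \<ge> \<delta>"
      using dist_spectrum[OF z] by blast
    have ne: "complex_of_real (\<mu> i) - z \<noteq> 0" for i using z by auto
    have "cmod (inverse (of_real (\<mu> i) - z)) \<le> inverse \<delta>" for i
      using \<delta> by (simp add: norm_inverse le_imp_inverse_le)
    then obtain R where R: "bounded_linear R"
      and c: "\<And>v i. cinner_l2 (\<phi> i) (R v) = inverse (of_real (\<mu> i) - z) * cinner_l2 (\<phi> i) v"
      and sum: "\<And>v. ((\<lambda>i. scaleC_l2 (inverse (of_real (\<mu> i) - z) * cinner_l2 (\<phi> i) v) (\<phi> i))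
                  has_sum R v) UNIV"
      using multiplier[of "\<lambda>i. inverse (of_real (\<mu> i) - z)"] by blast
    have "(R v, v + scaleC_l2 z (R v)) \<in> G" for v
    proof (rule has_sum_graph[OF sum])
      have "((\<lambda>i. scaleC_l2 (cinner_l2 (\<phi> i) v) (\<phi> i) +
               scaleC_l2 z (scaleC_l2 (inverse (of_real (\<mu> i) - z) * cinner_l2 (\<phi> i) v) (\<phi> i)))
              has_sum v + scaleC_l2 z (R v)) UNIV"
        using has_sum_bounded_linear[OF bounded_linear_scaleC_l2 sum, of z v]
        by (intro has_sum_add expansion) (simp add: o_def)
      moreover have "scaleC_l2 b (\<phi> i) + scaleC_l2 z (scaleC_l2 (inverse (of_real (\<mu> i) - z) * b) (\<phi> i))
          = scaleC_l2 (inverse (of_real (\<mu> i) - z) * b * of_real (\<mu> i)) (\<phi> i)" for i b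
        using ne[of i] by (simp add: l2.scale_left_distrib[symmetric] field_simps)
      ultimately show "((\<lambda>i. scaleC_l2 (inverse (of_real (\<mu> i) - z) * cinner_l2 (\<phi> i) v * of_real (\<mu> i)) (\<phi> i))
            has_sum v + scaleC_l2 z (R v)) UNIV"
        by simp
    qed
    moreover have "R (w - scaleC_l2 z u) = u" if "(u, w) \<in> G" for u w
    proof (rule eqI_cinner)
      fix i
      have "cinner_l2 (\<phi> i) (w - scaleC_l2 z u) = (of_real (\<mu> i) - z) * cinner_l2 (\<phi> i) u"
        by (simp add: cinner_diff_right symmetric[OF that] cinner_scale_right left_diff_distrib)
      then show "cinner_l2 (\<phi> i) (R (w - scaleC_l2 z u)) = cinner_l2 (\<phi> i) u"
        using ne[of i] by (simp add: c)
    qed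
    ultimately show ?thesis
      unfolding resolvent_set_def using R by blast
  qed
  ultimately show ?thesis
    unfolding spectrum_def by blast
qed

lemma inj_basis: "inj \<phi>"
proof (rule injI)
  fix i j assume "\<phi> i = \<phi> j"
  then have "cinner_l2 (\<phi> i) (\<phi> i) = cinner_l2 (\<phi> i) (\<phi> j)" by simp
  then show "i = j" by (simp add: orthonormal split: if_splits)
qed

lemma independent_basis: "finite F \<Longrightarrow> l2.independent (\<phi> ` F)"
proof (rule l2.independent_if_scalars_zero)
  fix f v assume F: "finite F" and s: "(\<Sum>v\<in>\<phi> ` F. scaleC_l2 (f v) v) = 0" and "v \<in> \<phi> ` F"
  then obtain i where i: "i \<in> F" "v = \<phi> i" by blast
  have "(\<Sum>v\<in>\<phi> ` F. scaleC_l2 (f v) v) = (\<Sum>i\<in>F. scaleC_l2 (f (\<phi> i)) (\<phi> i))"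
    by (rule sum.reindex_cong[OF inj_on_subset[OF inj_basis]]) auto
  then have "cinner_l2 (\<phi> i) 0 = f v"
    using cinner_lincomb[OF F, of i "\<lambda>i. f (\<phi> i)"] s i by simp
  then show "f v = 0" by simp
qed simp

text \<open>Pairing the eigenvalue equation with \<open>\<phi> i\<close> kills every coefficient
  with \<mu> i \<noteq> l, and only finitely many indices remain.\<close>

lemma eigenspace_subset_span:
  "eigenspace G (complex_of_real l) \<subseteq> l2.span (\<phi> ` {i. \<mu> i = l})"
proof
  fix u assume "u \<in> eigenspace G (complex_of_real l)"
  then have "(u, scaleC_l2 (of_real l) u) \<in> G" by (simp add: eigenspace_def)
  then have "complex_of_real l * cinner_l2 (\<phi> i) u = of_real (\<mu> i) * cinner_l2 (\<phi> i) u" for i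
    using symmetric cinner_scale_right by metis
  then have c: "cinner_l2 (\<phi> i) u = 0" if "\<mu> i \<noteq> l" for i
    using that by (metis mult_right_cancel of_real_eq_iff)
  have fin: "finite {i. \<mu> i = l}"
    by (rule finite_subset[OF _ finite_le[of l]]) auto
  have "u = (\<Sum>i | \<mu> i = l. scaleC_l2 (cinner_l2 (\<phi> i) u) (\<phi> i))"
  proof (rule eqI_cinner)
    fix i
    show "cinner_l2 (\<phi> i) u = cinner_l2 (\<phi> i) (\<Sum>i | \<mu> i = l. scaleC_l2 (cinner_l2 (\<phi> i) u) (\<phi> i))"
      unfolding cinner_lincomb[OF fin] using c[of i] by auto
  qed
  moreover have "(\<Sum>i | \<mu> i = l. scaleC_l2 (cinner_l2 (\<phi> i) u) (\<phi> i)) \<in> l2.span (\<phi> ` {i. \<mu> i = l})"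
    by (intro l2.span_sum l2.span_scale l2.span_base) simp
  ultimately show "u \<in> l2.span (\<phi> ` {i. \<mu> i = l})"
    by (rule ssubst[where P = "\<lambda>x. x \<in> _"])
qed

text \<open>The eigenvectors with value \<open>l\<close> are themselves an admissible independent
  set, and no independent subset of their span is larger, so the supremum is attained.\<close>

lemma multiplicity_eq: "multiplicity_of G (complex_of_real l) = enat (card {i. \<mu> i = l})"
proof -
  let ?I = "{i. \<mu> i = l}"
  have fin: "finite ?I"
    by (rule finite_subset[OF _ finite_le[of l]]) auto
  show ?thesis unfolding multiplicity_of_def
  proof (rule antisym)
    show "(SUP B\<in>{B. finite B \<and> B \<subseteq> eigenspace G (complex_of_real l) \<and> l2.independent B}. enat (card B))
        \<le> enat (card ?I)"
    proof (rule SUP_least)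
      fix B assume B: "B \<in> {B. finite B \<and> B \<subseteq> eigenspace G (complex_of_real l) \<and> l2.independent B}"
      then have "B \<subseteq> l2.span (\<phi> ` ?I)"
        using eigenspace_subset_span by blast
      then have "card B \<le> card (\<phi> ` ?I)"
        using B fin l2.independent_span_bound[of "\<phi> ` ?I" B] by simp
      then show "enat (card B) \<le> enat (card ?I)"
        by (simp only: card_image[OF inj_on_subset[OF inj_basis subset_UNIV]] enat_ord_simps)
    qed
    have "\<phi> ` ?I \<subseteq> eigenspace G (complex_of_real l)"
      using eigenvector_graph by (auto simp: eigenspace_def)
    then have "\<phi> ` ?I \<in> {B. finite B \<and> B \<subseteq> eigenspace G (complex_of_real l) \<and> l2.independent B}"
      using fin independent_basis[OF fin] by simp
    then have "enat (card (\<phi> ` ?I)) \<le> (SUP B\<in>{B. finite B \<and> B \<subseteq> eigenspace G (complex_of_real l) \<and>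
        l2.independent B}. enat (card B))"
      by (rule SUP_upper)
    then show "enat (card ?I) \<le> (SUP B\<in>{B. finite B \<and> B \<subseteq> eigenspace G (complex_of_real l) \<and>
        l2.independent B}. enat (card B))"
      by (simp only: card_image[OF inj_on_subset[OF inj_basis subset_UNIV]])
  qed
qed

lemma counting_function_eq: "counting_function G r = enat (card {i. \<mu> i \<le> r})"
proof -
  have S: "{l. complex_of_real l \<in> spectrum G \<and> l \<le> r} = \<mu> ` {i. \<mu> i \<le> r}"
    by (auto simp: spectrum_eq)
  have "counting_function G r = (\<Sum>l\<in>\<mu> ` {i. \<mu> i \<le> r}. enat (card {i. \<mu> i = l}))"
    unfolding counting_function_def S
    by (subst infsum_finite) (auto simp: finite_le multiplicity_eq)
  also have "\<dots> = enat (\<Sum>l\<in>\<mu> ` {i. \<mu> i \<le> r}. card {i. \<mu> i = l})"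
    by (simp add: of_nat_eq_enat[symmetric])
  also have "(\<Sum>l\<in>\<mu> ` {i. \<mu> i \<le> r}. card {i. \<mu> i = l})
           = (\<Sum>l\<in>\<mu> ` {i. \<mu> i \<le> r}. card {i \<in> {i. \<mu> i \<le> r}. \<mu> i = l})"
    by (intro sum.cong refl arg_cong[of _ _ card]) auto
  also have "\<dots> = card {i. \<mu> i \<le> r}"
    using finite_le sum.image_gen[of "{i. \<mu> i \<le> r}" "\<lambda>_. 1::nat" \<mu>] by simp
  finally show ?thesis .
qed

end

subsection \<open>Partial derivatives\<close>

lemma partial_deriv_eq:
  assumes "(f has_derivative f') (at x)"
  shows "partial_deriv j f x = f' (axis j 1)"
proof -
  have "((\<lambda>t. f (x + t *\<^sub>R axis j 1)) has_derivative (\<lambda>t. f' (t *\<^sub>R axis j 1))) (at 0)"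
  proof (rule has_derivative_compose[where g = f])
    show "((\<lambda>t. x + t *\<^sub>R axis j 1) has_derivative (\<lambda>t. t *\<^sub>R axis j 1)) (at 0)"
      by (auto intro!: derivative_eq_intros)
    show "(f has_derivative f') (at (x + 0 *\<^sub>R axis j 1))"
      using assms by simp
  qed
  moreover have "f' (t *\<^sub>R axis j 1) = t *\<^sub>R f' (axis j 1)" for t
    using assms by (simp add: has_derivative_linear linear_cmul)
  ultimately show ?thesis
    unfolding partial_deriv_def by (intro vector_derivative_at) (simp add: has_vector_derivative_def)
qed

lemma partial_deriv_frechet:
  "f differentiable (at x) \<Longrightarrow> partial_deriv j f x = frechet_derivative f (at x) (axis j 1)"
  by (rule partial_deriv_eq) (simp add: frechet_derivative_works)

lemma partial_deriv_line:
  assumes "f differentiable (at (x + t *\<^sub>R axis j 1))"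
  shows "((\<lambda>t. f (x + t *\<^sub>R axis j 1)) has_vector_derivative partial_deriv j f (x + t *\<^sub>R axis j 1)) (at t)"
proof -
  have f: "(f has_derivative frechet_derivative f (at (x + t *\<^sub>R axis j 1))) (at (x + t *\<^sub>R axis j 1))"
    using assms by (simp add: frechet_derivative_works)
  have "((\<lambda>t. f (x + t *\<^sub>R axis j 1)) has_derivative
          (\<lambda>s. frechet_derivative f (at (x + t *\<^sub>R axis j 1)) (s *\<^sub>R axis j 1))) (at t)"
  proof (rule has_derivative_compose[where g = f])
    show "((\<lambda>t. x + t *\<^sub>R axis j 1) has_derivative (\<lambda>s. s *\<^sub>R axis j 1)) (at t)"
      by (auto intro!: derivative_eq_intros)
  qed (rule f)
  then show ?thesis
    unfolding has_vector_derivative_def partial_deriv_frechet[OF assms]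
    by (simp add: linear_cmul[OF has_derivative_linear[OF f]])
qed

lemma partial_deriv_add:
  assumes f: "f differentiable (at x)" and g: "g differentiable (at x)"
  shows "partial_deriv j (\<lambda>x. f x + g x) x = partial_deriv j f x + partial_deriv j g x"
  unfolding partial_deriv_frechet[OF f] partial_deriv_frechet[OF g]
  using f g unfolding frechet_derivative_works by (intro partial_deriv_eq has_derivative_add)

lemma has_derivative_complex_mult:
  fixes f g :: "real^'d \<Rightarrow> complex"
  assumes "f differentiable (at x)" "g differentiable (at x)"
  shows "((\<lambda>x. f x * g x) has_derivative
    (\<lambda>h. f x * frechet_derivative g (at x) h + frechet_derivative f (at x) h * g x)) (at x)"
  using assms unfolding frechet_derivative_works by (rule has_derivative_mult)

lemma partial_deriv_mult:
  assumes f: "f differentiable (at x)" and g: "g differentiable (at x)"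
  shows "partial_deriv j (\<lambda>x. f x * g x) x = f x * partial_deriv j g x + partial_deriv j f x * g x"
  unfolding partial_deriv_frechet[OF f] partial_deriv_frechet[OF g]
  by (rule partial_deriv_eq[OF has_derivative_complex_mult[OF f g]])

lemma partial_deriv_const: "partial_deriv j (\<lambda>x. c) x = 0"
  by (rule partial_deriv_eq) (rule has_derivative_const)

lemma partial_deriv_cmult:
  "f differentiable (at x) \<Longrightarrow> partial_deriv j (\<lambda>x. c * f x) x = c * partial_deriv j f x"
  using partial_deriv_mult[of "\<lambda>x. c" x f j] by (simp add: partial_deriv_const)

lemma has_derivative_coordinate:
  "((\<lambda>x::real^'d. complex_of_real (x $ k)) has_derivative (\<lambda>h. complex_of_real (h $ k))) (at x)"
  by (intro bounded_linear_imp_has_derivative bounded_linear_compose[OF bounded_linear_of_real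
        bounded_linear_vec_nth])

lemma partial_deriv_coordinate:
  "partial_deriv j (\<lambda>x. complex_of_real (x $ k)) x = (if j = k then 1 else 0)"
  unfolding partial_deriv_eq[OF has_derivative_coordinate] by (simp add: axis_def)

lemma differentiable_coordinate: "(\<lambda>x::real^'d. complex_of_real (x $ k)) differentiable (at x)"
  using has_derivative_coordinate differentiable_def by blast

lemma partial_deriv_coordinate_mult:
  "f differentiable (at x) \<Longrightarrow> partial_deriv j (\<lambda>x. complex_of_real (x $ k) * f x) x
     = complex_of_real (x $ k) * partial_deriv j f x + (if j = k then f x else 0)"
  by (simp add: partial_deriv_mult differentiable_coordinate partial_deriv_coordinate)

lemma has_derivative_cnj_comp:
  "f differentiable (at x) \<Longrightarrow>
    ((\<lambda>x. cnj (f x)) has_derivative (\<lambda>h. cnj (frechet_derivative f (at x) h))) (at x)"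
  unfolding frechet_derivative_works by (rule bounded_linear.has_derivative[OF bounded_linear_cnj])

lemma differentiable_cnj_comp:
  "f differentiable (at x) \<Longrightarrow> (\<lambda>x. cnj (f x)) differentiable (at x)"
  using has_derivative_cnj_comp differentiable_def by blast

lemma partial_deriv_cnj:
  "f differentiable (at x) \<Longrightarrow> partial_deriv j (\<lambda>x. cnj (f x)) x = cnj (partial_deriv j f x)"
  by (simp add: partial_deriv_eq[OF has_derivative_cnj_comp] partial_deriv_frechet)

subsection \<open>Polynomials times the Gaussian\<close>

definition gaussian :: "real^'d \<Rightarrow> complex" where
  "gaussian x = of_real (exp (- (x \<bullet> x) / 2))"

text \<open>Generation by coordinate multiplications gives the induction behind differentiability,
  decay, commuting derivatives and, in \<open>poly_gauss_fock_span\<close>, the expansion into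
  excited states.\<close>

inductive_set poly_gauss :: "(real^'d \<Rightarrow> complex) set" where
  poly_gauss_gaussian: "gaussian \<in> poly_gauss"
| poly_gauss_cmult: "f \<in> poly_gauss \<Longrightarrow> (\<lambda>x. c * f x) \<in> poly_gauss"
| poly_gauss_add: "f \<in> poly_gauss \<Longrightarrow> g \<in> poly_gauss \<Longrightarrow> (\<lambda>x. f x + g x) \<in> poly_gauss"
| poly_gauss_coordinate: "f \<in> poly_gauss \<Longrightarrow> (\<lambda>x. of_real (x $ j) * f x) \<in> poly_gauss"

lemma poly_gauss_zero: "(\<lambda>x. 0) \<in> poly_gauss"
  using poly_gauss_cmult[OF poly_gauss_gaussian, of 0] by simp

lemma poly_gauss_sum:
  "(\<And>i. i \<in> S \<Longrightarrow> F i \<in> poly_gauss) \<Longrightarrow> (\<lambda>x. \<Sum>i\<in>S. F i x) \<in> poly_gauss"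
  by (induction S rule: infinite_finite_induct) (simp_all add: poly_gauss_zero poly_gauss_add)

lemma poly_gauss_diff:
  "f \<in> poly_gauss \<Longrightarrow> g \<in> poly_gauss \<Longrightarrow> (\<lambda>x. f x - g x) \<in> poly_gauss"
  using poly_gauss_add[of f "\<lambda>x. - 1 * g x"] poly_gauss_cmult[of g "-1"] by simp

lemma has_derivative_gaussian:
  "(gaussian has_derivative (\<lambda>h. of_real (- (x \<bullet> h) * exp (- (x \<bullet> x) / 2)))) (at x)"
  unfolding gaussian_def
  by (rule has_derivative_of_real) (auto intro!: derivative_eq_intros simp: inner_commute)

lemma partial_deriv_gaussian: "partial_deriv j gaussian x = - 1 * (of_real (x $ j) * gaussian x)"
  unfolding partial_deriv_eq[OF has_derivative_gaussian]
  by (simp add: gaussian_def inner_axis)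

lemma differentiable_poly_gauss: "f \<in> poly_gauss \<Longrightarrow> f differentiable (at x)"
proof (induction rule: poly_gauss.induct)
  case poly_gauss_gaussian
  then show ?case using has_derivative_gaussian differentiable_def by blast
qed (auto intro!: differentiable_mult differentiable_add differentiable_coordinate)

lemmas partial_deriv_poly_gauss =
  partial_deriv_add[OF differentiable_poly_gauss differentiable_poly_gauss]
  partial_deriv_cmult[OF differentiable_poly_gauss]
  partial_deriv_coordinate_mult[OF differentiable_poly_gauss]

lemma poly_gauss_partial_deriv: "f \<in> poly_gauss \<Longrightarrow> partial_deriv j f \<in> poly_gauss"
proof (induction rule: poly_gauss.induct)
  case poly_gauss_gaussian
  have "partial_deriv j gaussian = (\<lambda>x. - 1 * (of_real (x $ j) * gaussian x))"
    by (rule ext) (rule partial_deriv_gaussian)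
  then show ?case
    by (simp only: poly_gauss.intros)
next
  case (poly_gauss_cmult f c)
  have "partial_deriv j (\<lambda>x. c * f x) = (\<lambda>x. c * partial_deriv j f x)"
    using poly_gauss_cmult by (simp add: partial_deriv_poly_gauss fun_eq_iff)
  then show ?case
    using poly_gauss_cmult poly_gauss.poly_gauss_cmult by simp
next
  case (poly_gauss_add f g)
  have "partial_deriv j (\<lambda>x. f x + g x) = (\<lambda>x. partial_deriv j f x + partial_deriv j g x)"
    using poly_gauss_add by (simp add: partial_deriv_poly_gauss fun_eq_iff)
  then show ?case
    using poly_gauss_add poly_gauss.poly_gauss_add by simp
next
  case (poly_gauss_coordinate f k)
  have "partial_deriv j (\<lambda>x. of_real (x $ k) * f x)
      = (\<lambda>x. of_real (x $ k) * partial_deriv j f x + (if j = k then 1 else 0) * f x)"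
    using poly_gauss_coordinate by (auto simp: partial_deriv_poly_gauss fun_eq_iff)
  then show ?case
    using poly_gauss_coordinate
    by (simp only: poly_gauss.poly_gauss_add poly_gauss.poly_gauss_cmult poly_gauss.poly_gauss_coordinate)
qed

text \<open>Induction over the generators with the product rule. In \<open>H_op_symmetric\<close>
  all derivatives are moved onto a function of this class before they are interchanged.\<close>

lemma partial_deriv_commute:
  "f \<in> poly_gauss \<Longrightarrow> partial_deriv j (partial_deriv k f) x = partial_deriv k (partial_deriv j f) x"
proof (induction arbitrary: x rule: poly_gauss.induct)
  case poly_gauss_gaussian
  have *: "partial_deriv k gaussian = (\<lambda>x. - 1 * (of_real (x $ k) * gaussian x))" for k :: 'a
    by (rule ext) (rule partial_deriv_gaussian)
  have "partial_deriv j (\<lambda>x. - 1 * (of_real (x $ k) * gaussian x)) x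
      = - 1 * (of_real (x $ k) * (- 1 * (of_real (x $ j) * gaussian x)) + (if j = k then gaussian x else 0))"
    for j k :: 'a and x
    by (simp only: partial_deriv_poly_gauss poly_gauss.intros partial_deriv_gaussian)
  then show ?case
    unfolding * by (auto simp: mult.left_commute)
next
  case (poly_gauss_cmult f c)
  then show ?case
    by (simp add: partial_deriv_poly_gauss poly_gauss_partial_deriv)
next
  case (poly_gauss_add f g)
  then show ?case
    by (simp add: partial_deriv_poly_gauss poly_gauss_partial_deriv)
next
  case (poly_gauss_coordinate f l)
  have *: "partial_deriv k (\<lambda>x. of_real (x $ l) * f x)
      = (\<lambda>x. of_real (x $ l) * partial_deriv k f x + (if k = l then 1 else 0) * f x)" for k
    using poly_gauss_coordinate by (auto simp: partial_deriv_poly_gauss fun_eq_iff)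
  show ?case
    using poly_gauss_coordinate
    by (simp add: * partial_deriv_poly_gauss poly_gauss_partial_deriv poly_gauss.intros del: mult_zero_left mult_1 if_split)
qed

text \<open>The rate \<open>s\<close> is arbitrary below 1/2 so that a coordinate factor can be paid
  for: the induction hypothesis is used at the midpoint \<open>r\<close> of \<open>s\<close> and
  1/2, and the surplus decay absorbs the coordinate.\<close>

lemma poly_gauss_decay:
  assumes "f \<in> poly_gauss" "s < 1/2"
  obtains C where "C \<ge> 0" "\<And>x. cmod (f x) \<le> C * exp (- s * (x \<bullet> x))"
proof -
  have "\<exists>C\<ge>0. \<forall>x. cmod (f x) \<le> C * exp (- s * (x \<bullet> x))"
    using assms
  proof (induction arbitrary: s rule: poly_gauss.induct)
    case poly_gauss_gaussian
    have "- (x \<bullet> x) / 2 \<le> - s * (x \<bullet> x)" for x :: "real^'a"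
      using mult_right_mono[of s "1/2" "x \<bullet> x"] poly_gauss_gaussian by simp
    then show ?case
      by (intro exI[of _ 1]) (simp add: gaussian_def)
  next
    case (poly_gauss_cmult f c)
    then obtain C where "C \<ge> 0" "\<forall>x. cmod (f x) \<le> C * exp (- s * (x \<bullet> x))" by blast
    then show ?case
      by (intro exI[of _ "cmod c * C"]) (auto simp: norm_mult mult.assoc intro!: mult_left_mono)
  next
    case (poly_gauss_add f g)
    then obtain C D where "C \<ge> 0" "\<forall>x. cmod (f x) \<le> C * exp (- s * (x \<bullet> x))"
      "D \<ge> 0" "\<forall>x. cmod (g x) \<le> D * exp (- s * (x \<bullet> x))" by blast
    then show ?case
      by (intro exI[of _ "C + D"]) (auto simp: distrib_right intro!: norm_triangle_le add_mono)
  next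
    case (poly_gauss_coordinate f j)
    define r where "r = (s + 1/2) / 2"
    have r: "r < 1/2" "s < r" using poly_gauss_coordinate.prems by (auto simp: r_def)
    obtain C where C: "C \<ge> 0" "\<And>x. cmod (f x) \<le> C * exp (- r * (x \<bullet> x))"
      using poly_gauss_coordinate.IH[OF r(1)] by blast
    \<comment> \<open>Chosen so that 1 + |x|^2 \<le> K (1 + (r - s) |x|^2), which is at most K exp
      ((r - s) |x|^2).\<close>
    define K where "K = 1 + 1 / (r - s)"
    have K: "\<bar>x $ j\<bar> \<le> K * exp ((r - s) * (x \<bullet> x))" for x :: "real^'a"
    proof -
      have "\<bar>x $ j\<bar> \<le> norm x" by (rule component_le_norm_cart)
      also have "norm x \<le> 1 + x \<bullet> x"
        using zero_le_power2[of "norm x - 1/2"]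
        by (simp add: power2_norm_eq_inner[symmetric] power2_diff power_divide)
      also have "1 + x \<bullet> x \<le> K * (1 + (r - s) * (x \<bullet> x))"
      proof -
        have "K * (1 + (r - s) * (x \<bullet> x)) = (1 + x \<bullet> x) + (1 / (r - s) + (r - s) * (x \<bullet> x))"
          using r by (simp add: K_def distrib_right distrib_left)
        then show ?thesis using r by simp
      qed
      also have "\<dots> \<le> K * exp ((r - s) * (x \<bullet> x))"
        using r by (intro mult_left_mono exp_ge_add_one_self) (simp add: K_def)
      finally show ?thesis .
    qed
    have "cmod (of_real (x $ j) * f x) \<le> (K * C) * exp (- s * (x \<bullet> x))" for x
    proof -
      have "cmod (of_real (x $ j) * f x) \<le> (K * exp ((r - s) * (x \<bullet> x))) * (C * exp (- r * (x \<bullet> x)))"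
        unfolding norm_mult norm_of_real using K C r
        by (intro mult_mono) (auto simp: K_def)
      also have "\<dots> = (K * C) * (exp ((r - s) * (x \<bullet> x)) * exp (- r * (x \<bullet> x)))" by simp
      also have "exp ((r - s) * (x \<bullet> x)) * exp (- r * (x \<bullet> x)) = exp (- s * (x \<bullet> x))"
        by (simp add: exp_add[symmetric] algebra_simps)
      finally show ?thesis .
    qed
    then show ?case using C r by (intro exI[of _ "K * C"]) (auto simp: K_def)
  qed
  with that show thesis by blast
qed

lemma poly_gauss_monomial:
  assumes "f \<in> poly_gauss"
  shows "(\<lambda>x. (\<Prod>i\<in>S. (x $ i) ^ \<alpha> i) *\<^sub>R f x) \<in> poly_gauss"
proof -
  have pow: "(\<lambda>x. of_real (x $ i) ^ n * g x) \<in> poly_gauss" if "g \<in> poly_gauss"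
    for n i and g :: "real^'a \<Rightarrow> complex"
  proof (induction n)
    case (Suc n)
    from poly_gauss_coordinate[OF this, of i] show ?case by (simp add: mult.assoc)
  qed (simp add: that)
  show ?thesis
  proof (induction S rule: infinite_finite_induct)
    case (insert i S)
    from pow[OF insert.IH, of i "\<alpha> i"] insert.hyps show ?case
      by (simp add: scaleR_conv_of_real mult.assoc)
  qed (simp_all add: assms)
qed

lemma iterated_partial_poly_gauss: "f \<in> poly_gauss \<Longrightarrow> iterated_partial js f \<in> poly_gauss"
  by (induction js) (simp_all add: poly_gauss_partial_deriv)

lemma poly_gauss_schwartz: "f \<in> poly_gauss \<Longrightarrow> f \<in> schwartz"
  unfolding schwartz_def mem_Collect_eq
proof (intro allI conjI)
  fix js x \<alpha> assume f: "f \<in> poly_gauss"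
  show "iterated_partial js f differentiable (at x)"
    by (intro differentiable_poly_gauss iterated_partial_poly_gauss f)
  \<comment> \<open>Rate 0 suffices here: the seminorms ask only for boundedness.\<close>
  have half: "(0::real) < 1 / 2" by simp
  obtain C where "\<And>x. cmod ((\<Prod>i\<in>UNIV. (x $ i) ^ \<alpha> i) *\<^sub>R iterated_partial js f x) \<le> C * exp (- 0 * (x \<bullet> x))"
    using poly_gauss_decay[OF poly_gauss_monomial[OF iterated_partial_poly_gauss[OF f, of js], where S = UNIV and \<alpha> = \<alpha>] half]
    by blast
  then show "bounded (range (\<lambda>x. (\<Prod>i\<in>UNIV. (x $ i) ^ \<alpha> i) *\<^sub>R iterated_partial js f x))"
    by (intro boundedI[where B = C]) auto
qed

subsection \<open>Decay of Schwartz functions\<close>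

lemma schwartz_differentiable: "f \<in> schwartz \<Longrightarrow> f differentiable (at x)"
  unfolding schwartz_def by (auto dest!: spec[of _ "[]"])

lemma schwartz_partial_deriv:
  assumes "f \<in> schwartz" shows "partial_deriv j f \<in> schwartz"
proof -
  have "iterated_partial js (partial_deriv j f) = iterated_partial (js @ [j]) f" for js
    by simp
  with assms show ?thesis
    unfolding schwartz_def mem_Collect_eq by (simp only: simp_thms)
qed

lemma schwartz_measurable: "f \<in> schwartz \<Longrightarrow> f \<in> borel_measurable borel"
  by (intro borel_measurable_continuous_onI continuous_at_imp_continuous_on ballI
      differentiable_imp_continuous_within schwartz_differentiable)

text \<open>A product over coordinates, so that integrability reduces to that of 1 / (1 + t^2) on
  the line and each factor can be traded against one exponent of a monomial.\<close>

definition weight :: "real^'d \<Rightarrow> real" where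
  "weight x = (\<Prod>i\<in>UNIV. inverse (1 + (x $ i)\<^sup>2))"

lemma weight_pos: "weight x > 0"
  unfolding weight_def by (intro prod_pos) (auto simp: add_pos_nonneg)

lemma weight_le_1: "weight x \<le> 1"
  unfolding weight_def by (intro prod_le_1) (auto simp: inverse_le_1_iff)

lemma weight_measurable [measurable]: "weight \<in> borel_measurable borel"
  unfolding weight_def by measurable

lemma weight_integrable: "integrable lborel (weight :: real^'a \<Rightarrow> real)"
proof -
  have 1: "(\<integral>\<^sup>+t. ennreal (inverse (1 + t\<^sup>2)) \<partial>lborel) < \<infinity>"
  proof -
    have "set_integrable lborel UNIV (\<lambda>t::real. inverse (1 + t\<^sup>2))"
      using integrable_inverse_1_plus_square by (simp add: einterval_def)
    then show ?thesis
      by (auto simp: set_integrable_def integrable_iff_bounded)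
  qed
  have "(\<integral>\<^sup>+(x::real^'a). ennreal (weight x) \<partial>lborel)
      = (\<integral>\<^sup>+x. (\<Prod>b\<in>Basis. ennreal (inverse (1 + (x \<bullet> b)\<^sup>2))) \<partial>(lborel :: (real^'a) measure))"
  proof (rule nn_integral_cong)
    fix x :: "real^'a"
    have "(\<Prod>b\<in>Basis. inverse (1 + (x \<bullet> b)\<^sup>2)) = (\<Prod>b\<in>range (\<lambda>i. axis i 1). inverse (1 + (x \<bullet> b)\<^sup>2))"
      by (rule prod.cong) (auto simp: Basis_vec_def)
    also have "\<dots> = weight x"
      unfolding weight_def by (subst prod.reindex) (auto simp: inj_on_def axis_eq_axis inner_axis)
    finally show "ennreal (weight x) = (\<Prod>b\<in>Basis. ennreal (inverse (1 + (x \<bullet> b)\<^sup>2)))"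
      by (simp add: prod_ennreal)
  qed
  also have "\<dots> = (\<Prod>b\<in>(Basis::(real^'a) set). \<integral>\<^sup>+t. ennreal (inverse (1 + t\<^sup>2)) \<partial>lborel)"
    by (rule nn_integral_lborel_prod) auto
  also have "\<dots> < \<infinity>"
    using 1 by (simp add: power_less_top_ennreal)
  finally show ?thesis
    by (intro integrableI_bounded) (auto simp: weight_pos less_imp_le)
qed

text \<open>In each coordinate m (1 + t^2) \<le> 1 + a t^2 \<le> exp (a t^2) with m = min a 1; the
  product over all coordinates gives K = (1/m)^d.\<close>

lemma exp_le_weight:
  assumes "a > 0"
  obtains K where "K > 0" "\<And>x::real^'d. exp (- a * (x \<bullet> x)) \<le> K * weight x"
proof
  define m where "m = min a 1"
  have m: "0 < m" "m \<le> 1" "m \<le> a" using assms by (auto simp: m_def)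
  show "(1 / m) ^ CARD('d) > 0" using m by simp
  fix x :: "real^'d"
  have "exp (- a * t\<^sup>2) \<le> (1 / m) * inverse (1 + t\<^sup>2)" for t :: real
  proof -
    have "m * (1 + t\<^sup>2) \<le> 1 + a * t\<^sup>2"
      using m mult_right_mono[of m a "t\<^sup>2"] by (simp add: distrib_left)
    also have "\<dots> \<le> exp (a * t\<^sup>2)" by (rule exp_ge_add_one_self)
    finally have "m * (1 + t\<^sup>2) \<le> exp (a * t\<^sup>2)" .
    moreover have "1 + t\<^sup>2 > 0" by (simp add: add_pos_nonneg)
    ultimately have "inverse (exp (a * t\<^sup>2)) \<le> inverse (m * (1 + t\<^sup>2))"
      using m by (intro le_imp_inverse_le) auto
    then show ?thesis by (simp add: exp_minus divide_inverse)
  qed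
  then have "(\<Prod>i\<in>UNIV. exp (- a * (x $ i)\<^sup>2)) \<le> (\<Prod>i\<in>UNIV. (1 / m) * inverse (1 + (x $ i)\<^sup>2))"
    by (intro prod_mono) auto
  also have "(\<Prod>i\<in>UNIV. exp (- a * (x $ i)\<^sup>2)) = exp (- a * (x \<bullet> x))"
    by (simp add: exp_sum[symmetric] inner_vec_def sum_distrib_left sum_negf power2_eq_square)
  also have "(\<Prod>i\<in>UNIV. (1 / m) * inverse (1 + (x $ i)\<^sup>2)) = (1 / m) ^ CARD('d) * weight x"
    by (simp only: prod.distrib weight_def prod_constant)
  finally show "exp (- a * (x \<bullet> x)) \<le> (1 / m) ^ CARD('d) * weight x" .
qed

lemma integrable_exp: "a > 0 \<Longrightarrow> integrable lborel (\<lambda>x::real^'d. exp (- a * (x \<bullet> x)))"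
proof -
  assume "a > 0"
  then obtain K where K: "K > 0" "\<And>x::real^'d. exp (- a * (x \<bullet> x)) \<le> K * weight x"
    using exp_le_weight by blast
  show ?thesis
  proof (rule Bochner_Integration.integrable_bound)
    show "integrable lborel (\<lambda>x::real^'d. K * weight x)"
      by (intro integrable_mult_right weight_integrable)
    show "AE x in lborel. norm (exp (- a * (x \<bullet> x))) \<le> norm (K * weight (x::real^'d))"
      unfolding real_norm_def abs_exp_cancel
      by (intro AE_I2 order_trans[OF K(2) abs_ge_self])
  qed simp
qed

text \<open>The reciprocal of \<open>weight\<close> is multiplied in one factor at a time. A factor
  1 + (x $ j)^2 splits a seminorm into the old one and the one whose exponent at \<open>j\<close> is
  larger by 2, hence the induction with \<alpha> arbitrary.\<close>

lemma schwartz_decay: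
  assumes "f \<in> schwartz"
  obtains C where "C \<ge> 0" "\<And>x. cmod ((\<Prod>i\<in>UNIV. (x $ i) ^ \<alpha> i) *\<^sub>R f x) \<le> C * weight x"
proof -
  have "\<exists>C. \<forall>x. \<bar>\<Prod>i\<in>S. 1 + (x $ i)\<^sup>2\<bar> * cmod ((\<Prod>i\<in>UNIV. (x $ i) ^ \<alpha> i) *\<^sub>R f x) \<le> C"
    for S
    using finite[of S]
  proof (induction S arbitrary: \<alpha> rule: finite_induct)
    case empty
    have "bounded (range (\<lambda>x. (\<Prod>i\<in>UNIV. (x $ i) ^ \<alpha> i) *\<^sub>R iterated_partial [] f x))"
      using assms unfolding schwartz_def by blast
    then show ?case by (simp add: bounded_iff)
  next
    case (insert j S)
    from insert.IH[of \<alpha>] obtain C where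
      C: "\<And>x. \<bar>\<Prod>i\<in>S. 1 + (x $ i)\<^sup>2\<bar> * cmod ((\<Prod>i\<in>UNIV. (x $ i) ^ \<alpha> i) *\<^sub>R f x) \<le> C" by blast
    from insert.IH[of "\<alpha>(j := \<alpha> j + 2)"] obtain D where
      D: "\<And>x. \<bar>\<Prod>i\<in>S. 1 + (x $ i)\<^sup>2\<bar> * cmod ((\<Prod>i\<in>UNIV. (x $ i) ^ (\<alpha>(j := \<alpha> j + 2)) i) *\<^sub>R f x) \<le> D" by blast
    have eq: "(\<Prod>i\<in>UNIV. (x $ i) ^ (\<alpha>(j := \<alpha> j + 2)) i) = (x $ j)\<^sup>2 * (\<Prod>i\<in>UNIV. (x $ i) ^ \<alpha> i)" for x :: "real^'a"
    proof -
      have "(\<Prod>i\<in>UNIV - {j}. (x $ i) ^ (\<alpha>(j := \<alpha> j + 2)) i) = (\<Prod>i\<in>UNIV - {j}. (x $ i) ^ \<alpha> i)"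
        by (rule prod.cong) auto
      then show ?thesis
        by (simp add: prod.remove[of UNIV j] power_add mult_ac power2_eq_square del: fun_upd_apply)
           (simp add: power2_eq_square power_add mult_ac)
    qed
    show ?case
    proof (intro exI allI)
      fix x :: "real^'a"
      have "\<bar>\<Prod>i\<in>insert j S. 1 + (x $ i)\<^sup>2\<bar> * cmod ((\<Prod>i\<in>UNIV. (x $ i) ^ \<alpha> i) *\<^sub>R f x)
        = \<bar>\<Prod>i\<in>S. 1 + (x $ i)\<^sup>2\<bar> * cmod ((\<Prod>i\<in>UNIV. (x $ i) ^ \<alpha> i) *\<^sub>R f x) +
          \<bar>\<Prod>i\<in>S. 1 + (x $ i)\<^sup>2\<bar> * cmod ((\<Prod>i\<in>UNIV. (x $ i) ^ (\<alpha>(j := \<alpha> j + 2)) i) *\<^sub>R f x)"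
      proof -
        have "\<bar>1 + (x $ j)\<^sup>2\<bar> = 1 + (x $ j)\<^sup>2" by (simp add: abs_of_nonneg add_nonneg_nonneg)
        then have "\<bar>\<Prod>i\<in>insert j S. 1 + (x $ i)\<^sup>2\<bar> = (1 + (x $ j)\<^sup>2) * \<bar>\<Prod>i\<in>S. 1 + (x $ i)\<^sup>2\<bar>"
          unfolding prod.insert[OF insert.hyps] abs_mult by (simp only:)
        then show ?thesis
          unfolding eq by (simp add: abs_mult distrib_right distrib_left mult_ac del: prod.insert)
      qed
      also have "\<dots> \<le> C + D" by (intro add_mono C D)
      finally show "\<bar>\<Prod>i\<in>insert j S. 1 + (x $ i)\<^sup>2\<bar> * cmod ((\<Prod>i\<in>UNIV. (x $ i) ^ \<alpha> i) *\<^sub>R f x) \<le> C + D" .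
    qed
  qed
  from this[of UNIV] obtain C where
    C: "\<And>x. \<bar>\<Prod>i\<in>UNIV. 1 + (x $ i)\<^sup>2\<bar> * cmod ((\<Prod>i\<in>UNIV. (x $ i) ^ \<alpha> i) *\<^sub>R f x) \<le> C" by blast
  have "cmod ((\<Prod>i\<in>UNIV. (x $ i) ^ \<alpha> i) *\<^sub>R f x) \<le> C * weight x" for x
  proof -
    have p: "(\<Prod>i\<in>UNIV. 1 + (x $ i)\<^sup>2) > 0" by (intro prod_pos) (auto simp: add_pos_nonneg)
    have "weight x = inverse (\<Prod>i\<in>UNIV. 1 + (x $ i)\<^sup>2)"
      by (simp add: weight_def prod_inversef[symmetric] o_def)
    then show ?thesis using C[of x] p by (simp add: field_simps)
  qed
  moreover have "C \<ge> 0"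
    using C[of 0] by (rule order_trans[rotated]) simp
  ultimately show thesis using that by blast
qed

lemma schwartz_bounded_weight:
  assumes "f \<in> schwartz"
  obtains C where "C \<ge> 0" "\<And>x. cmod (f x) \<le> C * weight x"
  using schwartz_decay[OF assms, of "\<lambda>_. 0"] by auto

lemma square_integrable_weight_bound:
  assumes "f \<in> borel_measurable borel" "\<And>x. cmod (f x) \<le> C * weight x"
  shows "square_integrable f"
proof -
  have "(cmod (f x))\<^sup>2 \<le> C\<^sup>2 * weight x" for x
  proof -
    have "(cmod (f x))\<^sup>2 \<le> (C * weight x)\<^sup>2" by (intro power_mono assms) simp
    also have "\<dots> = C\<^sup>2 * (weight x * weight x)" by (simp add: power2_eq_square)
    also have "\<dots> \<le> C\<^sup>2 * (weight x * 1)"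
      by (intro mult_left_mono weight_le_1) (auto simp: weight_pos less_imp_le)
    finally show ?thesis by simp
  qed
  then have le: "norm ((cmod (f x))\<^sup>2) \<le> norm (C\<^sup>2 * weight x)" for x
    unfolding real_norm_def abs_power2 by (rule order_trans[OF _ abs_ge_self])
  have "integrable lborel (\<lambda>x. (cmod (f x))\<^sup>2)"
  proof (rule Bochner_Integration.integrable_bound[OF _ _ AE_I2[OF le]])
    show "integrable lborel (\<lambda>x. C\<^sup>2 * weight x)"
      by (intro integrable_mult_right weight_integrable)
    show "(\<lambda>x. (cmod (f x))\<^sup>2) \<in> borel_measurable lborel"
      using assms(1) by measurable
  qed
  with assms(1) show ?thesis by (simp add: square_integrable_def)
qed

lemma square_integrable_schwartz: "f \<in> schwartz \<Longrightarrow> square_integrable f"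
  using schwartz_bounded_weight[of f] square_integrable_weight_bound[OF schwartz_measurable, of f]
  by blast

lemma square_integrable_monomial_schwartz:
  assumes "f \<in> schwartz"
  shows "square_integrable (\<lambda>x. (\<Prod>i\<in>UNIV. (x $ i) ^ \<alpha> i) *\<^sub>R f x)"
proof -
  obtain C where "\<And>x. cmod ((\<Prod>i\<in>UNIV. (x $ i) ^ \<alpha> i) *\<^sub>R f x) \<le> C * weight x"
    using schwartz_decay[OF assms] by blast
  then show ?thesis
    using schwartz_measurable[OF assms] by (intro square_integrable_weight_bound) measurable
qed

lemma prod_power_delta:
  "(\<Prod>i\<in>UNIV. (x $ i) ^ (if i = j then 1 else 0)) = (x::real^'d) $ j"
  by (simp add: if_distrib[of "power _"] cong: if_cong)

lemma square_integrable_coordinate_schwartz: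
  assumes "f \<in> schwartz"
  shows "square_integrable (\<lambda>x. of_real (x $ j) * f x)"
    and "square_integrable (\<lambda>x. of_real (x $ j) * of_real (x $ k) * f x)"
proof -
  show "square_integrable (\<lambda>x. of_real (x $ j) * f x)"
    using square_integrable_monomial_schwartz[OF assms, of "\<lambda>i. if i = j then 1 else 0"]
    unfolding prod_power_delta scaleR_conv_of_real .
  show "square_integrable (\<lambda>x. of_real (x $ j) * of_real (x $ k) * f x)"
    using square_integrable_monomial_schwartz[OF assms,
        of "\<lambda>i. (if i = j then 1 else 0) + (if i = k then 1 else 0)"]
    unfolding power_add prod.distrib prod_power_delta scaleR_conv_of_real by simp
qed

subsection \<open>Integration by parts\<close>

lemma integral_translation_lborel:
  fixes F :: "'a::euclidean_space \<Rightarrow> 'b::{banach, second_countable_topology}"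
  assumes "F \<in> borel_measurable borel"
  shows "(LINT x|lborel. F (c + x)) = (LINT x|lborel. F x)"
proof -
  have "(LINT x|lborel. F x) = (LINT x|distr lborel borel ((+) c). F x)"
    by (simp add: lborel_distr_plus)
  also have "\<dots> = (LINT x|lborel. F (c + x))"
    using assms by (subst integral_distr) auto
  finally show ?thesis ..
qed

text \<open>|x + 2 h|^2 \<ge> 0 rearranges to |x|^2 \<le> 2 |x + h|^2 + 2 |h|^2. Halving the rate
  thus gives one integrable majorant for all translates by at most 1, as needed for difference
  quotients.\<close>

lemma exp_neg_translate_le:
  fixes x h :: "'a::real_inner"
  assumes "a > 0" "norm h \<le> 1"
  shows "exp (- a * ((x + h) \<bullet> (x + h))) \<le> exp a * exp (- (a/2) * (x \<bullet> x))"
proof -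
  have "0 \<le> (x + 2 *\<^sub>R h) \<bullet> (x + 2 *\<^sub>R h)" by simp
  then have "x \<bullet> x - 2 * (h \<bullet> h) \<le> 2 * ((x + h) \<bullet> (x + h))"
    by (simp add: inner_add_left inner_add_right inner_commute)
  moreover have "h \<bullet> h \<le> 1"
    using assms(2) by (simp add: norm_eq_sqrt_inner)
  ultimately have "x \<bullet> x - 2 \<le> 2 * ((x + h) \<bullet> (x + h))" by linarith
  then have "a * (x \<bullet> x - 2) \<le> a * (2 * ((x + h) \<bullet> (x + h)))"
    using assms(1) by (intro mult_left_mono) auto
  then show ?thesis
    unfolding exp_add[symmetric] by (simp add: algebra_simps)
qed

text \<open>Every difference quotient integrates to 0 by translation invariance of Lebesgue measure;
  the mean value inequality and \<open>exp_neg_translate_le\<close> dominate the quotients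
  uniformly, so the integral of their limit is 0 as well.\<close>

lemma integral_partial_deriv:
  fixes F :: "real^'d \<Rightarrow> complex"
  assumes diff: "\<And>x. F differentiable (at x)" and "a > 0"
    and F: "\<And>x. cmod (F x) \<le> C * exp (- a * (x \<bullet> x))"
    and dF: "\<And>x. cmod (partial_deriv j F x) \<le> C * exp (- a * (x \<bullet> x))"
  shows "(LINT x|lborel. partial_deriv j F x) = 0"
proof -
  let ?e = "axis j 1 :: real^'d"
  define h where "h n = inverse (real (Suc n))" for n
  have h: "h n > 0" "h n \<le> 1" for n by (simp_all add: h_def field_simps)
  have h0: "h \<longlonglongrightarrow> 0" unfolding h_def by (rule LIMSEQ_inverse_real_of_nat)
  have Fm [measurable]: "F \<in> borel_measurable borel"
    by (intro borel_measurable_continuous_onI continuous_at_imp_continuous_on ballI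
      differentiable_imp_continuous_within diff)
  have C: "C \<ge> 0" using order_trans[OF norm_ge_zero F[of 0]] by simp
  define q where "q n x = (F (x + h n *\<^sub>R ?e) - F x) /\<^sub>R h n" for n x
  have qlim: "(\<lambda>n. q n x) \<longlonglongrightarrow> partial_deriv j F x" for x
  proof -
    have "((\<lambda>t. F (x + t *\<^sub>R ?e)) has_vector_derivative partial_deriv j F x) (at 0)"
      using partial_deriv_line[of F x 0 j] diff by simp
    then have lim: "((\<lambda>t. cmod (F (x + t *\<^sub>R ?e) - (F x + t *\<^sub>R partial_deriv j F x)) / \<bar>t\<bar>) \<longlongrightarrow> 0) (at 0)"
      unfolding has_vector_derivative_def has_derivative_at by (simp add: diff_diff_eq)
    have "((\<lambda>t. (F (x + t *\<^sub>R ?e) - F x) /\<^sub>R t) \<longlongrightarrow> partial_deriv j F x) (at 0)"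
    proof (rule Lim_transform_within[OF LIM_zero_cancel zero_less_one])
      show "((\<lambda>t. (F (x + t *\<^sub>R ?e) - (F x + t *\<^sub>R partial_deriv j F x)) /\<^sub>R t + partial_deriv j F x
          - partial_deriv j F x) \<longlongrightarrow> 0) (at 0)"
        by (rule tendsto_norm_zero_cancel) (use lim in \<open>simp add: divide_inverse mult.commute\<close>)
    qed (simp add: algebra_simps)
    moreover have "filterlim h (at 0) sequentially"
      unfolding filterlim_at using h0 h(1) by (auto intro!: always_eventually simp: less_imp_neq[symmetric])
    ultimately show ?thesis unfolding q_def by (rule filterlim_compose)
  qed
  \<comment> \<open>Continuity of the derivative is not assumed; it is measurable as a pointwise
    limit of difference quotients.\<close>
  have "q n \<in> borel_measurable lborel" for n unfolding q_def by measurable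
  then have dm: "partial_deriv j F \<in> borel_measurable lborel"
    by (rule borel_measurable_LIMSEQ_metric) (rule qlim)
  have Fi: "integrable lborel F"
  proof (rule Bochner_Integration.integrable_bound)
    show "integrable lborel (\<lambda>x::real^'d. C * exp (- a * (x \<bullet> x)))"
      by (intro integrable_mult_right integrable_exp assms)
    show "AE x in lborel. norm (F x) \<le> norm (C * exp (- a * (x \<bullet> x)))"
      using F C by (intro AE_I2) (simp add: abs_mult)
  qed simp
  have Fti: "integrable lborel (\<lambda>x. F (x + c))" for c
    using Fi integrable_distr[of "\<lambda>x. x + c" lborel borel F]
    by (simp add: lborel_distr_plus[of c] add.commute[of _ c])
  have q0: "(LINT x|lborel. q n x) = 0" for n
  proof -
    have "(LINT x|lborel. q n x) = ((LINT x|lborel. F (x + h n *\<^sub>R ?e)) - (LINT x|lborel. F x)) /\<^sub>R h n"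
      unfolding q_def using Fti Fi by simp
    also have "(LINT x|lborel. F (x + h n *\<^sub>R ?e)) = (LINT x|lborel. F x)"
      using integral_translation_lborel[of F "h n *\<^sub>R ?e"] by (simp add: add.commute)
    finally show ?thesis by simp
  qed
  have qb: "norm (q n x) \<le> C * exp a * exp (- (a/2) * (x \<bullet> x))" for n x
  proof -
    let ?B = "C * exp a * exp (- (a/2) * (x \<bullet> x))"
    have "norm (F (x + h n *\<^sub>R ?e) - F (x + 0 *\<^sub>R ?e)) \<le> ?B * norm (h n - 0)"
    proof (rule differentiable_bound[where f = "\<lambda>t. F (x + t *\<^sub>R ?e)" and S = "{0..1}"])
      fix t :: real assume t: "t \<in> {0..1}"
      show "((\<lambda>t. F (x + t *\<^sub>R ?e)) has_derivative (\<lambda>s. s *\<^sub>R partial_deriv j F (x + t *\<^sub>R ?e))) (at t within {0..1})"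
        using partial_deriv_line[OF diff] unfolding has_vector_derivative_def
        by (rule has_derivative_at_withinI)
      have "norm (partial_deriv j F (x + t *\<^sub>R ?e)) \<le> C * exp (- a * ((x + t *\<^sub>R ?e) \<bullet> (x + t *\<^sub>R ?e)))"
        by (rule dF)
      also have "\<dots> \<le> C * (exp a * exp (- (a/2) * (x \<bullet> x)))"
        using t C \<open>a > 0\<close> by (intro mult_left_mono exp_neg_translate_le) simp_all
      finally have le: "norm (partial_deriv j F (x + t *\<^sub>R ?e)) \<le> ?B" by (simp add: mult.assoc)
      show "onorm (\<lambda>s. s *\<^sub>R partial_deriv j F (x + t *\<^sub>R ?e)) \<le> ?B"
      proof (rule onorm_le)
        fix s :: real
        show "norm (s *\<^sub>R partial_deriv j F (x + t *\<^sub>R ?e)) \<le> ?B * norm s"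
          using mult_left_mono[OF le abs_ge_zero[of s]] by (simp add: mult.commute)
      qed
    qed (use h[of n] in \<open>auto simp: less_imp_le\<close>)
    then show ?thesis
      unfolding q_def norm_scaleR using h(1)[of n] by (simp add: field_simps del: scaleR_diff_right)
  qed
  have "(\<lambda>n. LINT x|lborel. q n x) \<longlonglongrightarrow> (LINT x|lborel. partial_deriv j F x)"
  proof (rule integral_dominated_convergence)
    show "integrable lborel (\<lambda>x::real^'d. C * exp a * exp (- (a/2) * (x \<bullet> x)))"
      by (intro integrable_mult_right integrable_exp) (use assms in simp)
    show "q n \<in> borel_measurable lborel" for n unfolding q_def by measurable
  qed (use qb qlim dm in auto)
  then show ?thesis by (simp add: q0 LIMSEQ_const_iff)
qed

text \<open>The Hermitian product on functions, on which derivatives act;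
  \<open>cinner_to_l2\<close> identifies it with \<open>cinner_l2\<close> of the classes.\<close>

definition pairing :: "(real^'d \<Rightarrow> complex) \<Rightarrow> (real^'d \<Rightarrow> complex) \<Rightarrow> complex" where
  "pairing f g = (LINT x|lborel. cnj (f x) * g x)"

lemma square_integrable_poly_gauss: "f \<in> poly_gauss \<Longrightarrow> square_integrable f"
  by (intro square_integrable_schwartz poly_gauss_schwartz)

lemma has_pairing:
  "f \<in> poly_gauss \<Longrightarrow> square_integrable g \<Longrightarrow>
     has_bochner_integral lborel (\<lambda>x. cnj (f x) * g x) (pairing f g)"
  unfolding pairing_def
  by (intro has_bochner_integral_integrable square_integrable_cnj_mult[OF square_integrable_poly_gauss])

text \<open>The integral of the derivative of \<open>cnj f * g\<close> vanishes. All decay comes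
  from \<open>f\<close>; of \<open>g\<close> and its derivative only boundedness enters the
  estimates.\<close>

lemma pairing_partial_deriv:
  assumes f: "f \<in> poly_gauss" and g: "g \<in> schwartz"
  shows "pairing f (partial_deriv j g) = - pairing (partial_deriv j f) g"
proof -
  note df = differentiable_poly_gauss[OF f] and dg = schwartz_differentiable[OF g]
  let ?F = "\<lambda>x. cnj (f x) * g x"
  have pd: "partial_deriv j ?F x = cnj (f x) * partial_deriv j g x + cnj (partial_deriv j f x) * g x" for x
    by (simp add: partial_deriv_mult differentiable_cnj_comp df dg partial_deriv_cnj)
  \<comment> \<open>Any rate between 0 and 1/2 would do: positive for integrability, below 1/2 for
    \<open>poly_gauss_decay\<close>.\<close>
  have quarter: "(1/4::real) < 1/2" by simp
  obtain C1 where C1: "C1 \<ge> 0" "\<And>x. cmod (f x) \<le> C1 * exp (- (1/4) * (x \<bullet> x))"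
    using poly_gauss_decay[OF f quarter] by blast
  obtain C2 where C2: "C2 \<ge> 0" "\<And>x. cmod (partial_deriv j f x) \<le> C2 * exp (- (1/4) * (x \<bullet> x))"
    using poly_gauss_decay[OF poly_gauss_partial_deriv[OF f] quarter] by blast
  have bd: "\<exists>D\<ge>0. \<forall>x. cmod (k x) \<le> D" if k: "k \<in> schwartz" for k :: "real^'a \<Rightarrow> complex"
  proof -
    obtain D where D: "D \<ge> 0" "\<And>x. cmod (k x) \<le> D * weight x"
      using schwartz_bounded_weight[OF k] by blast
    have "cmod (k x) \<le> D" for x
      using D(2)[of x] mult_left_mono[OF weight_le_1 D(1), of x] by simp
    with D show ?thesis by blast
  qed
  obtain D1 where D1: "D1 \<ge> 0" "\<And>x. cmod (g x) \<le> D1" using bd[OF g] by blast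
  obtain D2 where D2: "D2 \<ge> 0" "\<And>x. cmod (partial_deriv j g x) \<le> D2"
    using bd[OF schwartz_partial_deriv[OF g]] by blast
  define C where "C = C1 * D1 + C1 * D2 + C2 * D1"
  have "(LINT x|lborel. partial_deriv j ?F x) = 0"
  proof (rule integral_partial_deriv[where a = "1/4" and C = C])
    show "?F differentiable (at x)" for x
      by (intro differentiable_mult differentiable_cnj_comp df dg)
    fix x :: "real^'a"
    let ?E = "exp (- (1/4) * (x \<bullet> x))"
    have 1: "cmod (f x) * cmod (g x) \<le> (C1 * ?E) * D1"
      by (intro mult_mono C1 D1) (use C1 in auto)
    have 2: "cmod (f x) * cmod (partial_deriv j g x) \<le> (C1 * ?E) * D2"
      by (intro mult_mono C1 D2) (use C1 in auto)
    have 3: "cmod (partial_deriv j f x) * cmod (g x) \<le> (C2 * ?E) * D1"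
      by (intro mult_mono C2 D1) (use C2 in auto)
    have pos: "0 \<le> (C1 * ?E) * D1" "0 \<le> (C1 * ?E) * D2" "0 \<le> (C2 * ?E) * D1"
      using C1(1) C2(1) D1(1) D2(1) by auto
    have eq: "C * ?E = (C1 * ?E) * D1 + (C1 * ?E) * D2 + (C2 * ?E) * D1"
      by (simp add: C_def algebra_simps)
    show "cmod (?F x) \<le> C * ?E"
      unfolding norm_mult complex_mod_cnj eq using 1 pos by linarith
    have "cmod (partial_deriv j ?F x) \<le> cmod (f x) * cmod (partial_deriv j g x) + cmod (partial_deriv j f x) * cmod (g x)"
      unfolding pd by (rule order_trans[OF norm_triangle_ineq]) (simp add: norm_mult)
    then show "cmod (partial_deriv j ?F x) \<le> C * ?E"
      unfolding eq using 2 3 pos by linarith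
  qed simp
  moreover have "has_bochner_integral lborel (partial_deriv j ?F) (pairing f (partial_deriv j g) + pairing (partial_deriv j f) g)"
    unfolding pd[abs_def]
    by (intro has_bochner_integral_add has_pairing f g poly_gauss_partial_deriv square_integrable_schwartz schwartz_partial_deriv)
  ultimately show ?thesis
    by (simp add: has_bochner_integral_iff eq_neg_iff_add_eq_0)
qed

lemma pairing_coordinate:
  "pairing f (\<lambda>x. of_real (x $ j) * g x) = pairing (\<lambda>x. of_real (x $ j) * f x) g"
  by (simp add: pairing_def mult_ac)

text \<open>The term for \<open>j = k\<close> is the commutator of coordinate and derivative. In
  \<open>H_op_symmetric\<close> it occurs in both halves of the antisymmetric difference and
  cancels.\<close>

lemma pairing_coordinate_partial:
  assumes f: "f \<in> poly_gauss" and g: "g \<in> schwartz"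
  shows "pairing (\<lambda>x. of_real (x $ k) * f x) (partial_deriv j g)
    = - pairing (\<lambda>x. of_real (x $ k) * partial_deriv j f x) g - (if j = k then pairing f g else 0)"
proof -
  have "partial_deriv j (\<lambda>x. of_real (x $ k) * f x)
      = (\<lambda>x. of_real (x $ k) * partial_deriv j f x + (if j = k then 1 else 0) * f x)"
    using f by (auto simp: partial_deriv_poly_gauss fun_eq_iff)
  moreover have "pairing (\<lambda>x. of_real (x $ k) * partial_deriv j f x + (if j = k then 1 else 0) * f x) g
     = pairing (\<lambda>x. of_real (x $ k) * partial_deriv j f x) g + (if j = k then pairing f g else 0)"
  proof -
    have "has_bochner_integral lborel (\<lambda>x. cnj (of_real (x $ k) * partial_deriv j f x) * g x +
         (if j = k then 1 else 0) * (cnj (f x) * g x))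
       (pairing (\<lambda>x. of_real (x $ k) * partial_deriv j f x) g + (if j = k then 1 else 0) * pairing f g)"
      by (intro has_bochner_integral_add has_bochner_integral_mult_right has_pairing f g poly_gauss_coordinate poly_gauss_partial_deriv square_integrable_schwartz)
    then show ?thesis
      unfolding pairing_def[of "\<lambda>x. _ x + _ x"] has_bochner_integral_iff
      by (auto simp: distrib_right split: if_splits)
  qed
  ultimately show ?thesis
    using pairing_partial_deriv[OF poly_gauss_coordinate[OF f] g, of k j] by simp
qed

subsection \<open>Symmetry of the operator\<close>

text \<open>The identity holds for each pair \<open>j\<close>, \<open>k\<close> separately. Second
  derivatives move over by two integrations by parts and an interchange; in the first-order part the
  sign from one integration by parts is matched by the conjugation of \<open>\<i>\<close>. Facts 1
  and 2 evaluate the two sides term by term.\<close>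

lemma H_op_symmetric:
  fixes A :: "complex^'d^'d"
  assumes f: "f \<in> poly_gauss" and g: "g \<in> schwartz"
  shows "pairing f (H_op A g) = pairing (H_op A f) g"
proof -
  define B where "B j k = complex_of_real (Re (A $ j $ k))" for j k
  define C where "C j k = complex_of_real (- Im (A $ j $ k))" for j k
  note sq = square_integrable_schwartz[OF g] square_integrable_schwartz[OF schwartz_partial_deriv[OF g]]
    square_integrable_schwartz[OF schwartz_partial_deriv[OF schwartz_partial_deriv[OF g]]]
  have 1: "has_bochner_integral lborel (\<lambda>x. 1/2 * (\<Sum>j\<in>UNIV. \<Sum>k\<in>UNIV. C j k *
        (- 1 * (cnj (f x) * partial_deriv j (partial_deriv k g) x) + cnj (of_real (x $ j) * (of_real (x $ k) * f x)) * g x))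
      + \<i>/2 * (\<Sum>j\<in>UNIV. \<Sum>k\<in>UNIV. B j k * (cnj (of_real (x $ k) * f x) * partial_deriv j g x
          - cnj (of_real (x $ j) * f x) * partial_deriv k g x)))
    (1/2 * (\<Sum>j\<in>UNIV. \<Sum>k\<in>UNIV. C j k *
        (- 1 * pairing f (partial_deriv j (partial_deriv k g)) + pairing (\<lambda>x. of_real (x $ j) * (of_real (x $ k) * f x)) g))
      + \<i>/2 * (\<Sum>j\<in>UNIV. \<Sum>k\<in>UNIV. B j k * (pairing (\<lambda>x. of_real (x $ k) * f x) (partial_deriv j g)
          - pairing (\<lambda>x. of_real (x $ j) * f x) (partial_deriv k g))))"
    by (intro has_bochner_integral_add has_bochner_integral_diff has_bochner_integral_mult_right
        has_bochner_integral_sum has_pairing poly_gauss_coordinate f sq)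
  have 2: "has_bochner_integral lborel (\<lambda>x. 1/2 * (\<Sum>j\<in>UNIV. \<Sum>k\<in>UNIV. C j k *
        (- 1 * (cnj (partial_deriv j (partial_deriv k f) x) * g x) + cnj (of_real (x $ j) * (of_real (x $ k) * f x)) * g x))
      - \<i>/2 * (\<Sum>j\<in>UNIV. \<Sum>k\<in>UNIV. B j k * (cnj (of_real (x $ k) * partial_deriv j f x) * g x
          - cnj (of_real (x $ j) * partial_deriv k f x) * g x)))
    (1/2 * (\<Sum>j\<in>UNIV. \<Sum>k\<in>UNIV. C j k *
        (- 1 * pairing (partial_deriv j (partial_deriv k f)) g + pairing (\<lambda>x. of_real (x $ j) * (of_real (x $ k) * f x)) g))
      - \<i>/2 * (\<Sum>j\<in>UNIV. \<Sum>k\<in>UNIV. B j k * (pairing (\<lambda>x. of_real (x $ k) * partial_deriv j f x) g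
          - pairing (\<lambda>x. of_real (x $ j) * partial_deriv k f x) g)))"
    by (intro has_bochner_integral_add has_bochner_integral_diff has_bochner_integral_mult_right
        has_bochner_integral_sum has_pairing poly_gauss_coordinate poly_gauss_partial_deriv f sq)
  have "pairing f (H_op A g) = 1/2 * (\<Sum>j\<in>UNIV. \<Sum>k\<in>UNIV. C j k *
        (- 1 * pairing f (partial_deriv j (partial_deriv k g)) + pairing (\<lambda>x. of_real (x $ j) * (of_real (x $ k) * f x)) g))
      + \<i>/2 * (\<Sum>j\<in>UNIV. \<Sum>k\<in>UNIV. B j k * (pairing (\<lambda>x. of_real (x $ k) * f x) (partial_deriv j g)
          - pairing (\<lambda>x. of_real (x $ j) * f x) (partial_deriv k g)))"
  proof -
    have "cnj (f x) * H_op A g x = 1/2 * (\<Sum>j\<in>UNIV. \<Sum>k\<in>UNIV. C j k *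
        (- 1 * (cnj (f x) * partial_deriv j (partial_deriv k g) x) + cnj (of_real (x $ j) * (of_real (x $ k) * f x)) * g x))
      + \<i>/2 * (\<Sum>j\<in>UNIV. \<Sum>k\<in>UNIV. B j k * (cnj (of_real (x $ k) * f x) * partial_deriv j g x
          - cnj (of_real (x $ j) * f x) * partial_deriv k g x))" for x
      unfolding H_op_def Let_def B_def[symmetric] C_def[symmetric]
      by (simp add: distrib_left right_diff_distrib sum_distrib_left mult_ac)
    then show ?thesis
      using has_bochner_integral_integral_eq[OF 1] unfolding pairing_def[of f "H_op A g"] by simp
  qed
  also have "\<dots> = 1/2 * (\<Sum>j\<in>UNIV. \<Sum>k\<in>UNIV. C j k *
        (- 1 * pairing (partial_deriv j (partial_deriv k f)) g + pairing (\<lambda>x. of_real (x $ j) * (of_real (x $ k) * f x)) g))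
      - \<i>/2 * (\<Sum>j\<in>UNIV. \<Sum>k\<in>UNIV. B j k * (pairing (\<lambda>x. of_real (x $ k) * partial_deriv j f x) g
          - pairing (\<lambda>x. of_real (x $ j) * partial_deriv k f x) g))"
  proof -
    have a: "pairing f (partial_deriv j (partial_deriv k g)) = pairing (partial_deriv j (partial_deriv k f)) g" for j k
    proof -
      have "partial_deriv k (partial_deriv j f) = partial_deriv j (partial_deriv k f)"
        using partial_deriv_commute[OF f] by blast
      then show ?thesis
        by (simp add: pairing_partial_deriv f g schwartz_partial_deriv poly_gauss_partial_deriv)
    qed
    have b: "pairing (\<lambda>x. of_real (x $ k) * f x) (partial_deriv j g) - pairing (\<lambda>x. of_real (x $ j) * f x) (partial_deriv k g)
      = - (pairing (\<lambda>x. of_real (x $ k) * partial_deriv j f x) g - pairing (\<lambda>x. of_real (x $ j) * partial_deriv k f x) g)" for j k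
      by (simp add: pairing_coordinate_partial f g)
    show ?thesis
      unfolding a b mult_minus_right sum_negf by simp
  qed
  also have "\<dots> = pairing (H_op A f) g"
  proof -
    have "cnj (H_op A f x) * g x = 1/2 * (\<Sum>j\<in>UNIV. \<Sum>k\<in>UNIV. C j k *
        (- 1 * (cnj (partial_deriv j (partial_deriv k f) x) * g x) + cnj (of_real (x $ j) * (of_real (x $ k) * f x)) * g x))
      - \<i>/2 * (\<Sum>j\<in>UNIV. \<Sum>k\<in>UNIV. B j k * (cnj (of_real (x $ k) * partial_deriv j f x) * g x
          - cnj (of_real (x $ j) * partial_deriv k f x) * g x))" for x
      unfolding H_op_def Let_def B_def[symmetric] C_def[symmetric]
      by (simp add: B_def C_def cnj_sum distrib_left distrib_right left_diff_distrib right_diff_distrib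
          sum_distrib_left sum_distrib_right mult_ac sum_negf[symmetric])
    then show ?thesis
      using has_bochner_integral_integral_eq[OF 2] unfolding pairing_def[of "H_op A f" g] by simp
  qed
  finally show ?thesis .
qed

lemma square_integrable_sum:
  "(\<And>i. i \<in> S \<Longrightarrow> square_integrable (F i)) \<Longrightarrow> square_integrable (\<lambda>x. \<Sum>i\<in>S. F i x)"
  by (induction S rule: infinite_finite_induct)
     (simp_all add: square_integrable_zero square_integrable_add)

lemma square_integrable_H_op:
  assumes g: "g \<in> schwartz"
  shows "square_integrable (H_op A g)"
  unfolding H_op_def Let_def
  by (intro square_integrable_add square_integrable_cmult square_integrable_sum square_integrable_diff
      square_integrable_coordinate_schwartz square_integrable_schwartz schwartz_partial_deriv g
      square_integrable_cmult[of _ "-1", simplified])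

subsection \<open>Creation and annihilation operators\<close>

text \<open>Taken without the customary factor 1 / sqrt 2, so the commutator with
  \<open>create\<close> is 2 instead of 1; the halves return in \<open>H_op_eq\<close>.\<close>

definition annihilate :: "'d \<Rightarrow> (real^'d \<Rightarrow> complex) \<Rightarrow> real^'d \<Rightarrow> complex" where
  "annihilate k f x = of_real (x $ k) * f x + partial_deriv k f x"

definition create :: "'d \<Rightarrow> (real^'d \<Rightarrow> complex) \<Rightarrow> real^'d \<Rightarrow> complex" where
  "create k f x = of_real (x $ k) * f x - partial_deriv k f x"

lemma poly_gauss_annihilate: "f \<in> poly_gauss \<Longrightarrow> annihilate k f \<in> poly_gauss"
  unfolding annihilate_def[abs_def]
  by (intro poly_gauss_add poly_gauss_coordinate poly_gauss_partial_deriv)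

lemma poly_gauss_create: "f \<in> poly_gauss \<Longrightarrow> create k f \<in> poly_gauss"
  unfolding create_def[abs_def]
  by (intro poly_gauss_diff poly_gauss_coordinate poly_gauss_partial_deriv)

lemma partial_deriv_lincomb:
  assumes "\<And>i. i \<in> S \<Longrightarrow> F i \<in> poly_gauss"
  shows "partial_deriv k (\<lambda>x. \<Sum>i\<in>S. c i * F i x) x = (\<Sum>i\<in>S. c i * partial_deriv k (F i) x)"
  using assms
proof (induction S rule: infinite_finite_induct)
  case (insert i S)
  have "(\<lambda>x. \<Sum>i\<in>S. c i * F i x) \<in> poly_gauss"
    using insert.prems by (intro poly_gauss_sum poly_gauss_cmult) auto
  then show ?case
    using insert by (simp add: partial_deriv_poly_gauss poly_gauss_cmult)
qed (simp_all add: partial_deriv_const)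

lemma annihilate_lincomb:
  assumes "\<And>i. i \<in> S \<Longrightarrow> F i \<in> poly_gauss"
  shows "annihilate k (\<lambda>x. \<Sum>i\<in>S. c i * F i x) x = (\<Sum>i\<in>S. c i * annihilate k (F i) x)"
  using assms by (simp add: annihilate_def partial_deriv_lincomb sum_distrib_left sum.distrib distrib_left mult_ac)

lemma create_lincomb:
  assumes "\<And>i. i \<in> S \<Longrightarrow> F i \<in> poly_gauss"
  shows "create k (\<lambda>x. \<Sum>i\<in>S. c i * F i x) x = (\<Sum>i\<in>S. c i * create k (F i) x)"
  using assms
  by (simp add: create_def partial_deriv_lincomb sum_distrib_left sum_subtractf right_diff_distrib mult_ac)

lemma partial_deriv_create:
  "f \<in> poly_gauss \<Longrightarrow> partial_deriv j (create k f) x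
    = of_real (x $ k) * partial_deriv j f x + (if j = k then f x else 0) - partial_deriv j (partial_deriv k f) x"
proof -
  assume f: "f \<in> poly_gauss"
  have "create k f = (\<lambda>x. of_real (x $ k) * f x + - 1 * partial_deriv k f x)"
    by (simp add: create_def fun_eq_iff)
  then show ?thesis
    by (simp only: partial_deriv_poly_gauss f poly_gauss.intros poly_gauss_partial_deriv) simp
qed

lemma partial_deriv_annihilate:
  "f \<in> poly_gauss \<Longrightarrow> partial_deriv j (annihilate k f) x
    = of_real (x $ k) * partial_deriv j f x + (if j = k then f x else 0) + partial_deriv j (partial_deriv k f) x"
  unfolding annihilate_def[abs_def]
  by (simp only: partial_deriv_poly_gauss poly_gauss.intros poly_gauss_partial_deriv)

lemma annihilate_create:
  assumes "f \<in> poly_gauss"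
  shows "annihilate j (create k f) x = create k (annihilate j f) x + (if j = k then 2 * f x else 0)"
  unfolding annihilate_def[of j "create k f"] create_def[of k "annihilate j f"]
    partial_deriv_create[OF assms] partial_deriv_annihilate[OF assms]
  by (simp add: annihilate_def create_def partial_deriv_commute[OF assms, of j k] algebra_simps)

lemma create_create:
  assumes "f \<in> poly_gauss"
  shows "create j (create k f) x = create k (create j f) x"
  unfolding create_def[of j "create k f"] create_def[of k "create j f"] partial_deriv_create[OF assms]
  by (simp add: create_def partial_deriv_commute[OF assms, of j k] algebra_simps)

text \<open>The first bracket, of oscillator type, is symmetric in \<open>j\<close> and
  \<open>k\<close>; the second, of angular momentum type, is antisymmetric. This is what separates
  the matrices \<open>C\<close> and \<open>B\<close> in \<open>H_op_eq\<close>.\<close>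

lemma create_annihilate:
  assumes "f \<in> poly_gauss"
  shows "create j (annihilate k f) x
    = (of_real (x $ j) * of_real (x $ k) * f x - partial_deriv j (partial_deriv k f) x)
      + (of_real (x $ j) * partial_deriv k f x - of_real (x $ k) * partial_deriv j f x)
      - (if j = k then f x else 0)"
  unfolding create_def[of j "annihilate k f"] partial_deriv_annihilate[OF assms]
  by (simp add: annihilate_def algebra_simps)

lemma annihilate_gaussian: "annihilate k gaussian = (\<lambda>x. 0)"
  by (simp add: annihilate_def partial_deriv_gaussian fun_eq_iff)

lemma pairing_lincomb_right:
  assumes "f \<in> poly_gauss" "\<And>i. i \<in> S \<Longrightarrow> square_integrable (G i)"
  shows "pairing f (\<lambda>x. \<Sum>i\<in>S. c i * G i x) = (\<Sum>i\<in>S. c i * pairing f (G i))"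
proof -
  have "has_bochner_integral lborel (\<lambda>x. \<Sum>i\<in>S. c i * (cnj (f x) * G i x)) (\<Sum>i\<in>S. c i * pairing f (G i))"
    by (intro has_bochner_integral_sum has_bochner_integral_mult_right has_pairing assms)
  then show ?thesis
    by (simp add: has_bochner_integral_iff pairing_def[of f "\<lambda>x. \<Sum>i\<in>S. c i * G i x"] sum_distrib_left mult_ac)
qed

lemma pairing_lincomb_left:
  assumes "\<And>i. i \<in> S \<Longrightarrow> F i \<in> poly_gauss" "square_integrable g"
  shows "pairing (\<lambda>x. \<Sum>i\<in>S. c i * F i x) g = (\<Sum>i\<in>S. cnj (c i) * pairing (F i) g)"
proof -
  have "has_bochner_integral lborel (\<lambda>x. \<Sum>i\<in>S. cnj (c i) * (cnj (F i x) * g x)) (\<Sum>i\<in>S. cnj (c i) * pairing (F i) g)"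
    by (intro has_bochner_integral_sum has_bochner_integral_mult_right has_pairing assms)
  then show ?thesis
    by (simp add: has_bochner_integral_iff pairing_def[of "\<lambda>x. \<Sum>i\<in>S. c i * F i x"] cnj_sum sum_distrib_left sum_distrib_right mult_ac)
qed

lemma pairing_cmult_right: "pairing f (\<lambda>x. c * g x) = c * pairing f g"
  by (simp add: pairing_def mult.left_commute)

lemma pairing_cmult_left: "pairing (\<lambda>x. c * f x) g = cnj c * pairing f g"
  by (simp add: pairing_def mult.assoc)

lemma pairing_create:
  assumes f: "f \<in> poly_gauss" and g: "g \<in> poly_gauss"
  shows "pairing f (create k g) = pairing (annihilate k f) g"
proof -
  have "pairing f (create k g) = pairing f (\<lambda>x. of_real (x $ k) * g x) - pairing f (partial_deriv k g)"
  proof -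
    have "has_bochner_integral lborel (\<lambda>x. cnj (f x) * (of_real (x $ k) * g x) - cnj (f x) * partial_deriv k g x)
       (pairing f (\<lambda>x. of_real (x $ k) * g x) - pairing f (partial_deriv k g))"
      by (intro has_bochner_integral_diff has_pairing f square_integrable_poly_gauss
          poly_gauss_coordinate poly_gauss_partial_deriv g)
    then show ?thesis
      by (simp add: has_bochner_integral_iff pairing_def[of f "create k g"] create_def right_diff_distrib)
  qed
  also have "\<dots> = pairing (\<lambda>x. of_real (x $ k) * f x) g + pairing (partial_deriv k f) g"
    by (simp add: pairing_coordinate pairing_partial_deriv f g poly_gauss_schwartz)
  also have "\<dots> = pairing (annihilate k f) g"
  proof -
    have "has_bochner_integral lborel (\<lambda>x. cnj (of_real (x $ k) * f x) * g x + cnj (partial_deriv k f x) * g x)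
       (pairing (\<lambda>x. of_real (x $ k) * f x) g + pairing (partial_deriv k f) g)"
      by (intro has_bochner_integral_add has_pairing f square_integrable_poly_gauss
          poly_gauss_coordinate poly_gauss_partial_deriv g)
    then show ?thesis
      by (simp add: has_bochner_integral_iff pairing_def[of "annihilate k f"] annihilate_def distrib_right)
  qed
  finally show ?thesis .
qed

lemma pairing_gaussian: "\<exists>c>0. pairing gaussian (gaussian :: real^'d \<Rightarrow> complex) = complex_of_real c"
proof -
  have "square_integrable (gaussian :: real^'d \<Rightarrow> complex)" by (rule square_integrable_poly_gauss[OF poly_gauss_gaussian])
  then have i: "integrable lborel (\<lambda>x::real^'d. (cmod (gaussian x))\<^sup>2)" by (simp add: square_integrable_def)
  let ?c = "LINT (x::real^'d)|lborel. (cmod (gaussian x))\<^sup>2"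
  have "pairing gaussian (gaussian :: real^'d \<Rightarrow> complex) = complex_of_real ?c"
    unfolding pairing_def integral_complex_of_real[symmetric]
    by (intro Bochner_Integration.integral_cong refl)
       (metis complex_norm_square mult.commute)
  moreover have "?c \<noteq> 0"
  proof
    assume "?c = 0"
    then have "AE x::real^'d in lborel. (cmod (gaussian x))\<^sup>2 = 0"
      using integral_nonneg_eq_0_iff_AE[OF i] by simp
    then have "AE x::real^'d in lborel. False"
      by eventually_elim (simp add: gaussian_def)
    then have "emeasure lborel (space (lborel :: (real^'d) measure)) = 0"
      by (simp add: AE_iff_measurable[OF _ refl] trivial_limit_def)
    then show False by simp
  qed
  moreover have "?c \<ge> 0" by simp
  ultimately show ?thesis by (metis less_eq_real_def)
qed

lemma pairing_cnj: "cnj (pairing f g) = pairing g f"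
  using Bochner_Integration.integral_cnj[of lborel "\<lambda>x. cnj (f x) * g x"]
  by (simp add: pairing_def mult.commute)

lemma pairing_zero_left: "pairing (\<lambda>x. 0) g = 0"
  by (simp add: pairing_def)

text \<open>Orthonormality of the rows yields the commutation relations of \<open>lower\<close> and
  \<open>raise\<close>, that of the columns inverts the change of operators. The conjugate
  coefficients in \<open>lower\<close> make it the adjoint of \<open>raise\<close>.\<close>

locale unitary_family =
  fixes v :: "'d::finite \<Rightarrow> 'd \<Rightarrow> complex"
  assumes rows: "(\<Sum>k\<in>UNIV. cnj (v l k) * v m k) = (if l = m then 1 else 0)"
    and columns: "(\<Sum>l\<in>UNIV. v l j * cnj (v l k)) = (if j = k then 1 else 0)"
begin

definition lower :: "'d \<Rightarrow> (real^'d \<Rightarrow> complex) \<Rightarrow> real^'d \<Rightarrow> complex" where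
  "lower l f x = (\<Sum>k\<in>UNIV. cnj (v l k) * annihilate k f x)"

definition raise :: "'d \<Rightarrow> (real^'d \<Rightarrow> complex) \<Rightarrow> real^'d \<Rightarrow> complex" where
  "raise l f x = (\<Sum>k\<in>UNIV. v l k * create k f x)"

lemma poly_gauss_lower: "f \<in> poly_gauss \<Longrightarrow> lower l f \<in> poly_gauss"
  unfolding lower_def[abs_def] by (intro poly_gauss_sum poly_gauss_cmult poly_gauss_annihilate)

lemma poly_gauss_raise: "f \<in> poly_gauss \<Longrightarrow> raise l f \<in> poly_gauss"
  unfolding raise_def[abs_def] by (intro poly_gauss_sum poly_gauss_cmult poly_gauss_create)

lemma raise_lower_eq:
  assumes "f \<in> poly_gauss"
  shows "raise m (lower l f) x = (\<Sum>j\<in>UNIV. \<Sum>k\<in>UNIV. v m j * cnj (v l k) * create j (annihilate k f) x)"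
  unfolding raise_def lower_def[abs_def]
  by (simp add: create_lincomb poly_gauss_annihilate assms sum_distrib_left mult.assoc)

lemma lower_raise:
  assumes f: "f \<in> poly_gauss"
  shows "lower l (raise m f) x = raise m (lower l f) x + (if l = m then 2 * f x else 0)"
proof -
  have "lower l (raise m f) x = (\<Sum>k\<in>UNIV. \<Sum>j\<in>UNIV. cnj (v l k) * v m j * annihilate k (create j f) x)"
    unfolding lower_def raise_def[abs_def]
    by (simp add: annihilate_lincomb poly_gauss_create f sum_distrib_left mult.assoc)
  also have "\<dots> = (\<Sum>k\<in>UNIV. \<Sum>j\<in>UNIV. cnj (v l k) * v m j * create j (annihilate k f) x)
      + (\<Sum>k\<in>UNIV. \<Sum>j\<in>UNIV. if k = j then cnj (v l k) * v m j * (2 * f x) else 0)"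
    unfolding sum.distrib[symmetric]
    by (intro sum.cong refl) (simp add: annihilate_create f distrib_left)
  also have "(\<Sum>k\<in>UNIV. \<Sum>j\<in>UNIV. if k = j then cnj (v l k) * v m j * (2 * f x) else 0)
      = (\<Sum>k\<in>UNIV. cnj (v l k) * v m k) * (2 * f x)"
    by (simp add: sum_distrib_right)
  also have "(\<Sum>k\<in>UNIV. \<Sum>j\<in>UNIV. cnj (v l k) * v m j * create j (annihilate k f) x)
     = raise m (lower l f) x"
    unfolding raise_lower_eq[OF f] by (subst sum.swap) (simp add: mult.commute)
  finally show ?thesis by (simp add: rows)
qed

lemma raise_raise:
  assumes f: "f \<in> poly_gauss"
  shows "raise l (raise m f) = raise m (raise l f)"
proof
  fix x
  have eq: "raise m f = (\<lambda>x. \<Sum>j\<in>UNIV. v m j * create j f x)" for m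
    by (rule ext) (rule raise_def)
  have *: "raise l (raise m f) x = (\<Sum>k\<in>UNIV. \<Sum>j\<in>UNIV. v l k * v m j * create k (create j f) x)" for l m
  proof -
    have "raise l (raise m f) x = (\<Sum>k\<in>UNIV. v l k * create k (raise m f) x)" by (rule raise_def)
    also have "\<dots> = (\<Sum>k\<in>UNIV. \<Sum>j\<in>UNIV. v l k * v m j * create k (create j f) x)"
      unfolding eq by (simp add: create_lincomb poly_gauss_create f sum_distrib_left mult.assoc)
    finally show ?thesis .
  qed
  have "raise l (raise m f) x = (\<Sum>j\<in>UNIV. \<Sum>k\<in>UNIV. v l k * v m j * create k (create j f) x)"
    unfolding * by (rule sum.swap)
  also have "\<dots> = raise m (raise l f) x"
    unfolding * by (intro sum.cong refl) (simp add: create_create[OF f] mult.commute)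
  finally show "raise l (raise m f) x = raise m (raise l f) x" .
qed

lemma pairing_raise:
  assumes f: "f \<in> poly_gauss" and g: "g \<in> poly_gauss"
  shows "pairing f (raise l g) = pairing (lower l f) g"
  unfolding raise_def[abs_def] lower_def[abs_def]
  by (simp add: pairing_lincomb_left pairing_lincomb_right f g square_integrable_poly_gauss
      poly_gauss_create poly_gauss_annihilate pairing_create)

lemma lower_gaussian: "lower l gaussian = (\<lambda>x. 0)"
  by (simp add: lower_def annihilate_gaussian fun_eq_iff)

lemma raise_cmult: "f \<in> poly_gauss \<Longrightarrow> raise l (\<lambda>x. c * f x) = (\<lambda>x. c * raise l f x)"
  by (simp add: raise_def create_def partial_deriv_poly_gauss sum_distrib_left right_diff_distrib mult_ac fun_eq_iff)

lemma lower_cmult: "f \<in> poly_gauss \<Longrightarrow> lower l (\<lambda>x. c * f x) = (\<lambda>x. c * lower l f x)"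
  by (simp add: lower_def annihilate_def partial_deriv_poly_gauss sum_distrib_left distrib_left mult_ac fun_eq_iff)

lemma raise_add:
  "f \<in> poly_gauss \<Longrightarrow> g \<in> poly_gauss \<Longrightarrow> raise l (\<lambda>x. f x + g x) = (\<lambda>x. raise l f x + raise l g x)"
  by (simp add: raise_def create_def partial_deriv_poly_gauss sum.distrib[symmetric] algebra_simps fun_eq_iff)

lemma lower_add:
  "f \<in> poly_gauss \<Longrightarrow> g \<in> poly_gauss \<Longrightarrow> lower l (\<lambda>x. f x + g x) = (\<lambda>x. lower l f x + lower l g x)"
  by (simp add: lower_def annihilate_def partial_deriv_poly_gauss sum.distrib[symmetric] algebra_simps fun_eq_iff)

text \<open>With \<open>create_raise\<close> this recovers multiplication by a coordinate, half the
  sum of \<open>annihilate\<close> and \<open>create\<close>, from the new operators;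
  \<open>poly_gauss_fock_span\<close> depends on it.\<close>

lemma annihilate_lower: "annihilate k f x = (\<Sum>l\<in>UNIV. v l k * lower l f x)"
proof -
  have "(\<Sum>l\<in>UNIV. v l k * lower l f x) = (\<Sum>l\<in>UNIV. \<Sum>j\<in>UNIV. v l k * cnj (v l j) * annihilate j f x)"
    by (simp add: lower_def sum_distrib_left mult.assoc)
  also have "\<dots> = (\<Sum>j\<in>UNIV. (\<Sum>l\<in>UNIV. v l k * cnj (v l j)) * annihilate j f x)"
    by (subst sum.swap) (simp add: sum_distrib_right)
  finally show ?thesis by (simp add: columns if_distrib[of "\<lambda>c. c * _"] cong: if_cong)
qed

lemma create_raise: "create k f x = (\<Sum>l\<in>UNIV. cnj (v l k) * raise l f x)"
proof -
  have "(\<Sum>l\<in>UNIV. cnj (v l k) * raise l f x) = (\<Sum>l\<in>UNIV. \<Sum>j\<in>UNIV. v l j * cnj (v l k) * create j f x)"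
    by (simp add: raise_def sum_distrib_left mult_ac)
  also have "\<dots> = (\<Sum>j\<in>UNIV. (\<Sum>l\<in>UNIV. v l j * cnj (v l k)) * create j f x)"
    by (subst sum.swap) (simp add: sum_distrib_right)
  finally show ?thesis by (simp add: columns if_distrib[of "\<lambda>c. c * _"] cong: if_cong)
qed

subsection \<open>Excited states\<close>

text \<open>Lists provide the recursion; since raising operators commute, only the multiset of the
  list matters (\<open>excited_perm\<close>).\<close>

definition excited :: "'d list \<Rightarrow> real^'d \<Rightarrow> complex" where
  "excited js = foldr raise js gaussian"

lemma excited_Nil [simp]: "excited [] = gaussian"
  and excited_Cons [simp]: "excited (j # js) = raise j (excited js)"
  by (simp_all add: excited_def)

lemma poly_gauss_excited: "excited js \<in> poly_gauss"
  by (induction js) (simp_all add: poly_gauss_raise poly_gauss_gaussian)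

lemma excited_move: "excited (xs @ j # ys) = raise j (excited (xs @ ys))"
  by (induction xs) (simp_all add: raise_raise poly_gauss_excited)

lemma excited_perm: "mset js = mset ks \<Longrightarrow> excited js = excited ks"
proof (induction js arbitrary: ks)
  case (Cons j js)
  have "j \<in> set ks" using Cons.prems by (metis list.set_intros(1) set_mset_mset)
  then obtain xs ys where ks: "ks = xs @ j # ys" by (meson split_list)
  have "excited js = excited (xs @ ys)"
    by (rule Cons.IH) (use Cons.prems in \<open>simp add: ks\<close>)
  then show ?case by (simp add: ks excited_move)
qed simp

text \<open>Moving \<open>lower l\<close> to the right past the raising operators leaves 2 f for
  each one with index \<open>l\<close>, until it annihilates the Gaussian. If \<open>l\<close> does
  not occur, the count 0 makes the list on the right irrelevant.\<close>

lemma lower_excited: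
  "lower l (excited js) x = 2 * of_nat (count (mset js) l) * excited (remove1 l js) x"
proof (induction js arbitrary: x)
  case Nil
  then show ?case by (simp add: lower_gaussian)
next
  case (Cons j js)
  have eq: "lower l (excited js) = (\<lambda>x. 2 * of_nat (count (mset js) l) * excited (remove1 l js) x)"
    using Cons.IH by (simp add: fun_eq_iff)
  have "lower l (excited (j # js)) x = raise j (lower l (excited js)) x + (if l = j then 2 * excited js x else 0)"
    by (simp add: lower_raise poly_gauss_excited)
  also have "raise j (lower l (excited js)) x
      = 2 * of_nat (count (mset js) l) * raise j (excited (remove1 l js)) x"
    unfolding eq by (simp add: raise_cmult poly_gauss_excited)
  also have "2 * of_nat (count (mset js) l) * raise j (excited (remove1 l js)) x
      + (if l = j then 2 * excited js x else 0)
    = 2 * of_nat (count (mset (j # js)) l) * excited (remove1 l (j # js)) x"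
  proof (cases "l = j")
    case True
    have "raise j (excited (remove1 j js)) = excited js" if "j \<in> set js"
      using excited_perm[of "j # remove1 j js" js] that by simp
    then show ?thesis
      using True by (cases "j \<in> set js") (auto simp: algebra_simps count_eq_zero_iff[THEN iffD2])
  qed simp
  finally show ?case .
qed

lemma raise_lower_excited:
  "raise l (lower l (excited js)) x = 2 * of_nat (count (mset js) l) * excited js x"
proof -
  have "lower l (excited js) = (\<lambda>x. 2 * of_nat (count (mset js) l) * excited (remove1 l js) x)"
    by (simp add: lower_excited fun_eq_iff)
  moreover have "raise l (excited (remove1 l js)) = excited js" if "l \<in> set js"
    using excited_perm[of "l # remove1 l js" js] that by simp
  moreover have "raise l (\<lambda>x. 0) x = 0"
    using raise_cmult[OF poly_gauss_gaussian, of l 0] by (simp add: fun_eq_iff)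
  ultimately show ?thesis
    by (cases "l \<in> set js") (simp_all add: raise_cmult poly_gauss_excited count_eq_zero_iff[THEN iffD2])
qed

text \<open>The leading raising operator of one state acts on the other as a lowering operator and
  deletes one \<open>j\<close> there, which leaves the multisets different. At the end a raising
  operator meets the Gaussian and gives 0.\<close>

lemma pairing_excited_neq: "mset ks \<noteq> mset js \<Longrightarrow> pairing (excited ks) (excited js) = 0"
proof (induction js arbitrary: ks)
  case Nil
  then obtain k ks' where ks: "ks = k # ks'" by (cases ks) auto
  have "pairing gaussian (raise k (excited ks')) = 0"
    by (simp add: pairing_raise poly_gauss_excited poly_gauss_gaussian lower_gaussian pairing_zero_left)
  moreover have "pairing (excited ks) gaussian = cnj (pairing gaussian (excited ks))"
    by (simp add: pairing_cnj)
  ultimately show ?case by (simp add: ks)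
next
  case (Cons j js)
  have eq: "lower j (excited ks) = (\<lambda>x. 2 * of_nat (count (mset ks) j) * excited (remove1 j ks) x)"
    by (simp add: lower_excited fun_eq_iff)
  have "pairing (excited ks) (excited (j # js)) = 2 * of_nat (count (mset ks) j) * pairing (excited (remove1 j ks)) (excited js)"
    by (simp add: pairing_raise poly_gauss_excited eq pairing_cmult_left)
  moreover have "mset (remove1 j ks) \<noteq> mset js" if "j \<in> set ks"
  proof
    assume "mset (remove1 j ks) = mset js"
    then have "mset (j # remove1 j ks) = mset (j # js)" by (simp only: mset.simps)
    then show False using Cons.prems that by simp
  qed
  ultimately show ?case
    using Cons.IH by (cases "j \<in> set ks") (auto simp: count_eq_zero_iff[THEN iffD2])
qed

lemma pairing_excited_self: "\<exists>c>0. pairing (excited js) (excited js) = complex_of_real c"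
proof (induction js)
  case (Cons j js)
  then obtain c where c: "c > 0" "pairing (excited js) (excited js) = complex_of_real c" by blast
  have eq: "lower j (excited (j # js)) = (\<lambda>x. 2 * of_nat (count (mset (j # js)) j) * excited js x)"
    by (simp only: lower_excited fun_eq_iff remove1.simps if_True simp_thms)
  have "pairing (excited (j # js)) (excited (j # js))
      = pairing (lower j (excited (j # js))) (excited js)"
    by (simp add: pairing_raise poly_gauss_excited poly_gauss_raise)
  also have "\<dots> = of_real (2 * of_nat (count (mset (j # js)) j) * c)"
    unfolding eq by (simp add: pairing_cmult_left c)
  finally show ?case using c(1) by (intro exI[of _ "2 * of_nat (count (mset (j # js)) j) * c"]) auto
qed (use pairing_gaussian in simp)

inductive_set fock_span :: "(real^'d \<Rightarrow> complex) set" where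
  fock_span_excited: "excited js \<in> fock_span"
| fock_span_cmult: "f \<in> fock_span \<Longrightarrow> (\<lambda>x. c * f x) \<in> fock_span"
| fock_span_add: "f \<in> fock_span \<Longrightarrow> g \<in> fock_span \<Longrightarrow> (\<lambda>x. f x + g x) \<in> fock_span"

lemma fock_span_sum:
  "(\<And>i. i \<in> S \<Longrightarrow> F i \<in> fock_span) \<Longrightarrow> (\<lambda>x. \<Sum>i\<in>S. F i x) \<in> fock_span"
proof (induction S rule: infinite_finite_induct)
  case empty
  show ?case using fock_span_cmult[OF fock_span_excited, of 0] by simp
next
  case (infinite S)
  show ?case using fock_span_cmult[OF fock_span_excited, of 0] infinite by simp
qed (simp_all add: fock_span_add)

lemma fock_span_poly_gauss: "f \<in> fock_span \<Longrightarrow> f \<in> poly_gauss"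
  by (induction rule: fock_span.induct) (auto intro: poly_gauss.intros poly_gauss_excited)

lemma fock_span_raise: "f \<in> fock_span \<Longrightarrow> raise l f \<in> fock_span"
proof (induction rule: fock_span.induct)
  case (fock_span_excited js)
  then show ?case using fock_span.fock_span_excited[of "l # js"] by simp
qed (auto simp: raise_cmult raise_add fock_span_poly_gauss intro: fock_span.intros)

lemma fock_span_lower: "f \<in> fock_span \<Longrightarrow> lower l f \<in> fock_span"
proof (induction rule: fock_span.induct)
  case (fock_span_excited js)
  have "lower l (excited js) = (\<lambda>x. 2 * of_nat (count (mset js) l) * excited (remove1 l js) x)"
    by (simp add: lower_excited fun_eq_iff)
  then show ?case by (simp add: fock_span.intros)
qed (auto simp: lower_cmult lower_add fock_span_poly_gauss intro: fock_span.intros)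

text \<open>Coordinate multiplication is half of annihilation plus creation, both of which are
  combinations of \<open>lower\<close> and \<open>raise\<close>; the span of the excited states is
  stable under these.\<close>

lemma poly_gauss_fock_span: "f \<in> poly_gauss \<Longrightarrow> f \<in> fock_span"
proof (induction rule: poly_gauss.induct)
  case poly_gauss_gaussian
  then show ?case using fock_span_excited[of "[]"] by simp
next
  case (poly_gauss_coordinate f k)
  have "of_real (x $ k) * f x = 1/2 * ((\<Sum>l\<in>UNIV. v l k * lower l f x) + (\<Sum>l\<in>UNIV. cnj (v l k) * raise l f x))" for x
    unfolding annihilate_lower[symmetric] create_raise[symmetric] by (simp add: annihilate_def create_def)
  then show ?case
    using poly_gauss_coordinate.IH
    by (simp only:) (intro fock_span.intros fock_span_sum fock_span_raise fock_span_lower)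
qed (auto intro: fock_span.intros)

subsection \<open>Diagonalisation\<close>

text \<open>The matrix in \<open>diag\<close> is C - i B, the conjugate of i A. Summed against
  \<open>create_annihilate\<close>, the symmetric C retains only the symmetric part \<open>D\<close>
  and the antisymmetric B only \<open>E\<close>. The diagonal term contributes minus half the trace
  of C, and that half trace, Re (i/2 tr A), is the ground state energy.\<close>

lemma H_op_eq:
  fixes A :: "complex^'d^'d"
  assumes A: "anti_hermitian A"
    and diag: "\<And>j k. - of_real (Im (A $ j $ k)) - \<i> * of_real (Re (A $ j $ k))
       = (\<Sum>l\<in>UNIV. of_real (\<mu> l) * v l j * cnj (v l k))"
    and f: "f \<in> poly_gauss"
  shows "H_op A f x = (\<Sum>l\<in>UNIV. of_real (\<mu> l) / 2 * raise l (lower l f) x)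
     + of_real (Re (\<i> / 2 * trace A)) * f x"
proof -
  define B where "B j k = complex_of_real (Re (A $ j $ k))" for j k
  define C where "C j k = complex_of_real (- Im (A $ j $ k))" for j k
  have cnjA: "cnj (A $ k $ j) = - (A $ j $ k)" for j k
    using A by (simp add: anti_hermitian_def)
  have BC: "B k j = - B j k" "C k j = C j k" for j k
    using arg_cong[OF cnjA[of k j], of Re] arg_cong[OF cnjA[of k j], of Im] by (simp_all add: B_def C_def)
  have B0: "B j j = 0" for j
    using BC(1)[of j j] by simp
  define D where "D j k = of_real (x $ j) * of_real (x $ k) * f x - partial_deriv j (partial_deriv k f) x" for j k
  define E where "E j k = of_real (x $ j) * partial_deriv k f x - of_real (x $ k) * partial_deriv j f x" for j k
  have DE: "D k j = D j k" "E k j = - E j k" for j k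
    by (simp_all add: D_def E_def partial_deriv_commute[OF f, of j k] mult.commute)
  have anti: "(\<Sum>j\<in>UNIV. \<Sum>k\<in>UNIV. X j k) = 0" if "\<And>j k. X k j = - X j k" for X :: "'d \<Rightarrow> 'd \<Rightarrow> complex"
  proof -
    have "(\<Sum>j\<in>UNIV. \<Sum>k\<in>UNIV. X j k) = (\<Sum>k\<in>UNIV. \<Sum>j\<in>UNIV. X j k)" by (rule sum.swap)
    also have "\<dots> = - (\<Sum>j\<in>UNIV. \<Sum>k\<in>UNIV. X j k)"
      unfolding sum_negf[symmetric] by (intro sum.cong refl that)
    finally show ?thesis by (simp add: equal_neg_zero)
  qed
  have CE: "(\<Sum>j\<in>UNIV. \<Sum>k\<in>UNIV. C j k * E j k) = 0"
  proof (rule anti)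
    show "C k j * E k j = - (C j k * E j k)" for j k
      unfolding BC(2)[of k j] DE(2)[of k j] by (rule mult_minus_right)
  qed
  have BD: "(\<Sum>j\<in>UNIV. \<Sum>k\<in>UNIV. B j k * D j k) = 0"
  proof (rule anti)
    show "B k j * D k j = - (B j k * D j k)" for j k
      unfolding BC(1)[of k j] DE(1)[of k j] by (rule mult_minus_left)
  qed
  have CB: "(\<Sum>j\<in>UNIV. \<Sum>k\<in>UNIV. if j = k then (C j k - \<i> * B j k) * f x else 0) = (\<Sum>j\<in>UNIV. C j j) * f x"
    by (simp add: B0 sum_distrib_right)
  have "(\<Sum>l\<in>UNIV. of_real (\<mu> l) / 2 * raise l (lower l f) x)
    = 1/2 * (\<Sum>l\<in>UNIV. \<Sum>j\<in>UNIV. \<Sum>k\<in>UNIV. of_real (\<mu> l) * v l j * cnj (v l k) * create j (annihilate k f) x)"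
    by (simp add: raise_lower_eq f sum_distrib_left mult_ac)
  also have "(\<Sum>l\<in>UNIV. \<Sum>j\<in>UNIV. \<Sum>k\<in>UNIV. of_real (\<mu> l) * v l j * cnj (v l k) * create j (annihilate k f) x)
    = (\<Sum>j\<in>UNIV. \<Sum>k\<in>UNIV. \<Sum>l\<in>UNIV. of_real (\<mu> l) * v l j * cnj (v l k) * create j (annihilate k f) x)"
    by (rule trans[OF sum.swap]) (rule sum.cong[OF refl], rule sum.swap)
  also have "\<dots> = (\<Sum>j\<in>UNIV. \<Sum>k\<in>UNIV. (C j k - \<i> * B j k) * (D j k + E j k - (if j = k then f x else 0)))"
    unfolding create_annihilate[OF f] D_def[symmetric] E_def[symmetric] sum_distrib_right[symmetric]
      diag[symmetric] by (simp add: B_def C_def)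
  also have "\<dots> = (\<Sum>j\<in>UNIV. \<Sum>k\<in>UNIV. C j k * D j k - \<i> * (B j k * E j k) + C j k * E j k
      - \<i> * (B j k * D j k) - (if j = k then (C j k - \<i> * B j k) * f x else 0))"
  proof (intro sum.cong refl)
    fix j k
    have "(c - \<i> * b) * (d + e - g) = c * d - \<i> * (b * e) + c * e - \<i> * (b * d) - (c - \<i> * b) * g" for b c d e g
      by (simp add: algebra_simps)
    from this[of "C j k" "B j k" "D j k" "E j k" "if j = k then f x else 0"]
    show "(C j k - \<i> * B j k) * (D j k + E j k - (if j = k then f x else 0))
      = C j k * D j k - \<i> * (B j k * E j k) + C j k * E j k
      - \<i> * (B j k * D j k) - (if j = k then (C j k - \<i> * B j k) * f x else 0)"
      by (cases "j = k") simp_all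
  qed
  also have "\<dots> = (\<Sum>j\<in>UNIV. \<Sum>k\<in>UNIV. C j k * D j k) - \<i> * (\<Sum>j\<in>UNIV. \<Sum>k\<in>UNIV. B j k * E j k)
      + (\<Sum>j\<in>UNIV. \<Sum>k\<in>UNIV. C j k * E j k) - \<i> * (\<Sum>j\<in>UNIV. \<Sum>k\<in>UNIV. B j k * D j k)
      - (\<Sum>j\<in>UNIV. \<Sum>k\<in>UNIV. if j = k then (C j k - \<i> * B j k) * f x else 0)"
    by (simp only: sum.distrib sum_subtractf sum_distrib_left)
  also have "\<dots> = (\<Sum>j\<in>UNIV. \<Sum>k\<in>UNIV. C j k * D j k) - \<i> * (\<Sum>j\<in>UNIV. \<Sum>k\<in>UNIV. B j k * E j k)
      - (\<Sum>j\<in>UNIV. C j j) * f x"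
    unfolding CE BD CB by simp
  finally have 1: "(\<Sum>l\<in>UNIV. of_real (\<mu> l) / 2 * raise l (lower l f) x)
    = 1/2 * ((\<Sum>j\<in>UNIV. \<Sum>k\<in>UNIV. C j k * D j k) - \<i> * (\<Sum>j\<in>UNIV. \<Sum>k\<in>UNIV. B j k * E j k)
      - (\<Sum>j\<in>UNIV. C j j) * f x)" .
  have tr: "complex_of_real (Re (\<i> / 2 * trace A)) = 1/2 * (\<Sum>j\<in>UNIV. C j j)"
    by (simp add: trace_def C_def sum_negf)
  have "(\<Sum>j\<in>UNIV. \<Sum>k\<in>UNIV. B j k * - E j k) = - (\<Sum>j\<in>UNIV. \<Sum>k\<in>UNIV. B j k * E j k)"
    by (simp add: sum_negf)
  moreover have "H_op A f x = 1/2 * (\<Sum>j\<in>UNIV. \<Sum>k\<in>UNIV. C j k * D j k) + \<i>/2 * (\<Sum>j\<in>UNIV. \<Sum>k\<in>UNIV. B j k * - E j k)"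
    unfolding H_op_def Let_def B_def[symmetric] C_def[symmetric] D_def E_def by simp
  moreover have "1/2 * a + \<i>/2 * (- b) = 1/2 * (a - \<i> * b - c * d) + 1/2 * c * d" for a b c d
    by (simp add: algebra_simps)
  ultimately show ?thesis
    unfolding 1 tr by (simp only:)
qed

end

subsection \<open>Diagonalisation of anti-Hermitian matrices\<close>

definition herm :: "complex^'n \<Rightarrow> complex^'n \<Rightarrow> complex" where
  "herm u v = (\<Sum>i\<in>UNIV. cnj (u $ i) * v $ i)"

lemma Re_herm: "Re (herm u v) = u \<bullet> v"
  by (simp add: herm_def inner_vec_def inner_complex_def)

lemma herm_scale_left: "herm (c *s u) v = cnj c * herm u v"
  by (simp add: herm_def sum_distrib_left mult.assoc)

lemma herm_cnj: "cnj (herm u v) = herm v u"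
  by (simp add: herm_def cnj_sum mult.commute)

lemma herm_eq: "herm u v = Complex (u \<bullet> v) ((\<i> *s u) \<bullet> v)"
  by (simp add: complex_eq_iff Re_herm[symmetric] herm_scale_left)

lemma herm_matrix:
  assumes "\<And>j k. N $ k $ j = cnj (N $ j $ k)"
  shows "herm (N *v u) w = herm u (N *v w)"
proof -
  have "herm (N *v u) w = (\<Sum>i\<in>UNIV. \<Sum>j\<in>UNIV. N $ j $ i * cnj (u $ j) * w $ i)"
    by (simp add: herm_def matrix_vector_mult_def cnj_sum sum_distrib_right assms[symmetric])
  also have "\<dots> = (\<Sum>j\<in>UNIV. \<Sum>i\<in>UNIV. N $ j $ i * cnj (u $ j) * w $ i)"
    by (rule sum.swap)
  also have "\<dots> = herm u (N *v w)"
    by (simp add: herm_def matrix_vector_mult_def sum_distrib_left mult_ac)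
  finally show ?thesis .
qed

text \<open>If b were nonzero, the value at t = - b / (c + 1) would be negative; c + 1 instead of c
  allows c = 0. This is the first variation at a maximum.\<close>

lemma nonneg_quadratic_linear_term:
  fixes b c :: real
  assumes "\<And>t. 0 \<le> 2 * t * b + t\<^sup>2 * c" "0 \<le> c"
  shows "b = 0"
proof (rule ccontr)
  assume b: "b \<noteq> 0"
  have "2 * (- b / d) * b + (- b / d)\<^sup>2 * c = - (b\<^sup>2 * (2 * d - c)) / d\<^sup>2" if "d \<noteq> 0" for d
    using that by (simp add: field_simps power2_eq_square)
  from this[of "c + 1"]
  have "2 * (- b / (c + 1)) * b + (- b / (c + 1))\<^sup>2 * c = - (b\<^sup>2 * (c + 2)) / (c + 1)\<^sup>2"
    using assms(2) by simp
  moreover have "- (b\<^sup>2 * (c + 2)) / (c + 1)\<^sup>2 < 0"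
    using b assms(2) by (intro divide_neg_pos) auto
  ultimately show False using assms(1)[of "- b / (c + 1)"] by linarith
qed

text \<open>Maximising the Rayleigh quotient over the unit sphere of an invariant subspace.\<close>

lemma symmetric_max_eigenvector:
  fixes T :: "'a::euclidean_space \<Rightarrow> 'a"
  assumes T: "linear T" and sym: "\<And>u w. T u \<bullet> w = u \<bullet> T w"
    and S: "subspace S" and inv: "\<And>u. u \<in> S \<Longrightarrow> T u \<in> S" and nz: "\<exists>u\<in>S. u \<noteq> 0"
  obtains u \<nu> where "u \<in> S" "norm u = 1" "T u = \<nu> *\<^sub>R u"
proof -
  let ?K = "S \<inter> sphere 0 1"
  have comp: "compact ?K" by (intro closed_Int_compact closed_subspace S compact_sphere)
  obtain u0 where "u0 \<in> S" "u0 \<noteq> 0" using nz by blast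
  then have "u0 /\<^sub>R norm u0 \<in> ?K" by (simp add: subspace_scale[OF S])
  then have ne: "?K \<noteq> {}" by blast
  have "bounded_linear T" using T linear_conv_bounded_linear by blast
  then have cont: "continuous_on ?K (\<lambda>u. T u \<bullet> u)"
    by (rule continuous_on_inner[OF linear_continuous_on continuous_on_id])
  obtain u where u: "u \<in> ?K" and max: "\<And>w. w \<in> ?K \<Longrightarrow> T w \<bullet> w \<le> T u \<bullet> u"
    using continuous_attains_sup[OF comp ne cont] by blast
  define \<nu> where "\<nu> = T u \<bullet> u"
  have nu: "u \<bullet> u = 1" using u by (simp add: norm_eq_1)
  have pos: "T w \<bullet> w \<le> \<nu> * (w \<bullet> w)" if w: "w \<in> S" for w
  proof (cases "w = 0")
    case False
    then have "w /\<^sub>R norm w \<in> ?K" using w by (simp add: subspace_scale[OF S])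
    from max[OF this] have "(T w \<bullet> w) / (norm w)\<^sup>2 \<le> \<nu>"
      by (simp add: linear_cmul[OF T] \<nu>_def power2_eq_square divide_inverse mult_ac)
    then show ?thesis using False by (simp add: pos_divide_le_eq power2_norm_eq_inner)
  qed (simp add: linear_0[OF T])
  have orth: "(\<nu> *\<^sub>R u - T u) \<bullet> w = 0" if w: "w \<in> S" for w
  proof (rule nonneg_quadratic_linear_term)
    fix t
    have "T (u + t *\<^sub>R w) \<bullet> (u + t *\<^sub>R w) \<le> \<nu> * ((u + t *\<^sub>R w) \<bullet> (u + t *\<^sub>R w))"
      using u w by (intro pos subspace_add[OF S] subspace_scale[OF S]) auto
    moreover have "T w \<bullet> u = T u \<bullet> w" using sym[of w u] by (simp add: inner_commute)
    ultimately show "0 \<le> 2 * t * ((\<nu> *\<^sub>R u - T u) \<bullet> w) + t\<^sup>2 * (\<nu> * (w \<bullet> w) - T w \<bullet> w)"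
      by (simp add: linear_add[OF T] linear_cmul[OF T] inner_add_left inner_add_right inner_diff_left
          inner_commute[of w u] \<nu>_def[symmetric] nu algebra_simps power2_eq_square)
  qed (use pos[OF w] in simp)
  \<comment> \<open>The defect lies in \<open>S\<close> and is orthogonal to all of
    \<open>S\<close>, in particular to itself.\<close>
  have "\<nu> *\<^sub>R u - T u \<in> S"
    using u by (intro subspace_diff[OF S] subspace_scale[OF S] inv) auto
  from orth[OF this] have "T u = \<nu> *\<^sub>R u" by simp
  then show thesis using that[of u \<nu>] u by simp
qed

text \<open>The complex orthogonal complement of the eigenvectors found so far is invariant.
  Regarded as a real subspace it contains a maximiser of the Rayleigh quotient, whose real
  eigenvalue makes it a complex eigenvector as well.\<close>

lemma hermitian_orthonormal_eigenvectors:
  fixes N :: "complex^'n^'n"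
  assumes N: "\<And>j k. N $ k $ j = cnj (N $ j $ k)" and "n \<le> CARD('n)"
  shows "\<exists>F. finite F \<and> card F = n \<and> (\<forall>u\<in>F. \<forall>w\<in>F. herm u w = (if u = w then 1 else 0)) \<and>
    (\<forall>u\<in>F. \<exists>\<nu>::real. N *v u = of_real \<nu> *s u)"
  using assms(2)
proof (induction n)
  case (Suc n)
  then obtain F where F: "finite F" "card F = n"
    and on: "\<And>u w. u \<in> F \<Longrightarrow> w \<in> F \<Longrightarrow> herm u w = (if u = w then 1 else 0)"
    and ev: "\<And>u. u \<in> F \<Longrightarrow> \<exists>\<nu>::real. N *v u = of_real \<nu> *s u"
    by auto
  define S where "S = {u. \<forall>f\<in>F. herm f u = 0}"
  have lin: "linear (\<lambda>u. N *v u)"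
    by (rule linearI, rule matrix_vector_right_distrib)
       (simp add: vec_eq_iff matrix_vector_mult_def scaleR_sum_right)
  have "subspace S"
    unfolding S_def subspace_def by (auto simp: herm_eq inner_add_right complex_eq_iff)
  moreover have "N *v u \<in> S" if "u \<in> S" for u
  proof -
    have "herm f (N *v u) = 0" if f: "f \<in> F" for f
    proof -
      obtain \<nu> :: real where "N *v f = of_real \<nu> *s f" using ev[OF f] by blast
      then have "herm f (N *v u) = of_real \<nu> * herm f u"
        using herm_matrix[OF N, of f u] by (simp add: herm_scale_left)
      then show ?thesis using \<open>u \<in> S\<close> f by (simp add: S_def)
    qed
    then show ?thesis by (simp add: S_def)
  qed
  moreover have "\<exists>u\<in>S. u \<noteq> 0"
  proof -
    \<comment> \<open>Complex orthogonality to \<open>f\<close> is real orthogonality to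
      \<open>f\<close> and to \<open>\<i> *s f\<close>; at most 2 n real conditions leave a nonzero
      vector in real dimension \<open>2 * CARD('n)\<close>.\<close>
    let ?G = "F \<union> (\<lambda>u. \<i> *s u) ` F"
    have "dim ?G \<le> card ?G" using F by (intro dim_le_card') auto
    also have "\<dots> \<le> card F + card ((\<lambda>u. \<i> *s u) ` F)" by (rule card_Un_le)
    also have "\<dots> \<le> n + n" using card_image_le[OF F(1)] F(2) by (metis add_le_cancel_left)
    also have "\<dots> < DIM(complex^'n)" using Suc.prems by simp
    finally obtain u where u: "u \<noteq> 0" "\<And>y. y \<in> span ?G \<Longrightarrow> orthogonal u y"
      using orthogonal_to_subspace_exists[of ?G] by blast
    have "f \<bullet> u = 0" "(\<i> *s f) \<bullet> u = 0" if "f \<in> F" for f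
      using u(2)[of f] u(2)[of "\<i> *s f"] that
      by (auto simp: orthogonal_def inner_commute intro: span_base)
    then have "u \<in> S" by (simp add: S_def herm_eq complex_eq_iff)
    with u show ?thesis by blast
  qed
  moreover have "(N *v u) \<bullet> w = u \<bullet> (N *v w)" for u w
    using herm_matrix[OF N, of u w] by (simp add: Re_herm[symmetric])
  ultimately obtain u \<nu> where u: "u \<in> S" "norm u = 1" "N *v u = \<nu> *\<^sub>R u"
    using symmetric_max_eigenvector[OF lin] by metis
  have uu: "herm u u = 1"
  proof -
    have "Im (herm u u) = 0" using arg_cong[OF herm_cnj[of u u], of Im] by simp
    then show ?thesis using u(2) by (simp add: complex_eq_iff Re_herm norm_eq_1)
  qed
  have uF: "herm f u = 0" "herm u f = 0" if "f \<in> F" for f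
    using u(1) that herm_cnj[of f u] by (auto simp: S_def)
  have "u \<notin> F" using uF uu by force
  moreover have "\<nu> *\<^sub>R u = of_real \<nu> *s u"
    unfolding vec_eq_iff vector_scaleR_component vector_smult_component
    by (simp add: scaleR_conv_of_real)
  ultimately show ?case
    using F on ev u uu uF by (intro exI[of _ "insert u F"]) auto
qed (auto intro: exI[of _ "{}"])

lemma hermitian_diagonalise:
  fixes N :: "complex^'n^'n"
  assumes N: "\<And>j k. N $ k $ j = cnj (N $ j $ k)"
  obtains w :: "'n \<Rightarrow> complex^'n" and \<mu> :: "'n \<Rightarrow> real" where
    "\<And>l m. herm (w l) (w m) = (if l = m then 1 else 0)"
    "\<And>j k. (\<Sum>l\<in>UNIV. w l $ j * cnj (w l $ k)) = (if j = k then 1 else 0)"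
    "\<And>j k. N $ j $ k = (\<Sum>l\<in>UNIV. of_real (\<mu> l) * w l $ j * cnj (w l $ k))"
proof -
  obtain F where F: "finite F" "card F = CARD('n)"
    and on: "\<And>u w. u \<in> F \<Longrightarrow> w \<in> F \<Longrightarrow> herm u w = (if u = w then 1 else 0)"
    and ev: "\<And>u. u \<in> F \<Longrightarrow> \<exists>\<nu>::real. N *v u = of_real \<nu> *s u"
    using hermitian_orthonormal_eigenvectors[OF N order.refl] by blast
  obtain w where w: "bij_betw w (UNIV :: 'n set) F"
    using F finite_same_card_bij[of "UNIV :: 'n set" F] by auto
  have wF: "w l \<in> F" for l using w by (auto simp: bij_betw_def)
  have inj: "inj w" using w by (simp add: bij_betw_def)
  have "\<forall>l. \<exists>\<nu>::real. N *v w l = of_real \<nu> *s w l" using ev[OF wF] by blast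
  then obtain \<mu> where \<mu>: "\<And>l. N *v w l = of_real (\<mu> l) *s w l" by metis
  have rows: "herm (w l) (w m) = (if l = m then 1 else 0)" for l m
    using on[OF wF wF] inj by (simp add: inj_eq)
  define V where "V = (\<chi> l j. cnj (w l $ j))"
  define W where "W = (\<chi> j l. w l $ j)"
  have "V ** W = mat 1"
    using rows by (simp add: V_def W_def matrix_matrix_mult_def mat_def vec_eq_iff herm_def)
  \<comment> \<open>A one-sided inverse of a square matrix is two-sided; this converts
    orthonormality into completeness.\<close>
  then have WV: "W ** V = mat 1" by (simp add: matrix_left_right_inverse)
  have cols: "(\<Sum>l\<in>UNIV. w l $ j * cnj (w l $ k)) = (if j = k then 1 else 0)" for j k
    using arg_cong[OF WV, of "\<lambda>M. M $ j $ k"]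
    by (simp add: V_def W_def matrix_matrix_mult_def mat_def)
  have "N $ j $ k = (\<Sum>l\<in>UNIV. of_real (\<mu> l) * w l $ j * cnj (w l $ k))" for j k
  proof -
    have "(\<Sum>l\<in>UNIV. of_real (\<mu> l) * w l $ j * cnj (w l $ k)) = (\<Sum>l\<in>UNIV. (N *v w l) $ j * cnj (w l $ k))"
      by (simp add: \<mu>)
    also have "\<dots> = (\<Sum>l\<in>UNIV. \<Sum>m\<in>UNIV. N $ j $ m * (w l $ m * cnj (w l $ k)))"
      by (simp add: matrix_vector_mult_def sum_distrib_right mult.assoc)
    also have "\<dots> = (\<Sum>m\<in>UNIV. N $ j $ m * (\<Sum>l\<in>UNIV. w l $ m * cnj (w l $ k)))"
      by (subst sum.swap) (simp add: sum_distrib_left)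
    also have "\<dots> = N $ j $ k" by (simp add: cols if_distrib cong: if_cong)
    finally show ?thesis ..
  qed
  with rows cols that show thesis by blast
qed

text \<open>The two products agree as polynomials, hence have the same multiset of roots. This
  matches eigenvalues found by diagonalisation with a prescribed list, multiplicities
  included.\<close>

lemma prod_linear_factors_permutes:
  fixes a b :: "'n::finite \<Rightarrow> complex"
  assumes "\<And>z. (\<Prod>j\<in>UNIV. z - a j) = (\<Prod>j\<in>UNIV. z - b j)"
  obtains p where "p permutes UNIV" "\<And>j. a j = b (p j)"
proof -
  have roots: "proots (\<Prod>j\<in>UNIV. [:- c j, 1:]) = image_mset c (mset_set UNIV)" for c :: "'n \<Rightarrow> complex"
  proof -
    have "proots (\<Prod>j\<in>UNIV. [:- c j, 1:]) = (\<Sum>j\<in>UNIV. {#c j#})"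
      by (subst proots_prod) auto
    also have "\<dots> = image_mset c (mset_set UNIV)"
      by (simp add: sum_unfold_sum_mset)
    finally show ?thesis .
  qed
  have "(\<Prod>j\<in>UNIV. [:- a j, 1:]) = (\<Prod>j\<in>UNIV. [:- b j, 1:])"
  proof (rule poly_eq_poly_eq_iff[THEN iffD1])
    show "poly (\<Prod>j\<in>UNIV. [:- a j, 1:]) = poly (\<Prod>j\<in>UNIV. [:- b j, 1:])"
      using assms by (simp add: fun_eq_iff poly_prod)
  qed
  then have "image_mset a (mset_set UNIV) = image_mset b (mset_set UNIV)"
    using roots[of a] roots[of b] by simp
  then obtain p where "p permutes UNIV" "\<forall>j\<in>UNIV. a j = b (p j)"
    using image_mset_eq_implies_permutes[of UNIV a b] by auto
  with that show thesis by blast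
qed

text \<open>Diagonalising the Hermitian matrix i A produces its eigenvalues in some order;
  comparison of characteristic polynomials shows that they are the numbers - s l up to a
  permutation, by which the eigenvectors are relabelled.\<close>

lemma anti_hermitian_diagonal:
  fixes A :: "complex^'n^'n" and s :: "'n \<Rightarrow> real"
  assumes A: "anti_hermitian A" and s: "eigenvalue_list A (\<lambda>j. \<i> * complex_of_real (s j))"
  obtains v :: "'n \<Rightarrow> 'n \<Rightarrow> complex" where
    "\<And>l m. (\<Sum>k\<in>UNIV. cnj (v l k) * v m k) = (if l = m then 1 else 0)"
    "\<And>j k. (\<Sum>l\<in>UNIV. v l j * cnj (v l k)) = (if j = k then 1 else 0)"
    "\<And>j k. - of_real (Im (A $ j $ k)) - \<i> * of_real (Re (A $ j $ k))
       = (\<Sum>l\<in>UNIV. of_real (- s l) * v l j * cnj (v l k))"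
proof -
  define N where "N = (\<chi> j k. \<i> * A $ j $ k)"
  have "N $ k $ j = cnj (N $ j $ k)" for j k
    using A by (simp add: N_def anti_hermitian_def)
  then obtain w :: "'n \<Rightarrow> complex^'n" and \<mu> where
    rows: "\<And>l m. herm (w l) (w m) = (if l = m then 1 else 0)" and
    cols: "\<And>j k. (\<Sum>l\<in>UNIV. w l $ j * cnj (w l $ k)) = (if j = k then 1 else 0)" and
    N: "\<And>j k. N $ j $ k = (\<Sum>l\<in>UNIV. of_real (\<mu> l) * w l $ j * cnj (w l $ k))"
    using hermitian_diagonalise[of N] by blast
  define W where "W = (\<chi> j l. w l $ j)"
  define V where "V = (\<chi> l j. cnj (w l $ j))"
  define D where "D z = (\<chi> j l. if j = l then z + \<i> * of_real (\<mu> l) else 0)" for z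
  have WV: "W ** V = mat 1"
    by (simp add: W_def V_def matrix_matrix_mult_def mat_def vec_eq_iff cols)
  have "mat z - A = W ** D z ** V" for z
  proof -
    have "(mat z - A) $ j $ k = (W ** D z ** V) $ j $ k" for j k
    proof -
      have "A $ j $ k = - \<i> * N $ j $ k" by (simp add: N_def)
      then have "(mat z - A) $ j $ k = z * (\<Sum>l\<in>UNIV. w l $ j * cnj (w l $ k))
          + \<i> * (\<Sum>l\<in>UNIV. of_real (\<mu> l) * w l $ j * cnj (w l $ k))"
        unfolding cols N by (simp add: mat_def)
      also have "\<dots> = (\<Sum>l\<in>UNIV. w l $ j * (z + \<i> * of_real (\<mu> l)) * cnj (w l $ k))"
        by (simp add: sum_distrib_left sum.distrib[symmetric] algebra_simps)
      also have "\<dots> = (W ** D z ** V) $ j $ k"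
        by (simp add: W_def D_def V_def matrix_matrix_mult_def if_distrib[of "\<lambda>c. _ * c"] cong: if_cong)
      finally show ?thesis .
    qed
    then show ?thesis by (simp add: vec_eq_iff)
  qed
  then have "det (mat z - A) = det (D z) * det (W ** V)" for z
    by (simp add: det_mul)
  moreover have "det (D z) = (\<Prod>j\<in>UNIV. z + \<i> * of_real (\<mu> j))" for z
    by (subst det_diagonal) (simp_all add: D_def)
  ultimately have "(\<Prod>j\<in>UNIV. z - (- \<i> * of_real (\<mu> j))) = (\<Prod>j\<in>UNIV. z - \<i> * of_real (s j))" for z
    using s by (simp add: WV eigenvalue_list_def)
  from prod_linear_factors_permutes[OF this]
  obtain p where p: "p permutes UNIV" "\<And>j. - \<i> * of_real (\<mu> j) = \<i> * of_real (s (p j))"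
    by blast
  have \<mu>: "\<mu> j = - s (p j)" for j
    using arg_cong[OF p(2)[of j], of Im] by simp
  have bij: "bij p" "bij (inv p)" using p(1) permutes_inv[OF p(1)] by (simp_all add: permutes_bij)
  have pinv: "p (inv p l) = l" for l using bij by (simp add: bij_is_surj surj_f_inv_f)
  \<comment> \<open>Conjugated because the operator involves the conjugate of i A; reindexed so that
    row \<open>l\<close> belongs to \<open>s l\<close>.\<close>
  define v where "v l k = cnj (w (inv p l) $ k)" for l k
  show thesis
  proof
    show "(\<Sum>k\<in>UNIV. cnj (v l k) * v m k) = (if l = m then 1 else 0)" for l m
    proof -
      have "(\<Sum>k\<in>UNIV. cnj (v l k) * v m k) = herm (w (inv p m)) (w (inv p l))"
        by (simp add: v_def herm_def mult.commute)
      then show ?thesis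
        using bij(2) by (auto simp: rows bij_def inj_eq)
    qed
    show "(\<Sum>l\<in>UNIV. v l j * cnj (v l k)) = (if j = k then 1 else 0)" for j k
    proof -
      have "(\<Sum>l\<in>UNIV. v l j * cnj (v l k)) = (\<Sum>l\<in>UNIV. w (inv p l) $ k * cnj (w (inv p l) $ j))"
        by (simp add: v_def mult.commute)
      also have "\<dots> = (\<Sum>l\<in>UNIV. w l $ k * cnj (w l $ j))"
        by (rule sum.reindex_bij_betw[OF bij(2)])
      finally show ?thesis by (simp add: cols eq_commute)
    qed
    show "- of_real (Im (A $ j $ k)) - \<i> * of_real (Re (A $ j $ k))
       = (\<Sum>l\<in>UNIV. of_real (- s l) * v l j * cnj (v l k))" for j k
    proof -
      have "- complex_of_real (Im (A $ j $ k)) - \<i> * of_real (Re (A $ j $ k)) = cnj (N $ j $ k)"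
        by (simp add: N_def complex_eq_iff)
      also have "\<dots> = (\<Sum>l\<in>UNIV. of_real (- s (p l)) * cnj (w l $ j) * w l $ k)"
        by (simp add: N cnj_sum \<mu>)
      also have "\<dots> = (\<Sum>l\<in>UNIV. of_real (- s (p (inv p l))) * cnj (w (inv p l) $ j) * w (inv p l) $ k)"
        by (rule sum.reindex_bij_betw[OF bij(2), symmetric])
      finally show ?thesis by (simp add: v_def pinv)
    qed
  qed
qed

subsection \<open>Completeness\<close>

text \<open>The positive and negative parts of \<open>h\<close>, divided by their common mass and
  pushed forward along \<open>X\<close>, are probability measures on the line with equal
  characteristic functions, so Levy's uniqueness theorem identifies them.\<close>

lemma real_fourier_unique:
  fixes h :: "'a \<Rightarrow> real" and X :: "'a \<Rightarrow> real"
  assumes h: "integrable M h" and X [measurable]: "X \<in> borel_measurable M"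
    and F: "\<And>t. (CLINT x|M. complex_of_real (h x) * iexp (t * X x)) = 0"
    and A: "A \<in> sets borel"
  shows "(LINT x|M. h x * indicator A (X x)) = 0"
proof -
  define p where "p x = max 0 (h x)" for x
  define n where "n x = max 0 (- h x)" for x
  have h_eq: "h x = p x - n x" for x by (auto simp: p_def n_def)
  have nn: "p x \<ge> 0" "n x \<ge> 0" for x by (auto simp: p_def n_def)
  have pi: "integrable M p" and ni: "integrable M n"
    unfolding p_def[abs_def] n_def[abs_def] using h by auto
  have [measurable]: "p \<in> borel_measurable M" "n \<in> borel_measurable M"
    using pi ni by auto
  have bnd: "integrable M (\<lambda>x. complex_of_real (g x) * iexp (t * X x))" if g: "integrable M g" for g t
  proof (rule Bochner_Integration.integrable_bound[OF integrable_norm[OF g]])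
    show "(\<lambda>x. complex_of_real (g x) * iexp (t * X x)) \<in> borel_measurable M"
      using g by measurable
  qed (simp add: norm_mult)
  have pn: "(CLINT x|M. complex_of_real (p x) * iexp (t * X x)) = (CLINT x|M. complex_of_real (n x) * iexp (t * X x))" for t
  proof -
    have "(CLINT x|M. complex_of_real (h x) * iexp (t * X x))
        = (CLINT x|M. complex_of_real (p x) * iexp (t * X x) - complex_of_real (n x) * iexp (t * X x))"
      by (intro Bochner_Integration.integral_cong refl) (simp add: h_eq left_diff_distrib)
    also have "\<dots> = (CLINT x|M. complex_of_real (p x) * iexp (t * X x)) - (CLINT x|M. complex_of_real (n x) * iexp (t * X x))"
      by (intro Bochner_Integration.integral_diff bnd pi ni)
    finally show ?thesis using F[of t] by simp
  qed
  \<comment> \<open>The masses of \<open>p\<close> and \<open>n\<close> agree by the hypothesis at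
    frequency 0. Mass 0 forces both parts to vanish almost everywhere and is treated apart, since it
    cannot be normalised.\<close>
  define c where "c = (LINT x|M. p x)"
  have c: "c = (LINT x|M. n x)"
    using pn[of 0] by (simp add: c_def)
  have c0: "c \<ge> 0" unfolding c_def using nn by (intro integral_nonneg_AE) auto
  have Am [measurable]: "{x \<in> space M. X x \<in> A} \<in> sets M"
    using A X by (simp add: measurable_sets_Collect[of X M borel])
  have ind [measurable]: "(\<lambda>x. indicator A (X x) :: real) \<in> borel_measurable M"
    using A by measurable
  have int_ind: "integrable M (\<lambda>x. g x * indicator A (X x))" if g: "integrable M g" for g :: "'a \<Rightarrow> real"
  proof (rule Bochner_Integration.integrable_bound[OF g])
    show "(\<lambda>x. g x * indicator A (X x)) \<in> borel_measurable M" using g by measurable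
  qed (auto simp: indicator_def)
  have "(LINT x|M. p x * indicator A (X x)) = (LINT x|M. n x * indicator A (X x))"
  proof (cases "c = 0")
    case True
    have "AE x in M. p x = 0" "AE x in M. n x = 0"
      using True c nn integral_nonneg_eq_0_iff_AE[OF pi] integral_nonneg_eq_0_iff_AE[OF ni]
      by (auto simp: c_def)
    then have "AE x in M. p x * indicator A (X x) = n x * indicator A (X x)"
      by eventually_elim simp
    then show ?thesis by (intro integral_cong_AE) auto
  next
    case False
    then have cpos: "c > 0" using c0 by simp
    define \<nu> where "\<nu> g = distr (density M (\<lambda>x. ennreal (g x / c))) borel X" for g
    have rd: "real_distribution (\<nu> g)"
      and ch: "char (\<nu> g) t = (CLINT x|M. complex_of_real (g x) * iexp (t * X x)) / c"
      and ms: "measure (\<nu> g) A = (LINT x|M. g x * indicator A (X x)) / c"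
      if g: "integrable M g" "\<And>x. g x \<ge> 0" "(LINT x|M. g x) = c" for g t
    proof -
      have gm [measurable]: "g \<in> borel_measurable M" using g by auto
      have "emeasure (density M (\<lambda>x. ennreal (g x / c))) (space M) = (\<integral>\<^sup>+x. ennreal (g x / c) \<partial>M)"
        by (subst emeasure_density) (auto intro!: nn_integral_cong)
      also have "\<dots> = ennreal (LINT x|M. g x / c)"
        using g cpos by (intro nn_integral_eq_integral) auto
      also have "\<dots> = 1" using g(3) cpos by simp
      finally have "prob_space (density M (\<lambda>x. ennreal (g x / c)))"
        by (intro prob_spaceI) simp
      then show "real_distribution (\<nu> g)"
        unfolding \<nu>_def by (intro prob_space.real_distribution_distr) simp_all
      have "char (\<nu> g) t = (CLINT x|density M (\<lambda>x. ennreal (g x / c)). iexp (t * X x))"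
        unfolding char_def \<nu>_def by (subst integral_distr) auto
      also have "\<dots> = (CLINT x|M. (g x / c) *\<^sub>R iexp (t * X x))"
        using g cpos by (subst integral_density) auto
      also have "\<dots> = (CLINT x|M. complex_of_real (g x) * iexp (t * X x) / c)"
        by (simp add: scaleR_conv_of_real)
      finally show "char (\<nu> g) t = (CLINT x|M. complex_of_real (g x) * iexp (t * X x)) / c"
        by simp
      interpret real_distribution "\<nu> g" by fact
      have "measure (\<nu> g) A = (LINT y|\<nu> g. indicator A y)"
        using A by (simp add: Int_absorb1 sets.sets_into_space)
      also have "\<dots> = (LINT x|density M (\<lambda>x. ennreal (g x / c)). indicator A (X x))"
        unfolding \<nu>_def using A by (subst integral_distr) auto
      also have "\<dots> = (LINT x|M. (g x / c) *\<^sub>R indicator A (X x))"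
        using g cpos by (subst integral_density) auto
      finally show "measure (\<nu> g) A = (LINT x|M. g x * indicator A (X x)) / c"
        by simp
    qed
    have "\<nu> p = \<nu> n"
    proof (rule Levy_uniqueness)
      show "real_distribution (\<nu> p)" "real_distribution (\<nu> n)"
        using pi ni nn c by (auto intro!: rd simp: c_def)
      show "char (\<nu> p) = char (\<nu> n)"
        using ch[OF pi nn(1)] ch[OF ni nn(2)] pn c by (auto simp: c_def)
    qed
    then show ?thesis
      using ms[OF pi nn(1)] ms[OF ni nn(2)] c cpos by (simp add: c_def)
  qed
  moreover have "(LINT x|M. h x * indicator A (X x)) = (LINT x|M. p x * indicator A (X x)) - (LINT x|M. n x * indicator A (X x))"
    unfolding h_eq left_diff_distrib by (intro Bochner_Integration.integral_diff int_ind pi ni)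
  ultimately show ?thesis by simp
qed

text \<open>Conjugation replaces t by - t, so the hypothesis passes to \<open>cnj g\<close> and
  hence to the real and imaginary parts.\<close>

lemma complex_fourier_unique:
  fixes g :: "'a \<Rightarrow> complex" and X :: "'a \<Rightarrow> real"
  assumes g: "integrable M g" and X [measurable]: "X \<in> borel_measurable M"
    and F: "\<And>t. (CLINT x|M. g x * iexp (t * X x)) = 0"
    and A: "A \<in> sets borel"
  shows "(CLINT x|M. g x * indicator A (X x)) = 0"
proof -
  have bnd: "integrable M (\<lambda>x. f x * iexp (t * X x))" if f: "integrable M f" for f :: "'a \<Rightarrow> complex" and t
  proof (rule Bochner_Integration.integrable_bound[OF integrable_norm[OF f]])
    show "(\<lambda>x. f x * iexp (t * X x)) \<in> borel_measurable M"
      using f by measurable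
  qed (simp add: norm_mult)
  have Fc: "(CLINT x|M. cnj (g x) * iexp (t * X x)) = 0" for t
  proof -
    have "(CLINT x|M. cnj (g x) * iexp (t * X x)) = (CLINT x|M. cnj (g x * iexp (- t * X x)))"
      by (simp add: exp_cnj)
    also have "\<dots> = cnj (CLINT x|M. g x * iexp (- t * X x))"
      by (rule Bochner_Integration.integral_cnj)
    finally show ?thesis using F[of "- t"] by simp
  qed
  have ci: "integrable M (\<lambda>x. cnj (g x))" using g by simp
  have re: "(LINT x|M. Re (g x) * indicator A (X x)) = 0"
  proof (rule real_fourier_unique[OF _ X _ A])
    fix t
    have "(CLINT x|M. complex_of_real (Re (g x)) * iexp (t * X x))
        = (CLINT x|M. 1/2 * (g x * iexp (t * X x) + cnj (g x) * iexp (t * X x)))"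
      by (intro Bochner_Integration.integral_cong refl)
         (simp add: distrib_right[symmetric] complex_add_cnj)
    also have "\<dots> = 0"
      using bnd[OF g, of t] bnd[OF ci, of t] F[of t] Fc[of t] by (simp del: of_real_mult)
    finally show "(CLINT x|M. complex_of_real (Re (g x)) * iexp (t * X x)) = 0" .
  qed (use g in simp)
  have im: "(LINT x|M. Im (g x) * indicator A (X x)) = 0"
  proof (rule real_fourier_unique[OF _ X _ A])
    fix t
    have "(CLINT x|M. complex_of_real (Im (g x)) * iexp (t * X x))
        = (CLINT x|M. (- \<i>/2) * (g x * iexp (t * X x) - cnj (g x) * iexp (t * X x)))"
    proof (intro Bochner_Integration.integral_cong refl)
      have "complex_of_real (Im z) * e = (- \<i>/2) * (z * e - cnj z * e)" for z e
        by (simp add: complex_eq_iff field_simps)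
      then show "complex_of_real (Im (g x)) * iexp (t * X x)
          = (- \<i>/2) * (g x * iexp (t * X x) - cnj (g x) * iexp (t * X x))" for x
        by (simp only:)
    qed
    also have "\<dots> = 0"
      using bnd[OF g, of t] bnd[OF ci, of t] F[of t] Fc[of t] by (simp del: of_real_mult)
    finally show "(CLINT x|M. complex_of_real (Im (g x)) * iexp (t * X x)) = 0" .
  qed (use g in simp)
  have "integrable M (\<lambda>x. g x * indicator A (X x))"
  proof (rule Bochner_Integration.integrable_bound[OF g])
    show "(\<lambda>x. g x * indicator A (X x)) \<in> borel_measurable M" using g A by measurable
  qed (auto simp: indicator_def)
  then have "Re (CLINT x|M. g x * indicator A (X x)) = (LINT x|M. Re (g x * indicator A (X x)))"
    "Im (CLINT x|M. g x * indicator A (X x)) = (LINT x|M. Im (g x * indicator A (X x)))"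
    by (rule integral_Re[symmetric], rule integral_Im[symmetric])
  moreover have "Re (g x * indicator A (X x)) = Re (g x) * indicator A (X x)"
    "Im (g x * indicator A (X x)) = Im (g x) * indicator A (X x)" for x
    by (simp_all add: indicator_def)
  ultimately show ?thesis by (simp add: complex_eq_iff re im)
qed

text \<open>Frequencies are exchanged for indicators one coordinate at a time: coordinates in
  \<open>S\<close> carry an indicator, the others an exponential. The one-dimensional result applies
  in coordinate \<open>k\<close> because its frequency \<open>t\<close> can be placed in the k-th
  slot of \<xi>.\<close>

lemma fourier_unique_boxes:
  fixes g :: "real^'d \<Rightarrow> complex"
  assumes g: "integrable lborel g"
    and F: "\<And>\<xi>. (CLINT x|lborel. g x * iexp (\<xi> \<bullet> x)) = 0"
    and A: "\<And>i. A i \<in> sets borel"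
  shows "(CLINT x|lborel. g x * (\<Prod>i\<in>UNIV. indicator (A i) (x $ i))) = 0"
proof -
  have [measurable]: "A i \<in> sets borel" for i by (rule A)
  have "(CLINT x|lborel. g x * (\<Prod>i\<in>S. indicator (A i) (x $ i)) * iexp (\<Sum>j\<in>-S. \<xi> $ j * x $ j)) = 0"
    for S and \<xi> :: "real^'d"
    using finite[of S]
  proof (induction S arbitrary: \<xi> rule: finite_induct)
    case empty
    then show ?case using F[of \<xi>] by (simp add: inner_vec_def)
  next
    case (insert k S)
    let ?f = "\<lambda>x::real^'d. g x * (\<Prod>i\<in>S. indicator (A i) (x $ i)) * iexp (\<Sum>j\<in>-insert k S. \<xi> $ j * x $ j)"
    have "(CLINT x|lborel. ?f x * indicator (A k) (x $ k)) = 0"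
    proof (rule complex_fourier_unique)
      have gm: "g \<in> borel_measurable borel" using g by auto
      show "integrable lborel ?f"
      proof (rule Bochner_Integration.integrable_bound[OF g])
        show "?f \<in> borel_measurable lborel" using gm by measurable
        have "norm (\<Prod>i\<in>S. indicator (A i) (x $ i) :: complex) \<le> 1" for x :: "real^'d"
          unfolding prod_norm[symmetric] by (intro prod_le_1) (auto simp: indicator_def)
        then show "AE x in lborel. norm (?f x) \<le> norm (g x)"
          by (intro AE_I2) (simp add: norm_mult mult_left_le)
      qed
      fix t
      have "?f x * iexp (t * x $ k) = g x * (\<Prod>i\<in>S. indicator (A i) (x $ i)) *
          iexp (\<Sum>j\<in>-S. (\<chi> j. if j = k then t else \<xi> $ j) $ j * x $ j)" for x
      proof -
        have "- S = insert k (- insert k S)" using insert.hyps by auto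
        then have "(\<Sum>j\<in>-S. (\<chi> j. if j = k then t else \<xi> $ j) $ j * x $ j)
          = (\<Sum>j\<in>insert k (- insert k S). (\<chi> j. if j = k then t else \<xi> $ j) $ j * x $ j)" by (rule arg_cong)
        also have "\<dots> = t * x $ k + (\<Sum>j\<in>- insert k S. (\<chi> j. if j = k then t else \<xi> $ j) $ j * x $ j)"
          by (subst sum.insert) auto
        also have "(\<Sum>j\<in>- insert k S. (\<chi> j. if j = k then t else \<xi> $ j) $ j * x $ j)
            = (\<Sum>j\<in>-insert k S. \<xi> $ j * x $ j)"
          by (intro sum.cong) auto
        finally show ?thesis by (simp add: exp_add distrib_left mult_ac)
      qed
      then have "(CLINT x|lborel. ?f x * iexp (t * x $ k)) = (CLINT x|lborel. g x *
          (\<Prod>i\<in>S. indicator (A i) (x $ i)) * iexp (\<Sum>j\<in>-S. (\<chi> j. if j = k then t else \<xi> $ j) $ j * x $ j))"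
        by (simp only:)
      also have "\<dots> = 0" by (rule insert.IH)
      finally show "(CLINT x|lborel. ?f x * iexp (t * x $ k)) = 0" .
    qed simp_all
    then show ?case
      using insert.hyps by (simp add: mult_ac)
  qed
  from this[of UNIV 0] show ?thesis by simp
qed

text \<open>Boxes form an intersection-stable generator, so the vanishing of the integrals extends
  to all Borel sets by Dynkin induction; an integrable function with this property is zero almost
  everywhere.\<close>

lemma fourier_unique:
  fixes g :: "real^'d \<Rightarrow> complex"
  assumes g: "integrable lborel g"
    and F: "\<And>\<xi>. (CLINT x|lborel. g x * iexp (\<xi> \<bullet> x)) = 0"
  shows "AE x in lborel. g x = 0"
proof -
  let ?E = "range (\<lambda>(a, b). box a b :: (real^'d) set)"
  have tot: "(CLINT x|lborel. g x) = 0"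
    using F[of 0] by simp
  have si: "set_integrable lborel A g" if "A \<in> sets borel" for A
    using integrable_mult_indicator[OF _ g, of A] that by (simp add: set_integrable_def)
  have zero: "(CLINT x:A|lborel. g x) = 0" if "A \<in> sigma_sets UNIV ?E" for A
  proof (rule sigma_sets_induct_disjoint[of ?E UNIV A "\<lambda>A. (CLINT x:A|lborel. g x) = 0"])
    show "Int_stable ?E" by (auto simp: Int_stable_def box_Int_box)
    show "A \<in> sigma_sets UNIV ?E" by fact
  next
    fix X assume "X \<in> ?E"
    then obtain a b where X: "X = box a b" by auto
    have "(CLINT x:X|lborel. g x) = (CLINT x|lborel. g x * (\<Prod>i\<in>UNIV. indicator {a$i<..<b$i} (x $ i)))"
      unfolding set_lebesgue_integral_def
    proof (intro Bochner_Integration.integral_cong refl)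
      fix x
      have "(\<Prod>i\<in>UNIV. indicator {a$i<..<b$i} (x $ i)) = (indicator X x :: complex)"
      proof (cases "x \<in> X")
        case True
        then show ?thesis by (simp add: X mem_box_cart)
      next
        case False
        then obtain i where "x $ i \<notin> {a$i<..<b$i}" by (auto simp: X mem_box_cart)
        then have "(\<Prod>i\<in>UNIV. indicator {a$i<..<b$i} (x $ i)) = (0::complex)"
          by (intro prod_zero finite bexI[of _ i]) simp_all
        with False show ?thesis by simp
      qed
      then show "indicat_real X x *\<^sub>R g x = g x * (\<Prod>i\<in>UNIV. indicator {a$i<..<b$i} (x $ i))"
        by (simp add: indicator_def)
    qed
    also have "\<dots> = 0" by (rule fourier_unique_boxes[OF g F]) auto
    finally show "(CLINT x:X|lborel. g x) = 0" .
  next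
    fix X assume X: "X \<in> sigma_sets UNIV ?E" and IH: "(CLINT x:X|lborel. g x) = 0"
    have Xb: "X \<in> sets borel" using X by (simp add: borel_eq_box)
    have "(CLINT x:UNIV|lborel. g x) = (CLINT x:X \<union> (UNIV - X)|lborel. g x)" by simp
    also have "\<dots> = (CLINT x:X|lborel. g x) + (CLINT x:UNIV - X|lborel. g x)"
      using Xb by (intro set_integral_Un si) auto
    finally show "(CLINT x:UNIV - X|lborel. g x) = 0"
      using IH tot by (simp add: set_lebesgue_integral_def)
  next
    fix X :: "nat \<Rightarrow> (real^'d) set"
    assume d: "disjoint_family X" and X: "range X \<subseteq> sigma_sets UNIV ?E"
      and IH: "\<And>i. (CLINT x:X i|lborel. g x) = 0"
    have Xb: "X i \<in> sets borel" for i using X by (auto simp: borel_eq_box)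
    have "(CLINT x:(\<Union>i. X i)|lborel. g x) = (\<Sum>i. (CLINT x:X i|lborel. g x))"
      using Xb d by (intro lebesgue_integral_countable_add si) (auto simp: disjoint_family_on_def)
    then show "(CLINT x:(\<Union>i. X i)|lborel. g x) = 0" by (simp add: IH)
  qed (auto simp: set_lebesgue_integral_def)
  then have zero': "(CLINT x:A|lborel. g x) = 0" if "A \<in> sets borel" for A
    using that by (simp add: borel_eq_box)
  have "AE x in lborel. Re (g x) = 0"
  proof (rule density_unique_real)
    fix A :: "(real^'d) set" assume A: "A \<in> sets lborel"
    have "(LINT x:A|lborel. Re (g x)) = Re (CLINT x:A|lborel. g x)"
      using si[of A] A by (simp add: set_lebesgue_integral_def set_integrable_def flip: integral_Re)
    then show "(LINT x:A|lborel. Re (g x)) = (LINT x:A|lborel. 0)"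
      using zero'[of A] A by (simp add: set_lebesgue_integral_def)
  qed (use g in simp_all)
  moreover have "AE x in lborel. Im (g x) = 0"
  proof (rule density_unique_real)
    fix A :: "(real^'d) set" assume A: "A \<in> sets lborel"
    have "(LINT x:A|lborel. Im (g x)) = Im (CLINT x:A|lborel. g x)"
      using si[of A] A by (simp add: set_lebesgue_integral_def set_integrable_def flip: integral_Im)
    then show "(LINT x:A|lborel. Im (g x)) = (LINT x:A|lborel. 0)"
      using zero'[of A] A by (simp add: set_lebesgue_integral_def)
  qed (use g in simp_all)
  ultimately show ?thesis by eventually_elim (simp add: complex_eq_iff)
qed

lemma poly_gauss_inner_power: "(\<lambda>x. of_real (\<xi> \<bullet> x) ^ n * gaussian x) \<in> poly_gauss"
proof (induction n)
  case (Suc n)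
  have "(\<lambda>x. \<Sum>j\<in>UNIV. of_real (\<xi> $ j) * (of_real (x $ j) * (of_real (\<xi> \<bullet> x) ^ n * gaussian x))) \<in> poly_gauss"
    by (intro poly_gauss_sum poly_gauss_cmult poly_gauss_coordinate Suc)
  moreover have "(\<Sum>j\<in>UNIV. of_real (\<xi> $ j) * (of_real (x $ j) * c)) = of_real (\<xi> \<bullet> x) * c" for x and c :: complex
    by (simp add: inner_vec_def sum_distrib_right mult.assoc)
  ultimately show ?case by (simp add: mult.assoc)
qed (simp add: poly_gauss_gaussian)

text \<open>|\<xi> \<plusminus> x/2|^2 \<ge> 0 bounds the inner product by |\<xi>|^2 + |x|^2 / 4, so
  half of the Gaussian exponent survives.\<close>

lemma exp_inner_gaussian_bound:
  fixes x \<xi> :: "'a::real_inner"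
  shows "exp \<bar>\<xi> \<bullet> x\<bar> * exp (- (x \<bullet> x) / 2) \<le> exp (\<xi> \<bullet> \<xi>) * exp (- (1/4) * (x \<bullet> x))"
proof -
  have "0 \<le> (\<xi> - (1/2) *\<^sub>R x) \<bullet> (\<xi> - (1/2) *\<^sub>R x)" "0 \<le> (\<xi> + (1/2) *\<^sub>R x) \<bullet> (\<xi> + (1/2) *\<^sub>R x)" by simp_all
  then have "\<bar>\<xi> \<bullet> x\<bar> \<le> \<xi> \<bullet> \<xi> + (1/4) * (x \<bullet> x)"
    by (simp add: inner_add_left inner_add_right inner_diff_left inner_diff_right inner_commute abs_le_iff)
  then show ?thesis unfolding exp_add[symmetric] by simp
qed

text \<open>The Fourier transform of \<open>gaussian * h\<close> vanishes: the Taylor partial sums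
  of the exponential are polynomials, which integrate to 0 by hypothesis, and the Gaussian dominates
  them together with exp |\<xi> \<bullet> x|. As the Gaussian has no zeros, h vanishes.\<close>

theorem poly_gauss_total:
  fixes h :: "real^'d \<Rightarrow> complex"
  assumes h: "square_integrable h" and orth: "\<And>f. f \<in> poly_gauss \<Longrightarrow> pairing f h = 0"
  shows "AE x in lborel. h x = 0"
proof -
  have hm [measurable]: "h \<in> borel_measurable borel" using h by (simp add: square_integrable_def)
  have gm [measurable]: "(gaussian :: real^'d \<Rightarrow> complex) \<in> borel_measurable borel"
  proof -
    have "square_integrable (gaussian :: real^'d \<Rightarrow> complex)"
      by (rule square_integrable_poly_gauss[OF poly_gauss_gaussian])
    then show ?thesis by (simp add: square_integrable_def)
  qed
  have cnjg: "cnj (gaussian x) = gaussian x" for x :: "real^'d" by (simp add: gaussian_def)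
  define g where "g x = gaussian x * h x" for x
  have dom: "integrable lborel (\<lambda>x. exp \<bar>\<xi> \<bullet> x\<bar> * cmod (g x))" for \<xi>
  proof -
    have "square_integrable (\<lambda>x. of_real (exp \<bar>\<xi> \<bullet> x\<bar>) * gaussian x)"
    proof -
      obtain K where K: "K > 0" "\<And>x::real^'d. exp (- (1/4) * (x \<bullet> x)) \<le> K * weight x"
        using exp_le_weight[of "1/4"] by auto
      show ?thesis
      proof (rule square_integrable_weight_bound)
        fix x :: "real^'d"
        have "cmod (of_real (exp \<bar>\<xi> \<bullet> x\<bar>) * gaussian x) \<le> exp (\<xi> \<bullet> \<xi>) * exp (- (1/4) * (x \<bullet> x))"
          using exp_inner_gaussian_bound[of \<xi> x] by (simp add: norm_mult gaussian_def)
        also have "\<dots> \<le> exp (\<xi> \<bullet> \<xi>) * (K * weight x)" by (intro mult_left_mono K) simp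
        finally show "cmod (of_real (exp \<bar>\<xi> \<bullet> x\<bar>) * gaussian x) \<le> (exp (\<xi> \<bullet> \<xi>) * K) * weight x"
          by (simp add: mult.assoc)
      qed simp
    qed
    from integrable_norm[OF square_integrable_cnj_mult[OF this h]]
    show ?thesis by (simp add: norm_mult g_def mult.assoc)
  qed
  have gi: "integrable lborel g"
  proof (rule Bochner_Integration.integrable_bound[OF dom[of 0]])
    show "g \<in> borel_measurable lborel" unfolding g_def by measurable
  qed simp
  have "(CLINT x|lborel. g x * iexp (\<xi> \<bullet> x)) = 0" for \<xi>
  proof -
    define s where "s N x = g x * (\<Sum>n<N. (\<i> * of_real (\<xi> \<bullet> x)) ^ n /\<^sub>R fact n)" for N x
    have s0: "(CLINT x|lborel. s N x) = 0" for N
    proof -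
      \<comment> \<open>The coefficients are conjugated in advance, since \<open>pairing\<close>
        conjugates its first argument.\<close>
      let ?f = "\<lambda>x. \<Sum>n<N. (cnj (\<i> ^ n /\<^sub>R fact n)) * (of_real (\<xi> \<bullet> x) ^ n * gaussian x)"
      have "?f \<in> poly_gauss"
        by (intro poly_gauss_sum poly_gauss_cmult poly_gauss_inner_power)
      then have "pairing ?f h = 0" by (rule orth)
      moreover have "cnj (?f x) * h x = s N x" for x
        by (simp add: s_def g_def cnj_sum sum_distrib_left sum_distrib_right cnjg power_mult_distrib
            scaleR_conv_of_real mult_ac)
      ultimately show ?thesis by (simp add: pairing_def)
    qed
    have "(\<lambda>N. CLINT x|lborel. s N x) \<longlonglongrightarrow> (CLINT x|lborel. g x * iexp (\<xi> \<bullet> x))"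
    proof (rule integral_dominated_convergence[OF _ _ dom[of \<xi>]])
      show "(\<lambda>x. g x * iexp (\<xi> \<bullet> x)) \<in> borel_measurable lborel" "s N \<in> borel_measurable lborel" for N
        unfolding s_def g_def by measurable
      have "(\<lambda>N. s N x) \<longlonglongrightarrow> g x * iexp (\<xi> \<bullet> x)" for x
        unfolding s_def
        by (intro tendsto_mult tendsto_const exp_converges[unfolded sums_def])
      then show "AE x in lborel. (\<lambda>N. s N x) \<longlonglongrightarrow> g x * iexp (\<xi> \<bullet> x)" by simp
      fix N
      have "norm (s N x) \<le> exp \<bar>\<xi> \<bullet> x\<bar> * cmod (g x)" for x
      proof -
        have "cmod (\<Sum>n<N. (\<i> * of_real (\<xi> \<bullet> x)) ^ n /\<^sub>R fact n) \<le> (\<Sum>n<N. \<bar>\<xi> \<bullet> x\<bar> ^ n /\<^sub>R fact n)"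
          by (rule order_trans[OF norm_sum]) (simp add: norm_power norm_mult divide_inverse mult.commute)
        also have "\<dots> \<le> exp \<bar>\<xi> \<bullet> x\<bar>"
          unfolding exp_def
          by (rule sum_le_suminf[OF summable_exp_generic]) auto
        finally show ?thesis
          unfolding s_def norm_mult by (subst mult.commute) (rule mult_right_mono, simp_all)
      qed
      then show "AE x in lborel. norm (s N x) \<le> exp \<bar>\<xi> \<bullet> x\<bar> * cmod (g x)" by simp
    qed
    then show ?thesis by (simp add: s0 LIMSEQ_const_iff)
  qed
  from fourier_unique[OF gi this] have "AE x in lborel. g x = 0" .
  then show ?thesis
    by eventually_elim (simp add: g_def gaussian_def)
qed

section \<open>The eigenbasis and the counting function of the operator\<close>

lemma sum_mset_eq_sum_count:
  fixes f :: "'a::finite \<Rightarrow> 'b::semiring_1"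
  shows "(\<Sum>j\<in>#M. f j) = (\<Sum>j\<in>UNIV. of_nat (count M j) * f j)"
proof (induction M)
  case (add a M)
  have "(\<Sum>j\<in>UNIV. of_nat (count (add_mset a M) j) * f j)
      = (\<Sum>j\<in>UNIV. of_nat (count M j) * f j + (if j = a then f j else 0))"
    by (intro sum.cong refl) (auto simp: algebra_simps)
  then show ?case by (simp add: add sum.distrib add.commute)
qed simp

context unitary_family
begin

text \<open>Each occurrence of \<open>l\<close> in the list contributes 2 through
  \<open>raise_lower_excited\<close>, and the half in \<open>H_op_eq\<close> turns this into \<mu>
  l.\<close>

lemma H_op_excited:
  fixes A :: "complex^'d^'d"
  assumes A: "anti_hermitian A"
    and diag: "\<And>j k. - of_real (Im (A $ j $ k)) - \<i> * of_real (Re (A $ j $ k))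
       = (\<Sum>l\<in>UNIV. of_real (\<mu> l) * v l j * cnj (v l k))"
  shows "H_op A (excited js) x
    = of_real (Re (\<i> / 2 * trace A) + (\<Sum>l\<in>#mset js. \<mu> l)) * excited js x"
proof -
  have "(\<Sum>l\<in>UNIV. of_real (\<mu> l) / 2 * (2 * of_nat (count (mset js) l) * excited js x))
      = of_real (\<Sum>l\<in>UNIV. of_nat (count (mset js) l) * \<mu> l) * excited js x"
    unfolding of_real_sum sum_distrib_right by (intro sum.cong refl) simp
  then show ?thesis
    unfolding H_op_eq[OF A diag poly_gauss_excited] raise_lower_excited sum_mset_eq_sum_count
    by (simp only: of_real_add distrib_right add.commute)
qed

lemma H_op_add:
  fixes A :: "complex^'d^'d"
  assumes A: "anti_hermitian A"
    and diag: "\<And>j k. - of_real (Im (A $ j $ k)) - \<i> * of_real (Re (A $ j $ k))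
       = (\<Sum>l\<in>UNIV. of_real (\<mu> l) * v l j * cnj (v l k))"
    and f: "f \<in> poly_gauss" and g: "g \<in> poly_gauss"
  shows "H_op A (\<lambda>x. f x + g x) x = H_op A f x + H_op A g x"
  unfolding H_op_eq[OF A diag f] H_op_eq[OF A diag g] H_op_eq[OF A diag poly_gauss_add[OF f g]]
    lower_add[OF f g] raise_add[OF poly_gauss_lower[OF f] poly_gauss_lower[OF g]]
  by (simp only: distrib_left sum.distrib add_ac)

lemma H_op_cmult:
  fixes A :: "complex^'d^'d"
  assumes A: "anti_hermitian A"
    and diag: "\<And>j k. - of_real (Im (A $ j $ k)) - \<i> * of_real (Re (A $ j $ k))
       = (\<Sum>l\<in>UNIV. of_real (\<mu> l) * v l j * cnj (v l k))"
    and f: "f \<in> poly_gauss"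
  shows "H_op A (\<lambda>x. c * f x) x = c * H_op A f x"
  unfolding H_op_eq[OF A diag f] H_op_eq[OF A diag poly_gauss_cmult[OF f]]
    lower_cmult[OF f] raise_cmult[OF poly_gauss_lower[OF f]]
  by (simp only: distrib_left sum_distrib_left mult.left_commute)

lemma excited_total:
  assumes h: "square_integrable h" and orth: "\<And>js. pairing (excited js) h = 0"
  shows "AE x in lborel. h x = 0"
proof (rule poly_gauss_total[OF h])
  fix f :: "real^'d \<Rightarrow> complex" assume "f \<in> poly_gauss"
  then have "f \<in> fock_span" by (rule poly_gauss_fock_span)
  then show "pairing f h = 0"
  proof (induction rule: fock_span.induct)
    case (fock_span_add f g)
    have "has_bochner_integral lborel (\<lambda>x. cnj (f x) * h x + cnj (g x) * h x) (pairing f h + pairing g h)"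
      using fock_span_add.hyps by (intro has_bochner_integral_add has_pairing h fock_span_poly_gauss)
    then show ?case
      using fock_span_add.IH
      by (simp add: has_bochner_integral_iff pairing_def[of "\<lambda>x. f x + g x"] distrib_right)
  qed (simp_all add: orth pairing_cmult_left)
qed

end

text \<open>The least weight \<open>m\<close> is positive and bounds the size of such a multiset by
  r / m, so all of them come from lists of bounded length.\<close>

lemma finite_multisets_sum_le:
  fixes a :: "'d::finite \<Rightarrow> real"
  assumes "\<And>j. a j > 0"
  shows "finite {M :: 'd multiset. (\<Sum>j\<in>#M. a j) \<le> r}"
proof -
  define m where "m = Min (range a)"
  have m: "m > 0" unfolding m_def using assms by (subst Min_gr_iff) auto
  have ma: "m \<le> a j" for j unfolding m_def by (intro Min_le) auto
  have "real (size M) * m \<le> (\<Sum>j\<in>#M. a j)" for M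
    by (induction M) (auto simp: distrib_right intro: add_mono ma)
  then have "{M :: 'd multiset. (\<Sum>j\<in>#M. a j) \<le> r} \<subseteq> mset ` {xs. set xs \<subseteq> UNIV \<and> length xs \<le> nat \<lfloor>r / m\<rfloor>}"
  proof safe
    fix M :: "'d multiset" assume *: "\<And>M::'d multiset. real (size M) * m \<le> (\<Sum>j\<in>#M. a j)" "(\<Sum>j\<in>#M. a j) \<le> r"
    then have "real (size M) \<le> r / m"
      using order_trans[OF *(1)[of M] *(2)] m by (simp add: pos_le_divide_eq)
    then have "size M \<le> nat \<lfloor>r / m\<rfloor>" by linarith
    moreover obtain xs where "mset xs = M" using ex_mset by blast
    ultimately show "M \<in> mset ` {xs. set xs \<subseteq> UNIV \<and> length xs \<le> nat \<lfloor>r / m\<rfloor>}"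
      by (intro image_eqI[of _ _ xs]) auto
  qed
  then show ?thesis
    by (rule finite_subset) (intro finite_imageI finite_lists_length_le finite)
qed

text \<open>\<open>diagonal_operator_l2\<close> is instantiated with multisets as indices and the
  normalised excited states as eigenvectors; negativity of the \<open>s j\<close> makes every
  sublevel set finite.\<close>

theorem counting_function_H_graph:
  fixes A :: "complex^'d^'d" and s :: "'d \<Rightarrow> real"
  assumes A: "anti_hermitian A" and ev: "eigenvalue_list A (\<lambda>j. \<i> * complex_of_real (s j))"
    and s: "\<And>j. s j < 0"
  shows "counting_function (H_graph A) r
    = enat (card {M :: 'd multiset. Re (\<i> / 2 * trace A) + (\<Sum>j\<in>#M. - s j) \<le> r})"
proof -
  obtain v :: "'d \<Rightarrow> 'd \<Rightarrow> complex" where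
    rows: "\<And>l m. (\<Sum>k\<in>UNIV. cnj (v l k) * v m k) = (if l = m then 1 else 0)" and
    cols: "\<And>j k. (\<Sum>l\<in>UNIV. v l j * cnj (v l k)) = (if j = k then 1 else 0)" and
    diag: "\<And>j k. - of_real (Im (A $ j $ k)) - \<i> * of_real (Re (A $ j $ k))
       = (\<Sum>l\<in>UNIV. of_real (- s l) * v l j * cnj (v l k))"
    using anti_hermitian_diagonal[OF A ev] by blast
  interpret unitary_family v
    by standard (fact rows, fact cols)
  let ?G = "H_graph A"
  define e where "e = Re (\<i> / 2 * trace A)"
  define \<mu> where "\<mu> M = e + (\<Sum>j\<in>#M. - s j)" for M
  define enum where "enum M = (SOME js :: 'd list. mset js = M)" for M
  have enum: "mset (enum M) = M" for M
    unfolding enum_def using someI_ex[OF ex_mset] by blast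
  have "\<forall>M. \<exists>c>0. pairing (excited (enum M)) (excited (enum M)) = complex_of_real c"
    using pairing_excited_self by blast
  then obtain c where c: "\<And>M. c M > 0"
    and cM: "\<And>M. pairing (excited (enum M)) (excited (enum M)) = complex_of_real (c M)" by metis
  define nf where "nf M = (\<lambda>x. complex_of_real (1 / sqrt (c M)) * excited (enum M) x)" for M
  have nf: "nf M \<in> poly_gauss" for M
    unfolding nf_def by (intro poly_gauss_cmult poly_gauss_excited)
  have sq: "square_integrable (nf M)" for M
    by (rule square_integrable_poly_gauss[OF nf])
  have H_nf: "H_op A (nf M) = (\<lambda>x. of_real (\<mu> M) * nf M x)" for M
  proof
    fix x
    have "H_op A (nf M) x = complex_of_real (1 / sqrt (c M)) * H_op A (excited (enum M)) x"
      unfolding nf_def by (rule H_op_cmult[OF A diag poly_gauss_excited])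
    also have "H_op A (excited (enum M)) x = of_real (\<mu> M) * excited (enum M) x"
      unfolding H_op_excited[OF A diag] enum by (simp only: \<mu>_def e_def)
    finally show "H_op A (nf M) x = of_real (\<mu> M) * nf M x"
      by (simp only: nf_def mult.left_commute)
  qed
  define \<phi> where "\<phi> M = to_l2 (nf M)" for M
  interpret orthonormal_l2 \<phi>
  proof
    have p: "cinner_l2 (\<phi> M) (\<phi> N) = of_real (1 / sqrt (c M)) * (of_real (1 / sqrt (c N)) *
        pairing (excited (enum M)) (excited (enum N)))" for M N
      unfolding \<phi>_def cinner_to_l2[OF sq sq] pairing_def[symmetric]
      unfolding nf_def pairing_cmult_left pairing_cmult_right complex_cnj_complex_of_real ..
    show "cinner_l2 (\<phi> M) (\<phi> N) = (if M = N then 1 else 0)" for M N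
    proof (cases "M = N")
      case True
      have "cinner_l2 (\<phi> M) (\<phi> M) = complex_of_real (1 / sqrt (c M) * (1 / sqrt (c M) * c M))"
        using p[of M M] by (simp only: cM True of_real_mult)
      also have "1 / sqrt (c M) * (1 / sqrt (c M) * c M) = 1"
        using c[of M] by (simp add: field_simps)
      finally show ?thesis using True by simp
    next
      case False
      then have "pairing (excited (enum M)) (excited (enum N)) = 0"
        by (intro pairing_excited_neq) (simp add: enum)
      then show ?thesis using False by (simp add: p)
    qed
  next
    fix u assume u: "\<And>M. cinner_l2 (\<phi> M) u = 0"
    obtain h where h: "square_integrable h" "u = to_l2 h" using obtain_to_l2 by blast
    have "pairing (excited js) h = 0" for js
    proof -
      have "0 = pairing (nf (mset js)) h"
        using u[of "mset js"] unfolding \<phi>_def h(2) cinner_to_l2[OF sq h(1)] pairing_def ..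
      also have "\<dots> = of_real (1 / sqrt (c (mset js))) * pairing (excited (enum (mset js))) h"
        unfolding nf_def pairing_cmult_left by simp
      also have "excited (enum (mset js)) = excited js"
        by (rule excited_perm) (rule enum)
      finally show ?thesis using c[of "mset js"] by simp
    qed
    then have "AE x in lborel. h x = 0" by (rule excited_total[OF h(1)])
    then show "u = 0" by (simp add: h to_l2_eq_0_iff)
  qed
  \<comment> \<open>\<open>P\<close> records a representative in \<open>poly_gauss\<close>, where
    \<open>H_op A\<close> is known to be linear; a pair in the closed graph need not come with any
    representative.\<close>
  define P where "P u w \<longleftrightarrow> (\<exists>f\<in>poly_gauss. u = to_l2 f \<and> w = to_l2 (H_op A f))" for u w
  have sqH: "square_integrable (H_op A f)" if "f \<in> poly_gauss" for f
    using square_integrable_H_op poly_gauss_schwartz that by blast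
  have P_add: "P (u + u') (w + w')" if "P u w" "P u' w'" for u u' w w'
  proof -
    obtain f g where f: "f \<in> poly_gauss" "u = to_l2 f" "w = to_l2 (H_op A f)"
      and g: "g \<in> poly_gauss" "u' = to_l2 g" "w' = to_l2 (H_op A g)"
      using \<open>P u w\<close> \<open>P u' w'\<close> unfolding P_def by blast
    have "H_op A (\<lambda>x. f x + g x) = (\<lambda>x. H_op A f x + H_op A g x)"
      by (rule ext) (rule H_op_add[OF A diag f(1) g(1)])
    then show ?thesis unfolding P_def
      using f g
      by (intro bexI[of _ "\<lambda>x. f x + g x"])
         (simp_all add: to_l2_add square_integrable_poly_gauss sqH poly_gauss_add)
  qed
  have P_scale: "P (scaleC_l2 a u) (scaleC_l2 a w)" if uw: "P u w" for a u w
  proof -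
    obtain f where f: "f \<in> poly_gauss" "u = to_l2 f" "w = to_l2 (H_op A f)"
      using uw unfolding P_def by blast
    have "H_op A (\<lambda>x. a * f x) = (\<lambda>x. a * H_op A f x)"
      by (rule ext) (rule H_op_cmult[OF A diag f(1)])
    then show ?thesis unfolding P_def
      using f
      by (intro bexI[of _ "\<lambda>x. a * f x"])
         (simp_all add: to_l2_cmult square_integrable_poly_gauss sqH poly_gauss_cmult)
  qed
  have P_eig: "P (\<phi> M) (scaleC_l2 (of_real (\<mu> M)) (\<phi> M))" for M
    unfolding P_def \<phi>_def using nf[of M] H_nf[of M] by (auto simp: to_l2_cmult sq)
  have P_G: "(u, w) \<in> ?G" if uw: "P u w" for u w
  proof -
    obtain f where f: "f \<in> poly_gauss" "u = to_l2 f" "w = to_l2 (H_op A f)"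
      using uw unfolding P_def by blast
    have "(u, w) \<in> (\<lambda>f. (to_l2 f, to_l2 (H_op A f))) ` schwartz"
      unfolding f(2,3) by (rule imageI) (rule poly_gauss_schwartz[OF f(1)])
    then show ?thesis
      unfolding H_graph_def by (rule subsetD[OF closure_subset])
  qed
  interpret diagonal_operator_l2 \<phi> ?G \<mu>
  proof
    show "closed ?G" by (simp add: H_graph_def)
  next
    fix F :: "'d multiset set" and a :: "'d multiset \<Rightarrow> complex"
    assume "finite F"
    then have "P (\<Sum>M\<in>F. scaleC_l2 (a M) (\<phi> M)) (\<Sum>M\<in>F. scaleC_l2 (a M * of_real (\<mu> M)) (\<phi> M))"
    proof (induction F rule: finite_induct)
      case empty
      show ?case using P_scale[OF P_eig, of 0] by simp
    next
      case (insert M F)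
      have "P (scaleC_l2 (a M) (\<phi> M)) (scaleC_l2 (a M * of_real (\<mu> M)) (\<phi> M))"
        using P_scale[OF P_eig, of "a M" M] by simp
      from P_add[OF this insert.IH] show ?case
        using insert.hyps by simp
    qed
    then show "(\<Sum>M\<in>F. scaleC_l2 (a M) (\<phi> M), \<Sum>M\<in>F. scaleC_l2 (a M * of_real (\<mu> M)) (\<phi> M)) \<in> ?G"
      by (rule P_G)
  next
    fix u w M assume uw: "(u, w) \<in> ?G"
    \<comment> \<open>\<open>?S\<close> is closed by continuity of the inner product and contains
      the graph over Schwartz functions by \<open>H_op_symmetric\<close>, hence also its
      closure.\<close>
    let ?S = "{p. cinner_l2 (\<phi> M) (snd p) = of_real (\<mu> M) * cinner_l2 (\<phi> M) (fst p)}"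
    have "continuous_on UNIV (cinner_l2 (\<phi> M))"
      by (rule linear_continuous_on[OF bounded_linear_cinner_right])
    then have "closed ?S"
      by (intro closed_Collect_eq continuous_on_mult continuous_on_const
          continuous_on_compose2[OF _ continuous_on_fst] continuous_on_compose2[OF _ continuous_on_snd])
         (auto intro: continuous_on_id)
    moreover have "(\<lambda>f. (to_l2 f, to_l2 (H_op A f))) ` schwartz \<subseteq> ?S"
    proof safe
      fix f :: "real^'d \<Rightarrow> complex" assume f: "f \<in> schwartz"
      have "cinner_l2 (\<phi> M) (to_l2 (H_op A f)) = pairing (nf M) (H_op A f)"
        unfolding \<phi>_def cinner_to_l2[OF sq square_integrable_H_op[OF f]] pairing_def ..
      also have "\<dots> = pairing (H_op A (nf M)) f"
        by (rule H_op_symmetric[OF nf f])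
      also have "\<dots> = of_real (\<mu> M) * pairing (nf M) f"
        unfolding H_nf pairing_cmult_left by simp
      also have "pairing (nf M) f = cinner_l2 (\<phi> M) (to_l2 f)"
        unfolding \<phi>_def cinner_to_l2[OF sq square_integrable_schwartz[OF f]] pairing_def ..
      finally show "cinner_l2 (\<phi> M) (snd (to_l2 f, to_l2 (H_op A f)))
          = of_real (\<mu> M) * cinner_l2 (\<phi> M) (fst (to_l2 f, to_l2 (H_op A f)))" by simp
    qed
    ultimately have "?G \<subseteq> ?S" unfolding H_graph_def by (intro closure_minimal)
    with uw show "cinner_l2 (\<phi> M) w = of_real (\<mu> M) * cinner_l2 (\<phi> M) u" by auto
  next
    fix r
    have "{M. \<mu> M \<le> r} = {M. (\<Sum>j\<in>#M. - s j) \<le> r - e}" by (auto simp: \<mu>_def)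
    then show "finite {M. \<mu> M \<le> r}"
      using finite_multisets_sum_le[of "\<lambda>j. - s j" "r - e"] s by simp
  qed
  show ?thesis
    unfolding counting_function_eq \<mu>_def e_def ..
qed

lemma card_multisets_eq_card_functions:
  fixes a :: "'d::finite \<Rightarrow> real"
  shows "card {M :: 'd multiset. (\<Sum>j\<in>#M. a j) \<le> r}
    = card {n :: 'd \<Rightarrow> nat. (\<Sum>j\<in>UNIV. real (n j) * a j) \<le> r}"
proof (rule bij_betw_same_card[of count])
  have "inj_on count {M :: 'd multiset. (\<Sum>j\<in>#M. a j) \<le> r}"
    by (rule inj_onI) (simp add: multiset_eqI)
  moreover have "count ` {M :: 'd multiset. (\<Sum>j\<in>#M. a j) \<le> r}
      = {n :: 'd \<Rightarrow> nat. (\<Sum>j\<in>UNIV. real (n j) * a j) \<le> r}"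
  proof safe
    fix n :: "'d \<Rightarrow> nat" assume n: "(\<Sum>j\<in>UNIV. real (n j) * a j) \<le> r"
    have "count (Abs_multiset n) = n" by (rule count_Abs_multiset) simp
    then show "n \<in> count ` {M :: 'd multiset. (\<Sum>j\<in>#M. a j) \<le> r}"
      using n by (intro image_eqI[of _ _ "Abs_multiset n"]) (auto simp: sum_mset_eq_sum_count)
  qed (simp add: sum_mset_eq_sum_count)
  ultimately show "bij_betw count {M :: 'd multiset. (\<Sum>j\<in>#M. a j) \<le> r}
      {n :: 'd \<Rightarrow> nat. (\<Sum>j\<in>UNIV. real (n j) * a j) \<le> r}"
    by (rule bij_betw_imageI)
qed

subsection \<open>Counting lattice points in a rational simplex\<close>

text \<open>Stars and bars: a value \<open>i\<close> at the new index leaves \<open>N - i\<close>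
  for the others, and the hockey-stick identity adds the binomials. Vanishing outside
  \<open>S\<close> keeps functions on the whole type finite in number.\<close>

lemma card_functions_sum_le:
  assumes "finite S"
  shows "finite {m :: 'd \<Rightarrow> nat. (\<forall>j. j \<notin> S \<longrightarrow> m j = 0) \<and> sum m S \<le> N} \<and>
    card {m :: 'd \<Rightarrow> nat. (\<forall>j. j \<notin> S \<longrightarrow> m j = 0) \<and> sum m S \<le> N} = (N + card S) choose card S"
  using assms
proof (induction S arbitrary: N rule: finite_induct)
  case empty
  have "{m :: 'd \<Rightarrow> nat. (\<forall>j. j \<notin> {} \<longrightarrow> m j = 0) \<and> sum m {} \<le> N} = {\<lambda>_. 0}" by auto
  then show ?case by simp
next
  case (insert k S)
  define D where "D N = {m :: 'd \<Rightarrow> nat. (\<forall>j. j \<notin> S \<longrightarrow> m j = 0) \<and> sum m S \<le> N}" for N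
  let ?E = "{m :: 'd \<Rightarrow> nat. (\<forall>j. j \<notin> insert k S \<longrightarrow> m j = 0) \<and> sum m (insert k S) \<le> N}"
  let ?f = "\<lambda>(i, m :: 'd \<Rightarrow> nat). m(k := i)"
  have D: "finite (D N)" "card (D N) = (N + card S) choose card S" for N
    using insert.IH[of N] by (simp_all add: D_def)
  have b: "bij_betw ?f (Sigma {..N} (\<lambda>i. D (N - i))) ?E"
  proof (rule bij_betw_byWitness[where f' = "\<lambda>m. (m k, m(k := 0))"])
    have s: "(\<Sum>x\<in>S. if x = k then i else m x) = sum m S" for m :: "'d \<Rightarrow> nat" and i
      using insert.hyps by (intro sum.cong) auto
    show "\<forall>p\<in>Sigma {..N} (\<lambda>i. D (N - i)). (\<lambda>m. (m k, m(k := 0))) (?f p) = p"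
      using insert.hyps by (auto simp: D_def fun_eq_iff)
    show "\<forall>m\<in>?E. ?f (m k, m(k := 0)) = m" by auto
    show "?f ` Sigma {..N} (\<lambda>i. D (N - i)) \<subseteq> ?E"
      using insert.hyps by (auto simp: D_def s)
    show "(\<lambda>m. (m k, m(k := 0))) ` ?E \<subseteq> Sigma {..N} (\<lambda>i. D (N - i))"
      using insert.hyps by (auto simp: D_def s)
  qed
  have "finite (Sigma {..N} (\<lambda>i. D (N - i)))" by (intro finite_SigmaI D finite_atMost)
  then have fin: "finite ?E" using bij_betw_finite[OF b] by blast
  have "card ?E = card (Sigma {..N} (\<lambda>i. D (N - i)))"
    by (rule bij_betw_same_card[OF b, symmetric])
  also have "\<dots> = (\<Sum>i\<le>N. (N - i + card S) choose card S)"
    using D by (simp add: card_SigmaI)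
  also have "\<dots> = (\<Sum>i\<le>N. (card S + i) choose card S)"
    by (rule sum.reindex_bij_witness[of _ "\<lambda>i. N - i" "\<lambda>i. N - i"]) (auto simp: add.commute)
  also have "\<dots> = (card S + N + 1) choose (card S + 1)"
    by (rule choose_rising_sum)
  also have "\<dots> = (N + card (insert k S)) choose card (insert k S)"
    using insert.hyps by (simp add: add.commute)
  finally show ?case using fin by simp
qed

text \<open>In natural numbers \<open>(w + q - 1) div q\<close> is the ceiling of w / q; this is its
  characteristic property.\<close>

lemma div_ceiling_le_iff:
  fixes w q x :: nat
  assumes "q > 0"
  shows "(w + q - 1) div q \<le> x \<longleftrightarrow> w \<le> q * x"
proof -
  have "(w + q - 1) div q \<le> x \<longleftrightarrow> (w + q - 1) div q < Suc x" by linarith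
  also have "\<dots> \<longleftrightarrow> w + q - 1 < Suc x * q"
    using assms by (rule div_less_iff_less_mult)
  also have "\<dots> \<longleftrightarrow> w \<le> q * x" using assms by (auto simp: mult.commute)
  finally show ?thesis .
qed

text \<open>A nonzero remainder y of w is complemented by q - y in w', and then both quotients round
  up, for a surplus of 1; without remainder neither does. It is applied to a residue vector and its
  negative.\<close>

lemma div_ceiling_complement:
  fixes w w' q s :: nat
  assumes q: "q > 0" and s: "w + w' = q * s"
  shows "(w + q - 1) div q + (w' + q - 1) div q = s + (if q dvd w then 0 else 1)"
proof (cases "q dvd w")
  case True
  then obtain x where x: "w = q * x" by blast
  have "q dvd w'" using True s by (metis dvd_add_right_iff dvd_triv_left)
  then obtain y where y: "w' = q * y" by blast
  have "(q * z + q - 1) div q = z" for z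
    using q by (intro div_nat_eqI) (auto simp: mult.commute)
  moreover have "x + y = s" using s x y q by (simp flip: distrib_left)
  ultimately show ?thesis using True x y by simp
next
  case False
  define x y where "x = w div q" and "y = w mod q"
  have w: "w = q * x + y" "y < q" "y > 0"
    using q False by (auto simp: x_def y_def dvd_eq_mod_eq_0)
  have "x < s"
  proof (rule ccontr)
    assume "\<not> x < s"
    then have "q * s \<le> q * x" by simp
    then show False using w s by linarith
  qed
  then obtain z where z: "s = x + 1 + z" by (metis add.assoc less_natE plus_1_eq_Suc add_Suc_right add.commute)
  have w': "w' = q * z + (q - y)"
    using s w z by (simp add: distrib_left)
  have "(w + q - 1) div q = x + 1"
    using w by (intro div_nat_eqI) (auto simp: algebra_simps)
  moreover have "(w' + q - 1) div q = z + 1"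
    unfolding w' using w by (intro div_nat_eqI) (auto simp: algebra_simps)
  ultimately show ?thesis using False z by simp
qed

text \<open>Bezout's identity, one element at a time. It is applied to the periods of a level count
  in \<open>card_level_zero\<close>, and to integer combinations of the \<open>a j\<close> in
  \<open>facet_volume_slanted\<close>.\<close>

lemma int_subgroup_Gcd:
  fixes T :: "int set"
  assumes add: "\<And>x y. x \<in> T \<Longrightarrow> y \<in> T \<Longrightarrow> x + y \<in> T" and neg: "\<And>x. x \<in> T \<Longrightarrow> - x \<in> T"
    and zero: "0 \<in> T" and "finite S" "S \<subseteq> T"
  shows "Gcd S \<in> T"
  using assms(4,5)
proof (induction S rule: finite_induct)
  case (insert x S)
  have mult: "k * y \<in> T" if "y \<in> T" for k y
  proof (induction k rule: int_induct[where k = 0])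
    case (step1 i)
    then show ?case using add[OF _ that] by (simp add: distrib_right)
  next
    case (step2 i)
    then show ?case using add[OF _ neg[OF that]] by (simp add: left_diff_distrib)
  qed (simp add: zero)
  obtain u v where "u * x + v * Gcd S = gcd x (Gcd S)" using bezout_int by blast
  moreover have "u * x + v * Gcd S \<in> T" using insert by (intro add mult) auto
  ultimately show ?case by simp
qed (simp add: zero)

text \<open>Vieta's formulas for the two leading coefficients, the only ones besides the constant
  term that are identified for the Ehrhart polynomial.\<close>

lemma coeff_prod_linear:
  fixes b :: "'i \<Rightarrow> real"
  assumes "finite I"
  shows "degree (\<Prod>i\<in>I. [:b i, 1:]) = card I \<and> coeff (\<Prod>i\<in>I. [:b i, 1:]) (card I) = 1 \<and>
    (I \<noteq> {} \<longrightarrow> coeff (\<Prod>i\<in>I. [:b i, 1:]) (card I - 1) = (\<Sum>i\<in>I. b i))"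
  using assms
proof (induction I rule: finite_induct)
  case (insert i I)
  let ?p = "\<Prod>i\<in>I. [:b i, 1:]"
  have p: "(\<Prod>i\<in>insert i I. [:b i, 1:]) = pCons 0 ?p + smult (b i) ?p"
    using insert.hyps by simp
  have deg: "degree ?p = card I" and lead: "coeff ?p (card I) = 1" using insert.IH by auto
  have c1: "coeff (\<Prod>i\<in>insert i I. [:b i, 1:]) (Suc (card I)) = 1"
    unfolding p using deg lead by (simp add: coeff_eq_0)
  have "degree (\<Prod>i\<in>insert i I. [:b i, 1:]) = (\<Sum>i\<in>insert i I. degree [:b i, 1:])"
    by (rule degree_prod_eq_sum_degree) simp
  then have d: "degree (\<Prod>i\<in>insert i I. [:b i, 1:]) = card (insert i I)" by simp
  have "coeff (\<Prod>i\<in>insert i I. [:b i, 1:]) (card I) = (\<Sum>i\<in>insert i I. b i)"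
  proof (cases "I = {}")
    case False
    then obtain n where n: "card I = Suc n" using insert.hyps by (metis card_gt_0_iff gr0_implies_Suc)
    have "coeff ?p n = (\<Sum>i\<in>I. b i)" using insert.IH False n by simp
    then show ?thesis unfolding p using lead n insert.hyps by (simp add: add.commute)
  qed simp
  then show ?case using c1 d insert.hyps by simp
qed simp

text \<open>Also true for k < c: the binomial coefficient is then 0, and so is the factor with i = c
  - k. Hence the counts are polynomial from k = 0 on.\<close>

lemma binomial_eq_prod:
  assumes "c \<le> d"
  shows "real ((k + d - c) choose d) = (\<Prod>i\<in>{1..d}. real i - real c + real k) / fact d"
proof -
  have "real ((k + d - c) choose d) = (\<Prod>i = 0..<d. real (k + d - c) - of_nat i) / fact d"
    unfolding binomial_gbinomial gbinomial_prod_rev ..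
  also have "(\<Prod>i = 0..<d. real (k + d - c) - of_nat i) = (\<Prod>i\<in>{1..d}. real i - real c + real k)"
    by (rule prod.reindex_bij_witness[of _ "\<lambda>i. d - i" "\<lambda>i. d - i"]) (use assms in \<open>auto simp: of_nat_diff\<close>)
  finally show ?thesis .
qed

text \<open>\<open>a\<close> stands for - p. Divisibility makes the vertices q / a_j on the axes
  integer points, which is why the count is a polynomial in the dilation factor.\<close>

locale lattice_simplex =
  fixes a :: "'d::finite \<Rightarrow> nat" and q :: nat
  assumes q_pos: "q > 0" and a_dvd: "\<And>j. a j dvd q"
begin

definition side :: "'d \<Rightarrow> nat" where "side j = q div a j"

definition residues :: "('d \<Rightarrow> nat) set" where "residues = Pi\<^sub>E UNIV (\<lambda>j. {..<side j})"

definition level :: "('d \<Rightarrow> nat) \<Rightarrow> nat" where "level r = (\<Sum>j\<in>UNIV. a j * r j)"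

definition ceil_level :: "('d \<Rightarrow> nat) \<Rightarrow> nat" where "ceil_level r = (level r + q - 1) div q"

definition points :: "nat \<Rightarrow> ('d \<Rightarrow> nat) set" where "points k = {n. level n \<le> q * k}"

lemma a_side: "a j * side j = q"
  using a_dvd by (simp add: side_def)

lemma a_pos: "a j > 0" and side_pos: "side j > 0"
  using a_side[of j] q_pos by (metis mult_0 neq0_conv, metis mult_0_right neq0_conv)

lemma mem_residues: "r \<in> residues \<longleftrightarrow> (\<forall>j. r j < side j)"
  by (auto simp: residues_def PiE_def extensional_def)

lemma finite_residues: "finite residues"
  unfolding residues_def by (intro finite_PiE) auto

lemma card_residues: "card residues = (\<Prod>j\<in>UNIV. side j)"
  unfolding residues_def by (simp add: card_PiE)

lemma ceil_level_le: "r \<in> residues \<Longrightarrow> ceil_level r \<le> CARD('d)"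
proof -
  assume r: "r \<in> residues"
  have "level r \<le> (\<Sum>j\<in>(UNIV::'d set). q)"
    unfolding level_def
  proof (rule sum_mono)
    fix j
    have "a j * r j \<le> a j * side j" using r by (simp add: mem_residues less_imp_le)
    then show "a j * r j \<le> q" by (simp add: a_side)
  qed
  then show ?thesis
    unfolding ceil_level_def div_ceiling_le_iff[OF q_pos] by (simp add: mult.commute)
qed

lemma card_points:
  "finite (points k)" "card (points k) = (\<Sum>r\<in>residues. (k + CARD('d) - ceil_level r) choose CARD('d))"
proof -
  \<comment> \<open>With \<open>c\<close> added on the left, the description stays correct for
    \<open>c > k\<close>, where the set is empty and the binomial coefficient is 0.\<close>
  define D where "D c = {m :: 'd \<Rightarrow> nat. (\<Sum>j\<in>UNIV. m j) + c \<le> k}" for c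
  have D: "finite (D c)" "card (D c) = (k + CARD('d) - c) choose CARD('d)" if "c \<le> CARD('d)" for c
  proof -
    have "finite (D c) \<and> card (D c) = (k + CARD('d) - c) choose CARD('d)"
    proof (cases "c \<le> k")
      case True
      then have "D c = {m :: 'd \<Rightarrow> nat. (\<forall>j. j \<notin> UNIV \<longrightarrow> m j = 0) \<and> sum m UNIV \<le> k - c}"
        by (auto simp: D_def)
      then show ?thesis
        using card_functions_sum_le[of "UNIV :: 'd set" "k - c"] True by simp
    next
      case False
      then have "D c = {}" by (auto simp: D_def)
      moreover have "(k + CARD('d) - c) choose CARD('d) = 0"
        using False that by (intro binomial_eq_0) auto
      ultimately show ?thesis by simp
    qed
    then show "finite (D c)" "card (D c) = (k + CARD('d) - c) choose CARD('d)" by auto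
  qed
  let ?f = "\<lambda>(r, m). \<lambda>j. side j * m j + r j"
  have lev: "level (\<lambda>j. side j * m j + r j) = q * (\<Sum>j\<in>UNIV. m j) + level r" for m r
  proof -
    have "level (\<lambda>j. side j * m j + r j) = (\<Sum>j\<in>UNIV. (a j * side j) * m j + a j * r j)"
      by (simp add: level_def distrib_left mult.assoc)
    then show ?thesis by (simp add: a_side level_def sum.distrib sum_distrib_left)
  qed
  \<comment> \<open>Whole multiples of \<open>q\<close> pass through the ceiling. The case
    \<open>k < M\<close> is separate because \<open>k - M\<close> truncates.\<close>
  have le_iff: "q * M + level r \<le> q * k \<longleftrightarrow> M + ceil_level r \<le> k" for M r
  proof (cases "M \<le> k")
    case True
    have "M + ceil_level r \<le> k \<longleftrightarrow> ceil_level r \<le> k - M" using True by auto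
    also have "\<dots> \<longleftrightarrow> level r \<le> q * (k - M)"
      unfolding ceil_level_def by (rule div_ceiling_le_iff[OF q_pos])
    also have "\<dots> \<longleftrightarrow> q * M + level r \<le> q * k"
      using True by (auto simp: diff_mult_distrib2 le_diff_conv2)
    finally show ?thesis ..
  next
    case False
    then have "q * k < q * M + level r" using q_pos by (intro trans_less_add1) simp
    then have "\<not> q * M + level r \<le> q * k" "\<not> M + ceil_level r \<le> k" using False by simp_all
    then show ?thesis by blast
  qed
  have b: "bij_betw ?f (Sigma residues (\<lambda>r. D (ceil_level r))) (points k)"
  proof (rule bij_betw_byWitness[where f' = "\<lambda>n. (\<lambda>j. n j mod side j, \<lambda>j. n j div side j)"])
    show "\<forall>p\<in>Sigma residues (\<lambda>r. D (ceil_level r)).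
        (\<lambda>n. (\<lambda>j. n j mod side j, \<lambda>j. n j div side j)) (?f p) = p"
      using side_pos by (auto simp: mem_residues fun_eq_iff)
    show "\<forall>n\<in>points k. ?f (\<lambda>j. n j mod side j, \<lambda>j. n j div side j) = n"
      by (auto simp: fun_eq_iff)
    show "?f ` Sigma residues (\<lambda>r. D (ceil_level r)) \<subseteq> points k"
      by (auto simp: points_def lev le_iff D_def)
    show "(\<lambda>n. (\<lambda>j. n j mod side j, \<lambda>j. n j div side j)) ` points k \<subseteq> Sigma residues (\<lambda>r. D (ceil_level r))"
    proof
      fix p assume "p \<in> (\<lambda>n. (\<lambda>j. n j mod side j, \<lambda>j. n j div side j)) ` points k"
      then obtain n where n: "n \<in> points k" and p: "p = (\<lambda>j. n j mod side j, \<lambda>j. n j div side j)" by blast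
      have "n = (\<lambda>j. side j * (n j div side j) + n j mod side j)" by simp
      then have "level n = q * (\<Sum>j\<in>UNIV. n j div side j) + level (\<lambda>j. n j mod side j)"
        using lev[of "\<lambda>j. n j div side j" "\<lambda>j. n j mod side j"] by simp
      then have "(\<Sum>j\<in>UNIV. n j div side j) + ceil_level (\<lambda>j. n j mod side j) \<le> k"
        using n le_iff by (simp add: points_def)
      then show "p \<in> Sigma residues (\<lambda>r. D (ceil_level r))"
        by (simp add: p mem_residues side_pos D_def)
    qed
  qed
  have fin: "finite (Sigma residues (\<lambda>r. D (ceil_level r)))"
    by (intro finite_SigmaI finite_residues D ceil_level_le)
  then show "finite (points k)" using bij_betw_finite[OF b] by blast
  have "card (points k) = card (Sigma residues (\<lambda>r. D (ceil_level r)))"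
    by (rule bij_betw_same_card[OF b, symmetric])
  also have "\<dots> = (\<Sum>r\<in>residues. card (D (ceil_level r)))"
    by (intro card_SigmaI finite_residues ballI D ceil_level_le)
  also have "\<dots> = (\<Sum>r\<in>residues. (k + CARD('d) - ceil_level r) choose CARD('d))"
    by (intro sum.cong refl D ceil_level_le)
  finally show "card (points k) = (\<Sum>r\<in>residues. (k + CARD('d) - ceil_level r) choose CARD('d))" .
qed

text \<open>The binomials of \<open>card_points\<close> as polynomials in \<open>k\<close>, by
  \<open>binomial_eq_prod\<close>; its condition on \<open>c\<close> is met by
  \<open>ceil_level_le\<close>.\<close>

definition ehrhart :: "real poly" where
  "ehrhart = (\<Sum>r\<in>residues. smult (1 / fact CARD('d)) (\<Prod>i\<in>{1..CARD('d)}. [:real i - real (ceil_level r), 1:]))"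

lemma poly_ehrhart: "poly ehrhart (real k) = real (card (points k))"
proof -
  have "poly ehrhart (real k) = (\<Sum>r\<in>residues. (\<Prod>i\<in>{1..CARD('d)}. real i - real (ceil_level r) + real k) / fact CARD('d))"
    by (simp add: ehrhart_def poly_sum poly_prod)
  also have "\<dots> = (\<Sum>r\<in>residues. real ((k + CARD('d) - ceil_level r) choose CARD('d)))"
    by (intro sum.cong refl binomial_eq_prod[symmetric] ceil_level_le)
  finally show ?thesis by (simp add: card_points)
qed

lemma degree_ehrhart: "degree ehrhart \<le> CARD('d)"
  unfolding ehrhart_def
proof (intro degree_sum_le finite_residues order_trans[OF degree_smult_le])
  fix r
  show "degree (\<Prod>i = 1..CARD('d). [:real i - real (ceil_level r), 1:]) \<le> CARD('d)"
    using coeff_prod_linear[of "{1..CARD('d)}" "\<lambda>i. real i - real (ceil_level r)"] by simp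
qed

text \<open>Evaluation at 0: since all \<open>a j\<close> are positive, the zero dilate contains
  only the origin.\<close>

lemma coeff_ehrhart_0: "coeff ehrhart 0 = 1"
proof -
  have nz: "a j \<noteq> 0" for j using a_pos[of j] by simp
  have "points 0 = {\<lambda>_. 0}"
    by (auto simp: points_def level_def fun_eq_iff nz)
  then show ?thesis using poly_ehrhart[of 0] by (simp add: poly_0_coeff_0)
qed

lemma coeff_ehrhart_top: "coeff ehrhart CARD('d) = (\<Prod>j\<in>UNIV. real (side j)) / fact CARD('d)"
proof -
  have "coeff ehrhart CARD('d) = (\<Sum>r\<in>residues. 1 / fact CARD('d))"
    unfolding ehrhart_def coeff_sum coeff_smult
    by (intro sum.cong refl)
       (use coeff_prod_linear[of "{1..CARD('d)}" "\<lambda>i. real i - real (ceil_level _)"] in simp)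
  then show ?thesis by (simp add: card_residues)
qed

lemma card_coordinate_zero: "side j * card {r \<in> residues. r j = 0} = card residues"
proof -
  have "{r \<in> residues. r j = 0} = Pi\<^sub>E UNIV (\<lambda>i. if i = j then {0} else {..<side i})"
    using side_pos by (auto simp: mem_residues PiE_def extensional_def Pi_def split: if_splits)
  then have "card {r \<in> residues. r j = 0} = (\<Prod>i\<in>UNIV. if i = j then 1 else side i)"
    by (simp add: card_PiE if_distrib cong: if_cong)
  also have "\<dots> = (\<Prod>i\<in>UNIV - {j}. side i)"
    by (subst prod.remove[of _ j]) (auto intro!: prod.cong)
  finally show ?thesis by (simp add: card_residues prod.remove[of UNIV j])
qed

text \<open>Translating a residue vector by a unit vector permutes the residues and shifts the level by
  \<open>a j\<close> modulo \<open>q\<close>, so all multiples of the gcd are attained equally often.\<close>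

lemma card_level_zero: "q * card {r \<in> residues. q dvd level r} = Gcd (range a) * card residues"
proof -
  define g where "g = Gcd (range a)"
  have g_dvd: "g dvd a j" for j by (simp add: g_def)
  then have g_pos: "g > 0" using a_pos by (metis dvd_0_left_iff neq0_conv)
  have gq: "g dvd q" using g_dvd a_dvd dvd_trans by blast
  \<comment> \<open>The congruence is formed in \<open>int\<close> so that \<open>t\<close> ranges
    over a group and the periods of \<open>N\<close> form a subgroup, \<open>T\<close>
    below.\<close>
  define N where "N t = card {r \<in> residues. int q dvd int (level r) - t}" for t
  have shift: "N (t + int (a j)) = N t" for t j
  proof -
    define f where "f r = r(j := (r j + 1) mod side j)" for r :: "'d \<Rightarrow> nat"
    have fR: "f ` residues \<subseteq> residues"
      using side_pos by (auto simp: f_def mem_residues)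
    have inj: "inj_on f residues"
    proof (rule inj_onI)
      fix r r' assume r: "r \<in> residues" "r' \<in> residues" and eq: "f r = f r'"
      have "r i = r' i" for i
      proof (cases "i = j")
        case True
        have "(r j + 1) mod side j = (r' j + 1) mod side j"
          using fun_cong[OF eq, of j] by (simp add: f_def)
        then show ?thesis using r True
          by (auto simp: mem_residues mod_Suc split: if_splits)
      next
        case False
        then show ?thesis using fun_cong[OF eq, of i] by (simp add: f_def)
      qed
      then show "r = r'" by blast
    qed
    have onto: "f ` residues = residues"
      by (rule endo_inj_surj[OF finite_residues fR inj])
    have lev: "int q dvd int (level (f r)) - (t + int (a j)) \<longleftrightarrow> int q dvd int (level r) - t" if r: "r \<in> residues" for r
    proof -
      have split: "level r = a j * r j + (\<Sum>i\<in>UNIV - {j}. a i * r i)" for r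
        unfolding level_def by (rule sum.remove) auto
      have rest: "(\<Sum>i\<in>UNIV - {j}. a i * f r i) = (\<Sum>i\<in>UNIV - {j}. a i * r i)"
        by (intro sum.cong) (auto simp: f_def)
      have "\<exists>b. int (a j * f r j) = int (a j * r j) + int (a j) - int q * b"
      proof (cases "r j + 1 < side j")
        case True
        then show ?thesis by (intro exI[of _ 0]) (simp add: f_def algebra_simps)
      next
        case False
        moreover have "r j < side j" using r by (simp add: mem_residues)
        ultimately have *: "r j + 1 = side j" by linarith
        have "f r j = 0" unfolding f_def fun_upd_same * by simp
        moreover have "int (a j * r j) + int (a j) = int (a j * (r j + 1))" by (simp add: algebra_simps)
        then have "int (a j * r j) + int (a j) = int q" by (simp only: * a_side)
        ultimately show ?thesis by (intro exI[of _ 1]) (simp del: of_nat_mult)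
      qed
      then obtain b where b: "int (a j * f r j) = int (a j * r j) + int (a j) - int q * b" by blast
      have "int (level (f r)) - (t + int (a j)) = (int (level r) - t) + int q * (- b)"
        unfolding split[of "f r"] split[of r] rest using b by simp
      then show ?thesis by (simp only: dvd_add_left_iff dvd_triv_left)
    qed
    have "{r \<in> residues. int q dvd int (level r) - (t + int (a j))}
        = f ` {r \<in> residues. int q dvd int (level r) - t}"
    proof (intro equalityI subsetI)
      fix r assume "r \<in> {r \<in> residues. int q dvd int (level r) - (t + int (a j))}"
      then have r: "r \<in> residues" and d: "int q dvd int (level r) - (t + int (a j))" by simp_all
      from r have "r \<in> f ` residues" unfolding onto .
      then obtain r' where r': "r = f r'" "r' \<in> residues" by (rule imageE)
      have "int q dvd int (level r') - t" using d lev[OF r'(2)] unfolding r'(1) by simp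
      then show "r \<in> f ` {r \<in> residues. int q dvd int (level r) - t}"
        unfolding r'(1) using r'(2) by (intro imageI CollectI conjI)
    next
      fix r assume "r \<in> f ` {r \<in> residues. int q dvd int (level r) - t}"
      then obtain r' where r': "r = f r'" "r' \<in> residues" "int q dvd int (level r') - t" by auto
      have "f r' \<in> residues" using fR r'(2) by (rule subsetD[OF _ imageI])
      then show "r \<in> {r \<in> residues. int q dvd int (level r) - (t + int (a j))}"
        unfolding r'(1) using lev[OF r'(2)] r'(3) by simp
    qed
    then show ?thesis unfolding N_def
      by (simp add: card_image inj_on_subset[OF inj])
  qed
  define T where "T = {u. \<forall>t. N (t + u) = N t}"
  have "Gcd (range (\<lambda>j. int (a j))) \<in> T"
  proof (rule int_subgroup_Gcd)
    show "x + y \<in> T" if "x \<in> T" "y \<in> T" for x y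
      using that by (simp add: T_def add.assoc[symmetric])
    show "- x \<in> T" if x: "x \<in> T" for x
    proof -
      have "N (t + - x) = N t" for t
      proof -
        have "N (t + - x + x) = N (t + - x)" using x unfolding T_def by blast
        then show ?thesis by simp
      qed
      then show ?thesis by (simp add: T_def)
    qed
    show "range (\<lambda>j. int (a j)) \<subseteq> T" using shift by (auto simp: T_def)
  qed (auto simp: T_def)
  moreover have "Gcd (range (\<lambda>j. int (a j))) = int g"
    unfolding g_def by (simp add: Gcd_int_def image_image)
  ultimately have gT: "N (t + int g) = N t" for t by (simp add: T_def)
  have Ng: "N (int (g * m)) = N 0" for m
  proof (induction m)
    case (Suc m)
    then show ?case using gT[of "int (g * m)"] by (simp add: algebra_simps)
  qed simp
  \<comment> \<open>All levels are multiples of \<open>g\<close>, and these fall into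
    \<open>K\<close> classes modulo \<open>q\<close>, each of size \<open>N 0\<close>; hence
    \<open>card residues = K * N 0\<close>.\<close>
  define K where "K = q div g"
  have gK: "g * K = q" using gq by (simp add: K_def)
  have g_lev: "g dvd level r" for r
    unfolding level_def by (intro dvd_sum dvd_mult2 g_dvd)
  have cover: "residues = (\<Union>m<K. {r \<in> residues. int q dvd int (level r) - int (g * m)})"
  proof (intro equalityI subsetI)
    fix r assume r: "r \<in> residues"
    obtain x where x: "level r = g * x" using g_lev by blast
    have K0: "K > 0" using gK q_pos by (metis mult_0_right neq0_conv)
    have "int (level r) - int (g * (x mod K)) = int q * int (x div K)"
    proof -
      have "level r = g * (x mod K) + q * (x div K)"
        unfolding x gK[symmetric] mult.assoc distrib_left[symmetric] by simp
      then show ?thesis by simp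
    qed
    then have "int q dvd int (level r) - int (g * (x mod K))" by simp
    then show "r \<in> (\<Union>m<K. {r \<in> residues. int q dvd int (level r) - int (g * m)})"
      using r K0 by (intro UN_I[of "x mod K"]) auto
  qed auto
  have disj: "{r \<in> residues. int q dvd int (level r) - int (g * m)} \<inter>
      {r \<in> residues. int q dvd int (level r) - int (g * m')} = {}" if "m < K" "m' < K" "m \<noteq> m'" for m m'
  proof (rule ccontr)
    assume "\<not> ?thesis"
    then obtain r where "int q dvd int (level r) - int (g * m)" "int q dvd int (level r) - int (g * m')" by blast
    then have "int q dvd (int (level r) - int (g * m')) - (int (level r) - int (g * m))" by (rule dvd_diff[rotated])
    then have "int g * int K dvd int g * (int m - int m')"
      by (simp add: gK[symmetric] algebra_simps)
    then have "int K dvd int m - int m'" using g_pos by simp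
    then have "int m mod int K = int m' mod int K" by (simp add: mod_eq_dvd_iff)
    then show False using that by simp
  qed
  have "card residues = card (\<Union>m<K. {r \<in> residues. int q dvd int (level r) - int (g * m)})"
    by (rule arg_cong[OF cover])
  also have "\<dots> = (\<Sum>m<K. N (int (g * m)))"
    unfolding N_def by (rule card_UN_disjoint) (use finite_residues disj in auto)
  also have "\<dots> = K * N 0" by (simp only: Ng sum_constant card_lessThan of_nat_id)
  finally have "g * card residues = q * N 0" by (simp add: gK[symmetric] mult.assoc)
  then show ?thesis by (simp add: N_def g_def)
qed

text \<open>Pairing a residue vector with its negative modulo the sides.\<close>

lemma sum_ceil_level:
  "2 * (\<Sum>r\<in>residues. ceil_level r) + card {r \<in> residues. q dvd level r}
    = (\<Sum>j\<in>UNIV. card {r \<in> residues. r j \<noteq> 0}) + card residues"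
proof -
  define neg where "neg r = (\<lambda>j. if r j = 0 then 0 else side j - r j)" for r :: "'d \<Rightarrow> nat"
  define supp where "supp r = card {j. r j \<noteq> 0}" for r :: "'d \<Rightarrow> nat"
  have neg_res: "neg r \<in> residues" if "r \<in> residues" for r
    unfolding mem_residues
  proof
    fix j
    have "r j < side j" using that by (simp add: mem_residues)
    then show "neg r j < side j" by (simp add: neg_def)
  qed
  have neg_neg: "neg (neg r) = r" if "r \<in> residues" for r
  proof
    fix j
    have "r j < side j" using that by (simp add: mem_residues)
    then show "neg (neg r) j = r j" by (simp add: neg_def)
  qed
  \<comment> \<open>Each coordinate in the support contributes \<open>a j * side j = q\<close>, so
    \<open>div_ceiling_complement\<close> applies with the size of the support.\<close>
  have lev: "level r + level (neg r) = q * supp r" if r: "r \<in> residues" for r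
  proof -
    have "level r + level (neg r) = (\<Sum>j\<in>UNIV. a j * (r j + neg r j))"
      by (simp add: level_def sum.distrib distrib_left)
    also have "\<dots> = (\<Sum>j\<in>UNIV. if r j \<noteq> 0 then q else 0)"
    proof (intro sum.cong refl)
      fix j
      have "r j + neg r j = side j" if "r j \<noteq> 0"
        using that r by (simp add: neg_def mem_residues less_imp_le)
      then show "a j * (r j + neg r j) = (if r j \<noteq> 0 then q else 0)"
        using a_side[of j] by (auto simp: neg_def)
    qed
    also have "\<dots> = (\<Sum>j\<in>{j. r j \<noteq> 0}. q)" by (simp add: sum.If_cases)
    finally show ?thesis by (simp add: supp_def mult.commute)
  qed
  have "(\<Sum>r\<in>residues. ceil_level (neg r)) = (\<Sum>r\<in>residues. ceil_level r)"
    by (rule sum.reindex_bij_witness[of _ neg neg]) (auto simp: neg_res neg_neg)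
  then have "2 * (\<Sum>r\<in>residues. ceil_level r) = (\<Sum>r\<in>residues. ceil_level r + ceil_level (neg r))"
    by (simp add: sum.distrib)
  also have "\<dots> = (\<Sum>r\<in>residues. supp r + (if q dvd level r then 0 else 1))"
    unfolding ceil_level_def by (intro sum.cong refl div_ceiling_complement[OF q_pos] lev)
  finally have "2 * (\<Sum>r\<in>residues. ceil_level r) = (\<Sum>r\<in>residues. supp r) + (\<Sum>r\<in>residues. if q dvd level r then 0 else 1)"
    by (simp add: sum.distrib)
  moreover have "card {r \<in> residues. q dvd level r} = (\<Sum>r\<in>residues. if q dvd level r then 1 else 0)"
    by (simp add: sum.If_cases finite_residues Int_def)
  moreover have "(\<Sum>r\<in>residues. if q dvd level r then 0 else 1) + (\<Sum>r\<in>residues. if q dvd level r then 1 else 0) = card residues"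
    by (simp add: sum.distrib[symmetric] card_eq_sum del: sum_constant) (intro sum.cong, auto)
  moreover have "(\<Sum>r\<in>residues. supp r) = (\<Sum>j\<in>UNIV. card {r \<in> residues. r j \<noteq> 0})"
  proof -
    have "(\<Sum>r\<in>residues. supp r) = (\<Sum>r\<in>residues. \<Sum>j\<in>UNIV. if r j \<noteq> 0 then 1 else 0)"
      by (simp add: supp_def sum.If_cases)
    also have "\<dots> = (\<Sum>j\<in>UNIV. \<Sum>r\<in>residues. if r j \<noteq> 0 then 1 else 0)" by (rule sum.swap)
    also have "\<dots> = (\<Sum>j\<in>UNIV. card {r \<in> residues. r j \<noteq> 0})"
      by (simp add: sum.If_cases finite_residues Int_def)
    finally show ?thesis .
  qed
  ultimately show ?thesis by linarith
qed

text \<open>A summand with ceiling c contributes (d + 1 - 2 c) / (2 (d - 1)!). In the sum over all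
  residues, \<open>sum_ceil_level\<close> cancels the d + 1 and leaves the densities 1 / side j of
  vectors with a zero at \<open>j\<close>, plus the density gcd / q of vectors whose level is
  divisible by \<open>q\<close>.\<close>

lemma coeff_ehrhart_second:
  "coeff ehrhart (CARD('d) - 1) = 1/2 * ((\<Prod>j\<in>UNIV. real (side j)) / fact (CARD('d) - 1)
     * ((\<Sum>j\<in>UNIV. 1 / real (side j)) + real (Gcd (range a)) / real q))"
proof -
  let ?d = "CARD('d)" and ?R = "real (card residues)"
  have d: "?d > 0" by simp
  have "coeff ehrhart (?d - 1) = (\<Sum>r\<in>residues. (1 / fact ?d) * (\<Sum>i\<in>{1..?d}. real i - real (ceil_level r)))"
    unfolding ehrhart_def coeff_sum coeff_smult
  proof (intro sum.cong refl)
    fix r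
    have "coeff (\<Prod>i = 1..?d. [:real i - real (ceil_level r), 1:]) (?d - 1) = (\<Sum>i = 1..?d. real i - real (ceil_level r))"
      using coeff_prod_linear[of "{1..?d}" "\<lambda>i. real i - real (ceil_level r)"] d by simp
    then show "1 / fact ?d * coeff (\<Prod>i = 1..?d. [:real i - real (ceil_level r), 1:]) (?d - 1)
       = 1 / fact ?d * (\<Sum>i = 1..?d. real i - real (ceil_level r))" by simp
  qed
  also have "\<dots> = (\<Sum>r\<in>residues. 1/2 / fact (?d - 1) * (real ?d + 1 - 2 * real (ceil_level r)))"
  proof (intro sum.cong refl)
    fix r
    have "2 * (\<Sum>i = 1..?d. real i) = real ?d * (real ?d + 1)"
      using double_gauss_sum_from_Suc_0[of ?d, where ?'a = real] by (simp add: algebra_simps)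
    then have S: "(\<Sum>i = 1..?d. real i - real (ceil_level r)) = real ?d * (1/2 * (real ?d + 1 - 2 * real (ceil_level r)))"
      by (simp add: sum_subtractf algebra_simps)
    have F: "(fact ?d :: real) = real ?d * fact (?d - 1)" using d by (rule fact_reduce)
    show "1 / fact ?d * (\<Sum>i = 1..?d. real i - real (ceil_level r))
        = 1/2 / fact (?d - 1) * (real ?d + 1 - 2 * real (ceil_level r))"
      unfolding S F by simp
  qed
  also have "\<dots> = 1/2 / fact (?d - 1) * (?R * (real ?d + 1) - 2 * real (\<Sum>r\<in>residues. ceil_level r))"
    unfolding sum_distrib_left[symmetric] by (simp add: sum_subtractf sum_distrib_left)
  also have "?R * (real ?d + 1) - 2 * real (\<Sum>r\<in>residues. ceil_level r)
      = ?R * ((\<Sum>j\<in>UNIV. 1 / real (side j)) + real (Gcd (range a)) / real q)"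
  proof -
    have nz: "real (card {r \<in> residues. r j \<noteq> 0}) = ?R - ?R / real (side j)" for j
    proof -
      have "card residues = card {r \<in> residues. r j = 0} + card {r \<in> residues. r j \<noteq> 0}"
        using finite_residues by (subst card_Un_disjoint[symmetric]) (auto intro!: arg_cong[of _ _ card])
      moreover have "real (side j) * real (card {r \<in> residues. r j = 0}) = ?R"
        unfolding card_coordinate_zero[of j, symmetric] by simp
      then have "real (card {r \<in> residues. r j = 0}) = ?R / real (side j)"
        using side_pos[of j] by (simp add: field_simps)
      ultimately show ?thesis by linarith
    qed
    have "real q * real (card {r \<in> residues. q dvd level r}) = real (Gcd (range a)) * ?R"
      using card_level_zero by (metis of_nat_mult)
    then have z: "real (card {r \<in> residues. q dvd level r}) = ?R * (real (Gcd (range a)) / real q)"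
      using q_pos by (simp add: field_simps)
    have "2 * real (\<Sum>r\<in>residues. ceil_level r) + real (card {r \<in> residues. q dvd level r})
        = (\<Sum>j\<in>UNIV. real (card {r \<in> residues. r j \<noteq> 0})) + ?R"
      using arg_cong[OF sum_ceil_level, of real] by simp
    then show ?thesis
      unfolding nz z by (simp add: sum_subtractf sum_distrib_left algebra_simps)
  qed
  finally show ?thesis
    by (simp add: card_residues)
qed

end

subsection \<open>Linear images of measurable sets\<close>

text \<open>The library has the determinant formula only for index types that are well-ordered.\<close>

lemma det_transvection:
  fixes m n :: "'n::finite"
  assumes "m \<noteq> n"
  shows "det (matrix (\<lambda>v::real^'n. \<chi> i. if i = m then v $ m + v $ n else v $ i)) = 1"
proof -
  have "matrix (\<lambda>v::real^'n. \<chi> i. if i = m then v $ m + v $ n else v $ i)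
      = (\<chi> k. if k = m then row m (mat 1) + 1 *s row n (mat 1) else row k (mat 1))"
    by (simp add: vec_eq_iff matrix_def row_def mat_def axis_def)
  then show ?thesis
    using det_row_operation[OF assms, of "mat 1 :: real^'n^'n" 1] by simp
qed

lemma abs_det_involution:
  fixes f :: "real^'n \<Rightarrow> real^'n"
  assumes f: "linear f" and inv: "\<And>x. f (f x) = x"
  shows "\<bar>det (matrix f)\<bar> = 1"
proof -
  have "f \<circ> f = id" using inv by auto
  then have "matrix f ** matrix f = mat 1"
    using matrix_compose[OF f f] by (simp add: matrix_id_mat_1)
  then have "det (matrix f) * det (matrix f) = 1"
    by (metis det_I det_mul)
  then show ?thesis
    by (simp add: abs_square_eq_1[symmetric] power2_eq_square)
qed

lemma measure_transvection_cbox: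
  fixes m n :: "'n::finite" and a b :: "real^'n"
  assumes "m \<noteq> n"
  shows "measure lebesgue ((\<lambda>v. \<chi> i. if i = m then v $ m + v $ n else v $ i) ` cbox a b)
    = measure lebesgue (cbox a b)"
proof (cases "cbox a b = {}")
  case False
  let ?h = "\<lambda>v::real^'n. \<chi> i. if i = m then v $ m + v $ n else v $ i"
  \<comment> \<open>The shear formula requires a nonnegative lower corner in coordinate
    \<open>n\<close>; translating the corner to the origin arranges this.\<close>
  have box: "cbox a b = (+) a ` cbox 0 (b - a)"
    by (simp add: cbox_translation[symmetric])
  have ne: "cbox 0 (b - a) \<noteq> {}" using False unfolding box by blast
  have "?h ` cbox a b = (+) (?h a) ` ?h ` cbox 0 (b - a)"
    unfolding box image_image by (intro image_cong refl) (simp add: vec_eq_iff)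
  then have "measure lebesgue (?h ` cbox a b) = measure lebesgue (?h ` cbox 0 (b - a))"
    by (simp only: measure_translation)
  also have "\<dots> = measure lebesgue (cbox 0 (b - a))"
    by (rule measure_shear_interval[OF assms ne]) simp
  also have "\<dots> = measure lebesgue (cbox a b)"
    unfolding box by (rule measure_translation[symmetric])
  finally show ?thesis .
qed simp

text \<open>Reduction to elementary maps. A map that kills a coordinate has determinant 0 and
  negligible image; for swaps and shears, both of determinant 1 up to sign, boxes suffice.\<close>

theorem measure_linear_image_det:
  fixes f :: "real^'n \<Rightarrow> real^'n"
  assumes "linear f" "S \<in> lmeasurable"
  shows "f ` S \<in> lmeasurable" "measure lebesgue (f ` S) = \<bar>det (matrix f)\<bar> * measure lebesgue S"
proof -
  define P where "P f \<longleftrightarrow> (\<forall>S \<in> lmeasurable. f ` S \<in> lmeasurable \<and>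
     measure lebesgue (f ` S) = \<bar>det (matrix f)\<bar> * measure lebesgue S)" for f :: "real^'n \<Rightarrow> real^'n"
  have sufficient: "P f" if "linear f" "\<And>a b. measure lebesgue (f ` cbox a b) = measure lebesgue (cbox a b)"
    "\<bar>det (matrix f)\<bar> = 1" for f
    unfolding P_def
  proof
    fix S :: "(real^'n) set" assume "S \<in> lmeasurable"
    from measure_linear_sufficient[OF that(1) this, of 1] that(2)
    have "f ` S \<in> lmeasurable \<and> 1 * measure lebesgue S = measure lebesgue (f ` S)" by simp
    then show "f ` S \<in> lmeasurable \<and> measure lebesgue (f ` S) = \<bar>det (matrix f)\<bar> * measure lebesgue S"
      unfolding that(3) by (simp only:)
  qed
  have "P f"
  proof (rule induct_linear_elementary[OF assms(1)])
    fix f g :: "real^'n \<Rightarrow> real^'n" assume fg: "linear f" "linear g" "P f" "P g"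
    show "P (f \<circ> g)" unfolding P_def
    proof
      fix S :: "(real^'n) set" assume "S \<in> lmeasurable"
      then have gS: "g ` S \<in> lmeasurable" "measure lebesgue (g ` S) = \<bar>det (matrix g)\<bar> * measure lebesgue S"
        using fg(4) unfolding P_def by blast+
      then have fS: "f ` g ` S \<in> lmeasurable" "measure lebesgue (f ` g ` S) = \<bar>det (matrix f)\<bar> * measure lebesgue (g ` S)"
        using fg(3) unfolding P_def by blast+
      show "(f \<circ> g) ` S \<in> lmeasurable \<and>
          measure lebesgue ((f \<circ> g) ` S) = \<bar>det (matrix (f \<circ> g))\<bar> * measure lebesgue S"
        unfolding image_comp[symmetric] matrix_compose[OF fg(2,1)] det_mul abs_mult mult.assoc gS(2)[symmetric]
        using fS by (rule conjI)
    qed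
  next
    fix f :: "real^'n \<Rightarrow> real^'n" and i assume f: "linear f" "\<And>x. f x $ i = 0"
    have "\<not> surj f"
    proof
      assume "surj f"
      then obtain x where "f x = axis i 1" by (metis surjD)
      then show False using f(2)[of x] by simp
    qed
    then have ni: "\<not> inj f" using linear_injective_imp_surjective[OF f(1)] by blast
    then have "det (matrix f) = 0" using det_nz_iff_inj[OF f(1)] by blast
    moreover have "negligible (f ` S)" for S
      by (rule negligible_linear_singular_image[OF f(1) ni])
    ultimately show "P f" unfolding P_def
      by (simp add: negligible_iff_measure)
  next
    fix c :: "'n \<Rightarrow> real"
    have "det (matrix (\<lambda>x. \<chi> i. c i * x $ i)) = prod c UNIV"
      by (subst det_diagonal) (simp_all add: matrix_def axis_def)
    then show "P (\<lambda>x. \<chi> i. c i * x $ i)"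
      unfolding P_def by (simp add: measurable_stretch measure_stretch)
  next
    fix m n :: 'n assume "m \<noteq> n"
    let ?h = "\<lambda>x::real^'n. \<chi> i. x $ Transposition.transpose m n i"
    have lin: "linear ?h" by (rule linearI) (simp_all add: vec_eq_iff)
    show "P ?h"
    proof (rule sufficient[OF lin])
      show "\<bar>det (matrix ?h)\<bar> = 1"
        by (rule abs_det_involution[OF lin]) (simp add: vec_eq_iff)
      fix a b :: "real^'n"
      have im: "?h ` cbox a b = cbox (?h a) (?h b)"
      proof (intro equalityI subsetI)
        fix y assume "y \<in> cbox (?h a) (?h b)"
        then have y: "a $ Transposition.transpose m n i \<le> y $ i \<and> y $ i \<le> b $ Transposition.transpose m n i" for i
          by (simp add: mem_box_cart)
        have "?h y \<in> cbox a b" unfolding mem_box_cart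
          using y[of "Transposition.transpose m n i" for i] by simp
        moreover have "y = ?h (?h y)" by (simp add: vec_eq_iff)
        ultimately show "y \<in> ?h ` cbox a b" by (rule image_eqI[rotated])
      qed (auto simp: mem_box_cart)
      show "measure lebesgue (?h ` cbox a b) = measure lebesgue (cbox a b)"
      proof (cases "cbox a b = {}")
        case False
        then have "cbox (?h a) (?h b) \<noteq> {}" unfolding im[symmetric] by blast
        then have "measure lebesgue (cbox (?h a) (?h b)) = (\<Prod>i\<in>UNIV. b $ Transposition.transpose m n i - a $ Transposition.transpose m n i)"
          by (simp add: content_cbox_cart)
        also have "\<dots> = (\<Prod>i\<in>UNIV. b $ i - a $ i)"
          by (rule prod.reindex_bij_betw[OF permutes_bij[OF permutes_swap_id[OF UNIV_I UNIV_I]]])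
        finally show ?thesis unfolding im using False by (simp add: content_cbox_cart)
      qed simp
    qed
  next
    fix m n :: 'n assume mn: "m \<noteq> n"
    show "P (\<lambda>x::real^'n. \<chi> i. if i = m then x $ m + x $ n else x $ i)"
    proof (rule sufficient)
      show "linear (\<lambda>x::real^'n. \<chi> i. if i = m then x $ m + x $ n else x $ i)"
        by (rule linearI) (auto simp: algebra_simps vec_eq_iff)
    qed (simp_all only: measure_transvection_cbox[OF mn] det_transvection[OF mn] abs_one)
  qed
  then show "f ` S \<in> lmeasurable" "measure lebesgue (f ` S) = \<bar>det (matrix f)\<bar> * measure lebesgue S"
    using assms(2) unfolding P_def by blast+
qed

subsection \<open>Prisms\<close>

lemma prism_eq: "prism F n = (\<lambda>(y, t). y + t *\<^sub>R n) ` (F \<times> {0..1})"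
  by (auto simp: prism_def image_iff) metis+

lemma compact_prism: "compact F \<Longrightarrow> compact (prism F n)"
  unfolding prism_eq split_def
  by (intro compact_continuous_image continuous_intros compact_Times compact_Icc)

text \<open>The linear map \<open>x \<mapsto> x + (n \<bullet> x) (u - n)\<close> translates every hyperplane orthogonal to the unit
  vector \<open>n\<close> within itself and maps \<open>n\<close> to \<open>u\<close>.\<close>

lemma measure_prism_change_direction:
  fixes n u :: "real^'n"
  assumes n: "n \<bullet> n = 1" and u: "n \<bullet> u \<noteq> 0"
  obtains D where "D > 0" "\<And>F \<beta>. compact F \<Longrightarrow> (\<And>y. y \<in> F \<Longrightarrow> n \<bullet> y = \<beta>) \<Longrightarrow>
     measure lebesgue (prism F u) = D * measure lebesgue (prism F n)"
proof -
  define f where "f x = x + (n \<bullet> x) *\<^sub>R (u - n)" for x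
  have lin: "linear f"
    by (rule linearI) (simp_all add: f_def inner_add_right scaleR_add_left scaleR_add_right)
  have "inj f"
  proof (rule linear_injective_0[OF lin, THEN iffD2], intro allI impI)
    fix x assume fx: "f x = 0"
    have "0 = n \<bullet> f x" by (simp add: fx)
    also have "\<dots> = (n \<bullet> x) * (n \<bullet> u)"
      by (simp add: f_def inner_add_right inner_diff_right n algebra_simps)
    finally have "n \<bullet> x = 0" using u by simp
    then show "x = 0" using fx by (simp add: f_def)
  qed
  then have D: "\<bar>det (matrix f)\<bar> > 0" using det_nz_iff_inj[OF lin] by simp
  have "measure lebesgue (prism F u) = \<bar>det (matrix f)\<bar> * measure lebesgue (prism F n)"
    if F: "compact F" and \<beta>: "\<And>y. y \<in> F \<Longrightarrow> n \<bullet> y = \<beta>" for F \<beta>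
  proof -
    have "f (y + t *\<^sub>R n) = \<beta> *\<^sub>R (u - n) + (y + t *\<^sub>R u)" if "y \<in> F" for y t
      using \<beta>[OF that] by (simp add: f_def inner_add_right n algebra_simps)
    then have "f ` prism F n = (+) (\<beta> *\<^sub>R (u - n)) ` prism F u"
      unfolding prism_eq image_image by (intro image_cong refl) auto
    then have "measure lebesgue (prism F u) = measure lebesgue (f ` prism F n)"
      by (simp only: measure_translation)
    also have "\<dots> = \<bar>det (matrix f)\<bar> * measure lebesgue (prism F n)"
      by (intro measure_linear_image_det lin lmeasurable_compact compact_prism F)
    finally show ?thesis .
  qed
  then show thesis by (rule that[OF D])
qed

subsection \<open>Lattice bases\<close>

definition int_vec :: "real^'n \<Rightarrow> bool" where
  "int_vec y \<longleftrightarrow> (\<forall>i. y $ i \<in> \<int>)"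

lemma int_vec_add: "int_vec x \<Longrightarrow> int_vec y \<Longrightarrow> int_vec (x + y)"
  and int_vec_diff: "int_vec x \<Longrightarrow> int_vec y \<Longrightarrow> int_vec (x - y)"
  and int_vec_scale: "int_vec x \<Longrightarrow> int_vec (of_int k *\<^sub>R x)"
  and int_vec_axis: "int_vec (axis j 1)"
  by (simp_all add: int_vec_def axis_def)

text \<open>The least positive element divides every other by division with remainder;
  \<open>g = 0\<close> covers the trivial subgroup.\<close>

lemma int_subgroup_generator:
  fixes T :: "int set"
  assumes add: "\<And>x y. x \<in> T \<Longrightarrow> y \<in> T \<Longrightarrow> x + y \<in> T" and neg: "\<And>x. x \<in> T \<Longrightarrow> - x \<in> T"
    and zero: "0 \<in> T"
  obtains g where "g \<in> T" "\<And>x. x \<in> T \<Longrightarrow> g dvd x"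
proof (cases "T = {0}")
  case False
  then obtain x where x: "x \<in> T" "x \<noteq> 0" using zero by blast
  have "\<exists>n::nat. n > 0 \<and> int n \<in> T"
    using x neg[OF x(1)] by (intro exI[of _ "nat \<bar>x\<bar>"]) (auto simp: abs_if)
  then have L: "(LEAST n. n > 0 \<and> int n \<in> T) > 0 \<and> int (LEAST n. n > 0 \<and> int n \<in> T) \<in> T"
    by (rule LeastI_ex)
  define n where "n = (LEAST n. n > 0 \<and> int n \<in> T)"
  have n: "n > 0" "int n \<in> T" using L by (simp_all add: n_def)
  have mult: "k * y \<in> T" if "y \<in> T" for k y
  proof (induction k rule: int_induct[where k = 0])
    case (step1 i)
    then show ?case using add[OF _ that] by (simp add: distrib_right)
  next
    case (step2 i)
    then show ?case using add[OF _ neg[OF that]] by (simp add: left_diff_distrib)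
  qed (simp add: zero)
  have "int n dvd y" if y: "y \<in> T" for y
  proof (rule ccontr)
    assume "\<not> int n dvd y"
    then have "y mod int n \<noteq> 0" by (simp add: dvd_eq_mod_eq_0)
    moreover have "y mod int n \<ge> 0" "y mod int n < int n" using n(1) by simp_all
    ultimately have r: "y mod int n > 0" "y mod int n < int n" by linarith+
    have "y mod int n = y + (- (y div int n)) * int n"
      using minus_div_mult_eq_mod[of y "int n"] by simp
    also have "\<dots> \<in> T" by (intro add y mult n)
    finally have "nat (y mod int n) > 0 \<and> int (nat (y mod int n)) \<in> T" using r by simp
    then have "n \<le> nat (y mod int n)" unfolding n_def by (rule Least_le)
    then show False using r by linarith
  qed
  then show thesis using that n(2) by blast
qed (use that in auto)

text \<open>Induction on the coordinates that may be nonzero. The i-th coordinates of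
  \<open>G\<close> are the multiples of some \<open>g\<close>; an element \<open>w\<close> with i-th
  coordinate \<open>g\<close> completes a basis of the kernel \<open>H\<close> of that coordinate,
  unless g = 0 and G = H.\<close>

lemma subgroup_basis:
  fixes G :: "(real^'n) set"
  assumes "finite I"
    and add: "\<And>x y. x \<in> G \<Longrightarrow> y \<in> G \<Longrightarrow> x + y \<in> G"
    and scale: "\<And>x k. x \<in> G \<Longrightarrow> of_int k *\<^sub>R x \<in> G" and zero: "0 \<in> G"
    and int: "\<And>x. x \<in> G \<Longrightarrow> int_vec x" and supp: "\<And>x i. x \<in> G \<Longrightarrow> i \<notin> I \<Longrightarrow> x $ i = 0"
  shows "\<exists>V. finite V \<and> independent V \<and> G = {\<Sum>v\<in>V. of_int (a v) *\<^sub>R v | a :: real^'n \<Rightarrow> int. True}"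
  using assms
proof (induction I arbitrary: G rule: finite_induct)
  case empty
  then have "G = {0}" by (auto simp: vec_eq_iff)
  then show ?case by (intro exI[of _ "{}"]) (simp add: independent_empty)
next
  case (insert i I)
  note add = insert.prems(1) and scale = insert.prems(2) and zero = insert.prems(3)
    and int = insert.prems(4) and supp = insert.prems(5)
  define H where "H = {x \<in> G. x $ i = 0}"
  have "\<exists>V. finite V \<and> independent V \<and> H = {\<Sum>v\<in>V. of_int (a v) *\<^sub>R v | a :: real^'n \<Rightarrow> int. True}"
  proof (rule insert.IH)
    show "x $ j = 0" if "x \<in> H" "j \<notin> I" for x j
      using that supp[of x j] by (cases "j = i") (auto simp: H_def)
  qed (use add scale zero int in \<open>auto simp: H_def\<close>)
  then obtain V where V: "finite V" "independent V"
    and HV: "H = {\<Sum>v\<in>V. of_int (a v) *\<^sub>R v | a :: real^'n \<Rightarrow> int. True}" by blast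
  define T where "T = {k. \<exists>x\<in>G. x $ i = of_int k}"
  have Tadd: "x + y \<in> T" if xy: "x \<in> T" "y \<in> T" for x y
  proof -
    obtain u v where "u \<in> G" "u $ i = of_int x" "v \<in> G" "v $ i = of_int y"
      using xy by (auto simp: T_def)
    then show ?thesis unfolding T_def by (intro CollectI bexI[of _ "u + v"]) (auto intro: add)
  qed
  have Tneg: "- x \<in> T" if x: "x \<in> T" for x
  proof -
    obtain u where "u \<in> G" "u $ i = of_int x" using x by (auto simp: T_def)
    then show ?thesis unfolding T_def using scale[of u "-1"] by (intro CollectI bexI[of _ "- u"]) auto
  qed
  have T0: "0 \<in> T" unfolding T_def using zero by (intro CollectI bexI[of _ 0]) simp_all
  have "\<exists>g. g \<in> T \<and> (\<forall>k\<in>T. g dvd k)"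
  proof (rule int_subgroup_generator[of T])
    show "\<exists>g. g \<in> T \<and> (\<forall>k\<in>T. g dvd k)" if "g \<in> T" "\<And>k. k \<in> T \<Longrightarrow> g dvd k" for g
      using that by blast
  qed (fact Tadd Tneg T0)+
  then obtain g where g: "g \<in> T" "\<And>k. k \<in> T \<Longrightarrow> g dvd k" by blast
  from g(1) obtain w where w: "w \<in> G" "w $ i = of_int g" by (auto simp: T_def)
  have decomp: "\<exists>k. x - of_int k *\<^sub>R w \<in> H" if x: "x \<in> G" for x
  proof -
    have "x $ i \<in> \<int>" using int[OF x] by (simp add: int_vec_def)
    then obtain k where k: "x $ i = of_int k" by (auto elim: Ints_cases)
    then have "g dvd k" using x by (intro g(2)) (auto simp: T_def)
    then obtain l where "k = g * l" by blast
    moreover have "x + of_int (- l) *\<^sub>R w \<in> G" by (intro add scale x w)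
    ultimately show ?thesis using k w by (intro exI[of _ l]) (auto simp: H_def)
  qed
  have HG: "H \<subseteq> G" by (auto simp: H_def)
  show ?case
  proof (cases "g = 0")
    case True
    have "G \<subseteq> H"
    proof
      fix x assume x: "x \<in> G"
      then obtain k where "x - of_int k *\<^sub>R w \<in> H" using decomp by blast
      then show "x \<in> H" using w True x by (simp add: H_def)
    qed
    then have "G = H" using HG by blast
    then show ?thesis using V HV by blast
  next
    case False
    have VH: "V \<subseteq> H"
    proof
      fix u assume u: "u \<in> V"
      have "(\<Sum>v\<in>V. of_int (if v = u then 1 else 0) *\<^sub>R v) = u"
        using V(1) u by (simp add: if_distrib[of of_int] if_distrib[of "\<lambda>c. c *\<^sub>R _"] cong: if_cong)
      then show "u \<in> H" unfolding HV by (intro CollectI exI[of _ "\<lambda>v. if v = u then 1 else 0"]) simp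
    qed
    have "span V \<subseteq> {x. x $ i = 0}"
      by (rule span_minimal) (use VH in \<open>auto simp: H_def subspace_def\<close>)
    then have wV: "w \<notin> span V" using w False by auto
    then have wn: "w \<notin> V" using span_base by blast
    have "G = {\<Sum>v\<in>insert w V. of_int (a v) *\<^sub>R v | a :: real^'n \<Rightarrow> int. True}"
    proof (intro equalityI subsetI)
      fix x assume "x \<in> G"
      then obtain k where "x - of_int k *\<^sub>R w \<in> H" using decomp by blast
      then obtain a :: "real^'n \<Rightarrow> int" where a: "x - of_int k *\<^sub>R w = (\<Sum>v\<in>V. of_int (a v) *\<^sub>R v)" unfolding HV by blast
      have "(\<Sum>v\<in>V. of_int ((a(w := k)) v) *\<^sub>R v) = (\<Sum>v\<in>V. of_int (a v) *\<^sub>R v)"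
        using wn by (intro sum.cong) auto
      then have "x = (\<Sum>v\<in>insert w V. of_int ((a(w := k)) v) *\<^sub>R v)"
        using V(1) wn a by (simp add: algebra_simps)
      then show "x \<in> {\<Sum>v\<in>insert w V. of_int (a v) *\<^sub>R v | a :: real^'n \<Rightarrow> int. True}" by blast
    next
      fix x assume "x \<in> {\<Sum>v\<in>insert w V. of_int (a v) *\<^sub>R v | a :: real^'n \<Rightarrow> int. True}"
      then obtain a :: "real^'n \<Rightarrow> int" where x: "x = (\<Sum>v\<in>insert w V. of_int (a v) *\<^sub>R v)" by blast
      have "(\<Sum>v\<in>V. of_int (a v) *\<^sub>R v) \<in> G" using HV HG by blast
      then show "x \<in> G" unfolding x using V(1) wn by (simp add: add scale w(1))
    qed
    moreover have "independent (insert w V)" using V(2) wV by (simp add: independent_insert)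
    ultimately show ?thesis using V(1) by blast
  qed
qed

text \<open>Ensures that the choice \<open>SOME V. lattice_basis L V\<close> in
  \<open>facet_volume\<close> selects a basis.\<close>

lemma lattice_basis_exists:
  fixes L :: "(real^'n) set"
  assumes "subspace L"
  shows "\<exists>V. lattice_basis L V"
proof -
  have "\<exists>V. finite V \<and> independent V \<and>
      {y \<in> L. int_vec y} = {\<Sum>v\<in>V. of_int (a v) *\<^sub>R v | a :: real^'n \<Rightarrow> int. True}"
    by (rule subgroup_basis[of UNIV])
       (use assms in \<open>auto simp: subspace_add subspace_scale subspace_0 int_vec_add int_vec_scale,
          auto simp: int_vec_def\<close>)
  then show ?thesis unfolding lattice_basis_def int_vec_def by blast
qed

lemma det_int_matrix:
  fixes M :: "real^'n^'n"
  assumes "\<And>i j. M $ i $ j \<in> \<int>"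
  shows "det M \<in> \<int>"
  unfolding det_def by (intro Ints_sum Ints_mult Ints_prod Ints_of_int assms)

lemma abs_det_unimodular:
  fixes M N :: "real^'n^'n"
  assumes "\<And>i j. M $ i $ j \<in> \<int>" "\<And>i j. N $ i $ j \<in> \<int>" "N ** M = mat 1"
  shows "\<bar>det M\<bar> = 1"
proof -
  obtain m n where mn: "det M = of_int m" "det N = of_int n"
    using det_int_matrix[OF assms(1)] det_int_matrix[OF assms(2)] by (auto elim!: Ints_cases)
  have "det N * det M = 1" using arg_cong[OF assms(3), of det] by (simp add: det_mul)
  then have "of_int (n * m) = (1::real)" by (simp add: mn)
  then have "n * m = 1" by linarith
  then have "\<bar>m\<bar> = 1" by (auto simp: zmult_eq_1_iff)
  then show ?thesis by (simp add: mn flip: of_int_abs)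
qed

text \<open>A lattice basis of the hyperplane orthogonal to a primitive vector \<open>c\<close>, together with an integer
  vector \<open>w\<close> satisfying \<open>c \<bullet> w = 1\<close>, is a basis of the integer lattice; replacing \<open>w\<close> by a unit
  vector multiplies the determinant by the coordinate of \<open>c\<close>.\<close>

lemma measure_prism_fundamental_cell:
  fixes c w :: "real^'n"
  assumes V: "lattice_basis {y. c \<bullet> y = 0} V"
    and c: "int_vec c" and w: "int_vec w" "c \<bullet> w = 1"
  shows "compact (fundamental_cell V)"
    and "measure lebesgue (prism (fundamental_cell V) (axis j 1)) = \<bar>c $ j\<bar>"
proof -
  have iV: "independent V"
    and LV: "{y. c \<bullet> y = 0 \<and> int_vec y} = {\<Sum>v\<in>V. of_int (a v) *\<^sub>R v | a :: real^'n \<Rightarrow> int. True}"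
    using V by (auto simp: lattice_basis_def int_vec_def)
  have fV: "finite V" by (rule independent_imp_finite[OF iV])
  have VL: "c \<bullet> u = 0 \<and> int_vec u" if u: "u \<in> V" for u
  proof -
    have "(\<Sum>v\<in>V. of_int (if v = u then 1 else 0) *\<^sub>R v) = u"
      using fV u by (simp add: if_distrib[of of_int] if_distrib[of "\<lambda>c. c *\<^sub>R _"] cong: if_cong)
    then have "u \<in> {\<Sum>v\<in>V. of_int (a v) *\<^sub>R v | a :: real^'n \<Rightarrow> int. True}"
      by (intro CollectI exI[of _ "\<lambda>v. if v = u then 1 else 0"]) simp
    then show ?thesis unfolding LV[symmetric] by simp
  qed
  have "span V \<subseteq> {x. c \<bullet> x = 0}"
    by (rule span_minimal) (use VL in \<open>auto simp: subspace_def inner_add_right\<close>)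
  then have wV: "w \<notin> span V" using w by auto
  then have wn: "w \<notin> V" using span_base by blast
  have ind: "independent (insert w V)" using iV wV by (simp add: independent_insert)
  have cint: "\<exists>k. c \<bullet> y = of_int k" if "int_vec y" for y
  proof -
    have "c \<bullet> y \<in> \<int>" using c that unfolding inner_vec_def int_vec_def
      by (intro Ints_sum) (auto intro: Ints_mult)
    then show ?thesis by (auto elim: Ints_cases)
  qed
  have decomp: "\<exists>a :: real^'n \<Rightarrow> int. y = (c \<bullet> y) *\<^sub>R w + (\<Sum>v\<in>V. of_int (a v) *\<^sub>R v)" if y: "int_vec y" for y
  proof -
    obtain k where k: "c \<bullet> y = of_int k" using cint[OF y] by blast
    have "y - of_int k *\<^sub>R w \<in> {y. c \<bullet> y = 0 \<and> int_vec y}"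
      using y w k by (auto simp: inner_diff_right int_vec_diff int_vec_scale)
    then obtain a :: "real^'n \<Rightarrow> int" where "y - of_int k *\<^sub>R w = (\<Sum>v\<in>V. of_int (a v) *\<^sub>R v)" unfolding LV by blast
    then show ?thesis using k by (intro exI[of _ a]) (simp add: algebra_simps)
  qed
  have "axis i 1 \<in> span (insert w V)" for i
  proof -
    obtain a :: "real^'n \<Rightarrow> int" where a: "axis i 1 = (c \<bullet> axis i 1) *\<^sub>R w + (\<Sum>v\<in>V. of_int (a v) *\<^sub>R v)"
      using decomp[OF int_vec_axis] by blast
    show ?thesis
      by (subst a) (intro span_add span_sum span_scale span_base, auto)
  qed
  then have "Basis \<subseteq> span (insert w V)" by (auto simp: Basis_vec_def)
  then have "span (insert w V) = UNIV" by (metis span_Basis span_minimal subspace_span top.extremum_uniqueI)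
  then have "card (insert w V) = CARD('n)"
    using ind by (metis DIM_cart DIM_real dim_UNIV dim_eq_card dim_span_eq_card_independent mult.right_neutral span_UNIV)
  then obtain g where g: "bij_betw g (UNIV :: 'n set) (insert w V)"
    using finite_same_card_bij[of "UNIV :: 'n set" "insert w V"] fV by auto
  then obtain i0 where i0: "g i0 = w" by (metis UNIV_I bij_betw_imp_surj_on image_iff insertI1)
  have gV: "bij_betw g (UNIV - {i0}) V"
  proof -
    have "bij_betw g (UNIV - {i0}) (insert w V - {g i0})"
      using g by (rule bij_betw_DiffI) (auto simp: i0 bij_betw_def)
    then show ?thesis using wn i0 by simp
  qed
  define M where "M u = (\<chi> k. if k = i0 then u else g k)" for u
  have rowM: "row k (M u) = (if k = i0 then u else g k)" for k u
    by (simp add: row_def M_def vec_eq_iff)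
  have sumM: "(\<Sum>k\<in>UNIV. x k *\<^sub>R row k (M u)) = x i0 *\<^sub>R u + (\<Sum>k\<in>UNIV - {i0}. x k *\<^sub>R g k)" for x u
    by (subst sum.remove[of _ i0]) (auto simp: rowM)
  have unim: "\<bar>det (M w)\<bar> = 1"
  proof -
    have "\<exists>a. \<forall>k. axis k 1 = (c \<bullet> axis k 1) *\<^sub>R w + (\<Sum>v\<in>V. of_int (a k v) *\<^sub>R v)"
      using decomp[OF int_vec_axis] by (intro choice allI)
    then obtain a :: "'n \<Rightarrow> real^'n \<Rightarrow> int"
      where a: "\<And>k. axis k 1 = (c \<bullet> axis k 1) *\<^sub>R w + (\<Sum>v\<in>V. of_int (a k v) *\<^sub>R v)" by blast
    \<comment> \<open>The coordinates of the unit vectors in the basis \<open>insert w V\<close>,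
      integral by \<open>decomp\<close>; so \<open>M w\<close> has an integral inverse.\<close>
    define N where "N = (\<chi> k i. if i = i0 then c $ k else of_int (a k (g i)))"
    have "N ** M w = mat 1"
    proof -
      have "(N ** M w) $ k = mat 1 $ k" for k
      proof -
        have "(N ** M w) $ k = (\<Sum>i\<in>UNIV. N $ k $ i *\<^sub>R row i (M w))"
          by (simp add: vec_eq_iff matrix_matrix_mult_def row_def)
        also have "\<dots> = c $ k *\<^sub>R w + (\<Sum>i\<in>UNIV - {i0}. of_int (a k (g i)) *\<^sub>R g i)"
          unfolding sumM by (simp add: N_def)
        also have "(\<Sum>i\<in>UNIV - {i0}. of_int (a k (g i)) *\<^sub>R g i) = (\<Sum>v\<in>V. of_int (a k v) *\<^sub>R v)"
          by (rule sum.reindex_bij_betw[OF gV])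
        finally have "(N ** M w) $ k = axis k 1" by (subst a) (simp add: inner_axis)
        then show ?thesis by (simp add: vec_eq_iff mat_def axis_def eq_commute)
      qed
      then show ?thesis by (simp add: vec_eq_iff)
    qed
    moreover have "M w $ i $ j \<in> \<int>" for i j
    proof -
      have "int_vec (g i)" using g VL w by (metis bij_betwE UNIV_I insertE)
      then show ?thesis using w by (simp add: M_def int_vec_def)
    qed
    moreover have "N $ i $ j \<in> \<int>" for i j using c by (simp add: N_def int_vec_def)
    ultimately show ?thesis by (intro abs_det_unimodular)
  qed
  have det_axis: "\<bar>det (M (axis j 1))\<bar> = \<bar>c $ j\<bar>"
  proof -
    obtain a :: "real^'n \<Rightarrow> int" where a: "axis j 1 = (c \<bullet> axis j 1) *\<^sub>R w + (\<Sum>v\<in>V. of_int (a v) *\<^sub>R v)"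
      using decomp[OF int_vec_axis] by blast
    let ?l = "\<Sum>v\<in>V. of_int (a v) *\<^sub>R v"
    let ?A = "M (c $ j *s w)"
    have "{row k ?A |k. k \<noteq> i0} = V"
      using gV by (auto simp: rowM bij_betw_def image_iff)
    then have "?l \<in> vec.span {row k ?A |k. k \<noteq> i0}"
      unfolding span_vec_eq by (simp add: span_sum span_scale span_base)
    from det_row_span[OF this]
    have "det (\<chi> k. if k = i0 then row i0 ?A + ?l else row k ?A) = det ?A" .
    moreover have "(\<chi> k. if k = i0 then row i0 ?A + ?l else row k ?A) = M (axis j 1)"
    proof -
      have "row i0 ?A + ?l = axis j 1"
        by (subst a) (simp add: rowM inner_axis scalar_mult_eq_scaleR)
      then show ?thesis
        unfolding M_def[of "axis j 1"] by (intro arg_cong[of _ _ vec_lambda] ext) (simp add: rowM)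
    qed
    moreover have "det ?A = c $ j * det (M w)"
      unfolding M_def by (rule det_row_mul)
    ultimately show ?thesis using unim by (simp add: abs_mult)
  qed
  \<comment> \<open>Combining the rows of \<open>M u\<close> maps the unit cube onto the prism over
    the cell with edge \<open>u\<close>, so the measure is a determinant.\<close>
  define E where "E u x = (\<Sum>k\<in>UNIV. x $ k *\<^sub>R row k (M u))" for u and x :: "real^'n"
  have linE: "linear (E u)" for u
    unfolding E_def by (rule linearI) (simp_all add: sum.distrib scaleR_add_left scaleR_sum_right)
  have matE: "matrix (E u) = transpose (M u)" for u
    by (simp add: E_def matrix_def transpose_def vec_eq_iff row_def axis_def if_distrib[of "\<lambda>c. c * _"] cong: if_cong)
  have cell: "fundamental_cell V = (\<lambda>x. \<Sum>k\<in>UNIV - {i0}. x $ k *\<^sub>R g k) ` cbox 0 1"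
  proof (intro equalityI subsetI)
    fix y assume "y \<in> fundamental_cell V"
    then obtain t where t: "\<forall>v\<in>V. 0 \<le> t v \<and> t v \<le> 1" and y: "y = (\<Sum>v\<in>V. t v *\<^sub>R v)"
      by (auto simp: fundamental_cell_def)
    let ?x = "\<chi> k. if k = i0 then 0 else t (g k)"
    have gk: "g k \<in> V" if "k \<noteq> i0" for k using gV that by (auto simp: bij_betw_def)
    have "y = (\<Sum>k\<in>UNIV - {i0}. t (g k) *\<^sub>R g k)"
      unfolding y by (rule sum.reindex_bij_betw[OF gV, symmetric])
    also have "\<dots> = (\<Sum>k\<in>UNIV - {i0}. ?x $ k *\<^sub>R g k)" by (rule sum.cong) auto
    finally have "y = (\<Sum>k\<in>UNIV - {i0}. ?x $ k *\<^sub>R g k)" .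
    moreover have "?x \<in> cbox 0 1" using t gk by (auto simp: mem_box_cart)
    ultimately show "y \<in> (\<lambda>x. \<Sum>k\<in>UNIV - {i0}. x $ k *\<^sub>R g k) ` cbox 0 1" by (rule image_eqI)
  next
    fix y assume "y \<in> (\<lambda>x. \<Sum>k\<in>UNIV - {i0}. x $ k *\<^sub>R g k) ` cbox 0 1"
    then obtain x where x: "x \<in> cbox 0 1" and y: "y = (\<Sum>k\<in>UNIV - {i0}. x $ k *\<^sub>R g k)" by blast
    let ?t = "\<lambda>v. x $ the_inv_into (UNIV - {i0}) g v"
    have "y = (\<Sum>k\<in>UNIV - {i0}. ?t (g k) *\<^sub>R g k)"
      unfolding y using gV by (intro sum.cong refl) (simp add: bij_betw_def the_inv_into_f_f)
    also have "\<dots> = (\<Sum>v\<in>V. ?t v *\<^sub>R v)" by (rule sum.reindex_bij_betw[OF gV])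
    finally show "y \<in> fundamental_cell V"
      using x unfolding fundamental_cell_def by (intro CollectI exI[of _ ?t]) (auto simp: mem_box_cart)
  qed
  show "compact (fundamental_cell V)"
    unfolding cell by (intro compact_continuous_image continuous_intros compact_cbox)
  have prism: "prism (fundamental_cell V) u = E u ` cbox 0 1" for u
  proof (intro equalityI subsetI)
    fix z assume "z \<in> prism (fundamental_cell V) u"
    then obtain x t where x: "x \<in> cbox 0 1" and t: "0 \<le> t" "t \<le> 1"
      and z: "z = (\<Sum>k\<in>UNIV - {i0}. x $ k *\<^sub>R g k) + t *\<^sub>R u"
      unfolding prism_def cell by blast
    let ?x = "\<chi> k. if k = i0 then t else x $ k"
    have "(\<Sum>k\<in>UNIV - {i0}. ?x $ k *\<^sub>R g k) = (\<Sum>k\<in>UNIV - {i0}. x $ k *\<^sub>R g k)"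
      by (intro sum.cong) auto
    then have "z = E u ?x" unfolding E_def sumM z by simp
    moreover have "?x \<in> cbox 0 1" using x t by (auto simp: mem_box_cart)
    ultimately show "z \<in> E u ` cbox 0 1" by (rule image_eqI)
  next
    fix z assume "z \<in> E u ` cbox 0 1"
    then obtain x where x: "x \<in> cbox 0 1" and z: "z = E u x" by blast
    have "0 \<le> x $ i0" "x $ i0 \<le> 1" using x by (auto simp: mem_box_cart)
    then show "z \<in> prism (fundamental_cell V) u"
      unfolding prism_def cell z E_def sumM using x
      by (intro CollectI exI[of _ "\<Sum>k\<in>UNIV - {i0}. x $ k *\<^sub>R g k"] exI[of _ "x $ i0"]) auto
  qed
  have "measure lebesgue (cbox 0 (1::real^'n)) = 1"
    using content_cbox_cart[of 0 "1::real^'n"] by (simp add: interval_ne_empty_cart)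
  then show "measure lebesgue (prism (fundamental_cell V) (axis j 1)) = \<bar>c $ j\<bar>"
    unfolding prism by (simp add: measure_linear_image_det[OF linE] matE det_transpose det_axis)
qed

subsection \<open>Facet volumes\<close>

text \<open>Replacing the unit normal by \<open>axis j 1\<close> scales the prisms over
  \<open>F\<close> and over the fundamental cell by the same factor, which cancels; the cell then
  contributes \<open>\<bar>c $ j\<bar>\<close>. The value is therefore independent of the normal and
  the lattice basis that were chosen.\<close>

lemma facet_volume_eq:
  fixes c w :: "real^'n"
  assumes c: "int_vec c" and w: "int_vec w" "c \<bullet> w = 1" and j: "c $ j \<noteq> 0"
    and dir: "direction_space F = {y. c \<bullet> y = 0}" and F: "compact F" and \<beta>: "\<And>y. y \<in> F \<Longrightarrow> c \<bullet> y = \<beta>"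
  shows "facet_volume F = measure lebesgue (prism F (axis j 1)) / \<bar>c $ j\<bar>"
proof -
  let ?L = "{y. c \<bullet> y = 0}"
  define V where "V = (SOME V. lattice_basis ?L V)"
  have "subspace ?L" by (auto simp: subspace_def inner_add_right)
  from lattice_basis_exists[OF this] have V: "lattice_basis ?L V"
    unfolding V_def by (rule someI_ex)
  define n where "n = (SOME n. norm n = 1 \<and> (\<forall>v\<in>?L. n \<bullet> v = 0))"
  have c0: "c \<noteq> 0" using j by auto
  have "norm n = 1 \<and> (\<forall>v\<in>?L. n \<bullet> v = 0)"
    unfolding n_def by (rule someI[of _ "c /\<^sub>R norm c"]) (use c0 in auto)
  then have nn: "n \<bullet> n = 1" and nL: "\<And>v. c \<bullet> v = 0 \<Longrightarrow> n \<bullet> v = 0"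
    by (auto simp: norm_eq_1)
  \<comment> \<open>\<open>n\<close> is proportional to \<open>c\<close>: it kills
    \<open>y - (c \<bullet> y) *\<^sub>R w\<close>, which lies in the hyperplane.\<close>
  have ny: "n \<bullet> y = (c \<bullet> y) * (n \<bullet> w)" for y
    using nL[of "y - (c \<bullet> y) *\<^sub>R w"] w(2) by (simp add: inner_diff_right)
  have nw: "n \<bullet> w \<noteq> 0" using nn ny[of n] by auto
  have na: "n \<bullet> axis j 1 \<noteq> 0" using ny[of "axis j 1"] nw j by (simp add: inner_axis)
  obtain D where D: "D > 0" "\<And>F \<beta>. compact F \<Longrightarrow> (\<And>y. y \<in> F \<Longrightarrow> n \<bullet> y = \<beta>) \<Longrightarrow>
     measure lebesgue (prism F (axis j 1)) = D * measure lebesgue (prism F n)"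
    using measure_prism_change_direction[OF nn na] by blast
  have F': "measure lebesgue (prism F (axis j 1)) = D * measure lebesgue (prism F n)"
  proof (rule D(2)[OF F])
    fix y assume "y \<in> F"
    then show "n \<bullet> y = \<beta> * (n \<bullet> w)" using ny[of y] \<beta>[of y] by simp
  qed
  have cell: "compact (fundamental_cell V)" "measure lebesgue (prism (fundamental_cell V) (axis j 1)) = \<bar>c $ j\<bar>"
    using measure_prism_fundamental_cell[OF V c w] by blast+
  have "c \<bullet> v = 0" if v: "v \<in> V" for v
  proof -
    have "finite V" using V independent_imp_finite by (auto simp: lattice_basis_def)
    then have "(\<Sum>u\<in>V. of_int (if u = v then 1 else 0) *\<^sub>R u) = v"
      using v by (simp add: if_distrib[of of_int] if_distrib[of "\<lambda>c. c *\<^sub>R _"] cong: if_cong)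
    then have "v \<in> {\<Sum>u\<in>V. of_int (a u) *\<^sub>R u | a :: real^'n \<Rightarrow> int. True}"
      by (intro CollectI exI[of _ "\<lambda>u. if u = v then 1 else 0"]) simp
    then have "v \<in> {y \<in> ?L. \<forall>i. y $ i \<in> \<int>}" using V unfolding lattice_basis_def by simp
    then show ?thesis by simp
  qed
  then have "n \<bullet> y = 0" if "y \<in> fundamental_cell V" for y
    using that by (auto simp: fundamental_cell_def inner_sum_right nL)
  then have C': "\<bar>c $ j\<bar> = D * measure lebesgue (prism (fundamental_cell V) n)"
    using D(2)[OF cell(1), of 0] cell(2) by simp
  have "facet_volume F = measure lebesgue (prism F n) / measure lebesgue (prism (fundamental_cell V) n)"
    unfolding facet_volume_def Let_def dir hyperplane_volume_def n_def[symmetric] V_def[symmetric] ..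
  then show ?thesis unfolding F' C' using D(1) by simp
qed

subsection \<open>Volume and facets of the simplex\<close>

lemma Basis_vec_eq: "(Basis :: (real^'d) set) = range (\<lambda>i. axis i 1)"
  by (auto simp: Basis_vec_def)

lemma sum_Basis_vec: "(\<Sum>b\<in>Basis. f (b :: real^'d)) = (\<Sum>i\<in>UNIV. f (axis i 1))"
  unfolding Basis_vec_eq by (subst sum.reindex) (auto simp: inj_on_def axis_eq_axis)

lemma sum_Basis_vec_remove:
  "(\<Sum>b\<in>Basis - {axis j 1}. f (b :: real^'d)) = (\<Sum>i\<in>UNIV - {j}. f (axis i 1))"
proof -
  have "(Basis :: (real^'d) set) - {axis j 1} = (\<lambda>i. axis i 1) ` (UNIV - {j})"
    unfolding Basis_vec_eq by (auto simp: axis_eq_axis)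
  then show ?thesis by (simp add: sum.reindex inj_on_def axis_eq_axis)
qed

lemma measure_std_simplex:
  fixes S :: "(real^'d) set"
  defines "S \<equiv> {x. (\<forall>i. 0 \<le> x $ i) \<and> (\<Sum>i\<in>UNIV. x $ i) \<le> 1}"
  shows "S \<in> lmeasurable" "measure lebesgue S = 1 / fact CARD('d)"
proof -
  have S: "S = convex hull (insert 0 Basis)"
  proof -
    have "(\<Sum>b\<in>Basis. x \<bullet> b) = (\<Sum>i\<in>UNIV. x $ i)" for x :: "real^'d"
      by (simp add: sum_Basis_vec inner_axis)
    moreover have "(\<forall>b\<in>Basis. 0 \<le> x \<bullet> b) \<longleftrightarrow> (\<forall>i. 0 \<le> x $ i)" for x :: "real^'d"
      by (auto simp: Basis_vec_eq inner_axis)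
    ultimately show ?thesis
      unfolding std_simplex S_def by (simp only:)
  qed
  have "compact S" unfolding S by (intro finite_imp_compact_convex_hull) simp
  then show "S \<in> lmeasurable" by (rule lmeasurable_compact)
  have "S \<in> sets borel" using \<open>compact S\<close> by (simp add: borel_compact)
  then have "measure lebesgue S = measure lborel S" by (simp add: measure_completion)
  then show "measure lebesgue S = 1 / fact CARD('d)"
    by (simp add: S content_std_simplex)
qed

text \<open>Splitting off coordinate \<open>j\<close> by Fubini leaves the unit interval times a
  standard simplex of dimension d - 1. The latter is measured in the product measure over
  \<open>Basis\<close> without \<open>axis j 1\<close>, since the dimension of
  \<open>real^'d\<close> is fixed by its type.\<close>

lemma measure_std_prism:
  fixes j :: "'d::finite" and S :: "(real^'d) set"
  defines "S \<equiv> {x. (\<forall>i. 0 \<le> x $ i) \<and> x $ j \<le> 1 \<and> (\<Sum>i\<in>UNIV - {j}. x $ i) \<le> 1}"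
  shows "S \<in> lmeasurable" "measure lebesgue S = 1 / fact (CARD('d) - 1)"
proof -
  let ?b = "axis j 1 :: real^'d"
  let ?A = "Basis - {?b}"
  let ?M = "\<lambda>A. Pi\<^sub>M A (\<lambda>_::real^'d. lborel :: real measure)"
  let ?T = "{x. (\<forall>i\<in>?A. 0 \<le> x i) \<and> sum x ?A \<le> (1::real)} \<inter> space (?M ?A)"
  have bB: "?b \<in> Basis" by (simp add: Basis_vec_eq)
  have insB: "insert ?b ?A = Basis" using bB by blast
  have "S = (\<Inter>i. {x. 0 \<le> x $ i}) \<inter> {x. x $ j \<le> 1} \<inter> {x. (\<Sum>i\<in>UNIV - {j}. x $ i) \<le> 1}"
    by (auto simp: S_def)
  also have "closed \<dots>"
    by (intro closed_Int closed_INT ballI closed_Collect_le continuous_intros)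
  finally have cl: "closed S" .
  have "S \<subseteq> cbox 0 1"
  proof
    fix x assume x: "x \<in> S"
    have "x $ i \<le> 1" for i
    proof (cases "i = j")
      case False
      then have "x $ i \<le> (\<Sum>i\<in>UNIV - {j}. x $ i)"
        using x by (intro member_le_sum) (auto simp: S_def)
      then show ?thesis using x by (simp add: S_def)
    qed (use x in \<open>simp add: S_def\<close>)
    then show "x \<in> cbox 0 1" using x by (simp add: mem_box_cart S_def)
  qed
  then have "compact S" using cl bounded_subset[OF bounded_cbox] by (simp add: compact_eq_bounded_closed)
  then show "S \<in> lmeasurable" by (rule lmeasurable_compact)
  have Sb: "S \<in> sets borel" using cl by (rule borel_closed)
  have Tm: "?T \<in> sets (?M ?A)"
  proof -
    have "?T = Pi\<^sub>E ?A (\<lambda>_. {0..}) \<inter> (\<lambda>x. sum x ?A) -` {..1} \<inter> space (?M ?A)"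
      by (auto simp: space_PiM)
    also have "\<dots> \<in> sets (?M ?A)" by measurable
    finally show ?thesis .
  qed
  let ?g = "\<lambda>f. \<Sum>b\<in>Basis. f b *\<^sub>R b"
  have gm: "?g \<in> ?M Basis \<rightarrow>\<^sub>M borel" by measurable
  have g_nth: "?g f $ i = f (axis i 1)" for f i
    by (simp add: sum_Basis_vec axis_def if_distrib[of "\<lambda>c. _ * c"] cong: if_cong)
  have gS: "?g f \<in> S \<longleftrightarrow> (\<forall>i. 0 \<le> f (axis i 1)) \<and> f ?b \<le> 1 \<and> (\<Sum>i\<in>UNIV - {j}. f (axis i 1)) \<le> 1" for f
    unfolding S_def mem_Collect_eq g_nth ..
  interpret product_sigma_finite "\<lambda>_::real^'d. lborel :: real measure" by standard
  have "emeasure lborel S = emeasure (distr (?M Basis) borel ?g) S"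
    by (subst lborel_eq) (rule refl)
  also have "\<dots> = emeasure (?M Basis) (?g -` S \<inter> space (?M Basis))"
    using gm Sb by (rule emeasure_distr)
  also have "\<dots> = (\<integral>\<^sup>+f. indicator (?g -` S \<inter> space (?M Basis)) f \<partial>?M (insert ?b ?A))"
    using measurable_sets[OF gm Sb] unfolding insB by simp
  also have "\<dots> = (\<integral>\<^sup>+y. \<integral>\<^sup>+x. indicator (?g -` S \<inter> space (?M Basis)) (x(?b := y)) \<partial>?M ?A \<partial>lborel)"
  proof (rule product_nn_integral_insert_rev)
    show "indicator (?g -` S \<inter> space (?M Basis)) \<in> borel_measurable (?M (insert ?b ?A))"
      unfolding insB using measurable_sets[OF gm Sb] by (rule borel_measurable_indicator)
  qed simp_all
  also have "\<dots> = (\<integral>\<^sup>+y. \<integral>\<^sup>+x. indicator {0..1::real} y * indicator ?T x \<partial>?M ?A \<partial>lborel)"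
  proof (intro nn_integral_cong)
    fix y :: real and x :: "real^'d \<Rightarrow> real" assume x: "x \<in> space (?M ?A)"
    have sp: "x(?b := y) \<in> space (?M Basis)"
      using x by (subst insB[symmetric]) (auto simp: space_PiM PiE_def extensional_def)
    have "(\<Sum>i\<in>UNIV - {j}. (x(?b := y)) (axis i 1)) = sum x ?A"
      unfolding sum_Basis_vec_remove by (intro sum.cong) (auto simp: axis_eq_axis)
    moreover have "(\<forall>i. 0 \<le> (x(?b := y)) (axis i 1)) \<longleftrightarrow> 0 \<le> y \<and> (\<forall>b\<in>?A. 0 \<le> x b)"
      by (auto simp: Basis_vec_eq axis_eq_axis)
    ultimately have "?g (x(?b := y)) \<in> S \<longleftrightarrow> y \<in> {0..1} \<and> x \<in> ?T"
      unfolding gS using x by auto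
    then show "indicator (?g -` S \<inter> space (?M Basis)) (x(?b := y)) = (indicator {0..1} y * indicator ?T x :: ennreal)"
      using sp by (auto simp: indicator_def)
  qed
  also have "\<dots> = (\<integral>\<^sup>+y. indicator {0..1::real} y * emeasure (?M ?A) ?T \<partial>lborel)"
    using Tm by (simp add: nn_integral_cmult)
  also have "\<dots> = emeasure (?M ?A) ?T"
    by (simp add: nn_integral_multc)
  also have "\<dots> = ennreal (1 ^ card ?A / fact (card ?A))"
    by (rule emeasure_std_simplex_aux) simp_all
  also have "card ?A = CARD('d) - 1"
    using bB by (simp add: card_Diff_singleton)
  finally have "emeasure lborel S = ennreal (1 / fact (CARD('d) - 1))"
    by simp
  then have "measure lborel S = 1 / fact (CARD('d) - 1)" by (simp add: measure_def)
  then show "measure lebesgue S = 1 / fact (CARD('d) - 1)"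
    using Sb by (simp add: measure_completion)
qed

lemma det_coordinate_shear:
  fixes l :: "real^'n"
  assumes "l $ j = 0"
  shows "det (matrix (\<lambda>x. x + (l \<bullet> x) *\<^sub>R axis j 1)) = 1"
proof -
  have l: "l = (\<Sum>i\<in>UNIV - {j}. l $ i *\<^sub>R row i (mat 1))"
  proof -
    have "l = (\<Sum>i\<in>UNIV. l $ i *\<^sub>R row i (mat 1))"
      by (simp add: vec_eq_iff row_def mat_def if_distrib[of "\<lambda>c. _ * c"] cong: if_cong)
    also have "\<dots> = (\<Sum>i\<in>UNIV - {j}. l $ i *\<^sub>R row i (mat 1))"
      using assms by (subst sum.remove[of _ j]) auto
    finally show ?thesis .
  qed
  have "l \<in> vec.span {row i (mat 1) |i. i \<noteq> j}"
    unfolding span_vec_eq by (subst l) (intro span_sum span_scale span_base, auto)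
  from det_row_span[OF this]
  have "det (\<chi> k. if k = j then row j (mat 1) + l else row k (mat 1)) = (1::real)" by simp
  moreover have "matrix (\<lambda>x. x + (l \<bullet> x) *\<^sub>R axis j 1) = (\<chi> k. if k = j then row j (mat 1) + l else row k (mat 1))"
    by (simp add: vec_eq_iff matrix_def row_def mat_def axis_def inner_axis[unfolded axis_def])
  ultimately show ?thesis by simp
qed

context lattice_simplex
begin

definition axis_simplex :: "(real^'d) set" where
  "axis_simplex = {y. (\<forall>j. 0 \<le> y $ j) \<and> (\<Sum>j\<in>UNIV. real (a j) * y $ j) \<le> real q}"

lemma real_a_side: "real (a j) * real (side j) = real q"
  using a_side[of j] by (metis of_nat_mult)

lemma measure_simplex: "measure lebesgue axis_simplex = (\<Prod>j\<in>UNIV. real (side j)) / fact CARD('d)"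
proof -
  let ?T = "{x::real^'d. (\<forall>i. 0 \<le> x $ i) \<and> (\<Sum>i\<in>UNIV. x $ i) \<le> 1}"
  let ?f = "\<lambda>x::real^'d. \<chi> k. real (side k) * x $ k"
  have lev: "(\<Sum>j\<in>UNIV. real (a j) * (real (side j) * x $ j)) = real q * (\<Sum>j\<in>UNIV. x $ j)" for x :: "real^'d"
    by (simp add: mult.assoc[symmetric] real_a_side sum_distrib_left)
  have "axis_simplex = ?f ` ?T"
  proof (intro equalityI subsetI)
    fix y assume y: "y \<in> axis_simplex"
    let ?x = "\<chi> k. y $ k / real (side k)"
    have yx: "y = ?f ?x" using side_pos by (simp add: vec_eq_iff less_imp_neq[symmetric])
    have "(\<Sum>j\<in>UNIV. real (a j) * (real (side j) * ?x $ j)) = (\<Sum>j\<in>UNIV. real (a j) * y $ j)"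
      by (intro sum.cong refl) (use side_pos in \<open>simp add: less_imp_neq[symmetric]\<close>)
    then have "real q * (\<Sum>j\<in>UNIV. ?x $ j) \<le> real q * 1"
      using y unfolding lev by (simp add: axis_simplex_def)
    then have "(\<Sum>j\<in>UNIV. ?x $ j) \<le> 1" using q_pos by simp
    then have "?x \<in> ?T" using y by (simp add: axis_simplex_def)
    with yx show "y \<in> ?f ` ?T" by (rule image_eqI)
  next
    fix y assume "y \<in> ?f ` ?T"
    then obtain x where x: "x \<in> ?T" "y = ?f x" by blast
    have "real q * (\<Sum>j\<in>UNIV. x $ j) \<le> real q * 1" using x by (intro mult_left_mono) auto
    then show "y \<in> axis_simplex" using x by (simp add: axis_simplex_def lev)
  qed
  then show ?thesis
    using measure_stretch[OF measure_std_simplex(1), of "\<lambda>k. real (side k)"] measure_std_simplex(2)[where 'd = 'd]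
    by (simp add: abs_of_nonneg prod_nonneg)
qed

text \<open>The common shape behind all facets: it is the prism over the facet
  \<open>y $ j = 0\<close>, and a shear carries the prism over the slanted facet to a translate of
  it.\<close>

definition coordinate_prism :: "'d \<Rightarrow> (real^'d) set" where
  "coordinate_prism j = {y. (\<forall>i. 0 \<le> y $ i) \<and> y $ j \<le> 1 \<and> (\<Sum>i\<in>UNIV - {j}. real (a i) * y $ i) \<le> real q}"

lemma measure_coordinate_prism:
  "measure lebesgue (coordinate_prism j) = (\<Prod>i\<in>UNIV. real (side i)) / fact (CARD('d) - 1) / real (side j)"
proof -
  let ?T = "{x::real^'d. (\<forall>i. 0 \<le> x $ i) \<and> x $ j \<le> 1 \<and> (\<Sum>i\<in>UNIV - {j}. x $ i) \<le> 1}"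
  let ?m = "\<lambda>k. if k = j then 1 else real (side k)"
  let ?f = "\<lambda>x::real^'d. \<chi> k. ?m k * x $ k"
  have m: "?m k > 0" for k using side_pos by simp
  have lev: "(\<Sum>i\<in>UNIV - {j}. real (a i) * (?m i * x $ i)) = real q * (\<Sum>i\<in>UNIV - {j}. x $ i)" for x :: "real^'d"
    unfolding sum_distrib_left by (intro sum.cong) (auto simp: mult.assoc[symmetric] real_a_side)
  have "coordinate_prism j = ?f ` ?T"
  proof (intro equalityI subsetI)
    fix y assume y: "y \<in> coordinate_prism j"
    let ?x = "\<chi> k. y $ k / ?m k"
    have yx: "y = ?f ?x" using m by (simp add: vec_eq_iff less_imp_neq[symmetric])
    have "(\<Sum>i\<in>UNIV - {j}. real (a i) * (?m i * ?x $ i)) = (\<Sum>i\<in>UNIV - {j}. real (a i) * y $ i)"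
      by (intro sum.cong refl) (use side_pos in \<open>auto simp: less_imp_neq[symmetric]\<close>)
    then have "real q * (\<Sum>i\<in>UNIV - {j}. ?x $ i) \<le> real q * 1"
      using y unfolding lev by (simp add: coordinate_prism_def)
    then have "(\<Sum>i\<in>UNIV - {j}. ?x $ i) \<le> 1" using q_pos by simp
    then have "?x \<in> ?T" using y by (simp add: coordinate_prism_def)
    with yx show "y \<in> ?f ` ?T" by (rule image_eqI)
  next
    fix y assume "y \<in> ?f ` ?T"
    then obtain x where x: "x \<in> ?T" "y = ?f x" by blast
    have "real q * (\<Sum>i\<in>UNIV - {j}. x $ i) \<le> real q * 1" using x by (intro mult_left_mono) auto
    then have "(\<Sum>i\<in>UNIV - {j}. real (a i) * y $ i) \<le> real q"
      unfolding lev[symmetric] x(2) by simp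
    then show "y \<in> coordinate_prism j" using x by (simp add: coordinate_prism_def)
  qed
  then have "measure lebesgue (coordinate_prism j) = \<bar>prod ?m UNIV\<bar> * (1 / fact (CARD('d) - 1))"
    using measure_stretch[OF measure_std_prism(1)[of j], of ?m] measure_std_prism(2)[of j] by simp
  moreover have "prod ?m UNIV = (\<Prod>i\<in>UNIV - {j}. real (side i))"
    by (subst prod.remove[of _ j]) (auto intro!: prod.cong)
  moreover have "(\<Prod>i\<in>UNIV. real (side i)) = real (side j) * (\<Prod>i\<in>UNIV - {j}. real (side i))"
    by (rule prod.remove) auto
  ultimately show ?thesis
    using side_pos[of j] by (simp add: abs_of_nonneg prod_nonneg)
qed

definition normal :: "real^'d" where "normal = (\<chi> j. real (a j))"

definition vertex :: "'d \<Rightarrow> real^'d" where "vertex j = real (side j) *\<^sub>R axis j 1"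

lemma inner_normal: "normal \<bullet> y = (\<Sum>j\<in>UNIV. real (a j) * y $ j)"
  by (simp add: normal_def inner_vec_def)

lemma vertex_nth: "vertex j $ i = (if i = j then real (side j) else 0)"
  by (simp add: vertex_def axis_def)

lemma normal_vertex: "normal \<bullet> vertex j = real q"
  by (simp add: vertex_def inner_axis normal_def real_a_side mult.commute)

lemma axis_simplex_eq: "axis_simplex = {y. (\<forall>j. 0 \<le> y $ j) \<and> normal \<bullet> y \<le> real q}"
  by (simp add: axis_simplex_def inner_normal)

lemma vertex_simplex: "vertex j \<in> axis_simplex" and zero_simplex: "0 \<in> axis_simplex"
  by (simp_all add: axis_simplex_eq normal_vertex vertex_nth)

lemma compact_simplex: "compact axis_simplex"
proof -
  have "axis_simplex = (\<Inter>j. {y. 0 \<le> y $ j}) \<inter> {y. normal \<bullet> y \<le> real q}" by (auto simp: axis_simplex_eq)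
  also have "closed \<dots>"
    by (intro closed_Int closed_INT ballI closed_Collect_le continuous_intros)
  finally have "closed axis_simplex" .
  moreover have "axis_simplex \<subseteq> cbox 0 (\<chi> j. real (side j))"
  proof
    fix y assume y: "y \<in> axis_simplex"
    have "y $ j \<le> real (side j)" for j
    proof -
      have "real (a j) * y $ j \<le> (\<Sum>j\<in>UNIV. real (a j) * y $ j)"
        using y by (intro member_le_sum) (auto simp: axis_simplex_def)
      also have "\<dots> \<le> real (a j) * real (side j)" using y by (simp add: axis_simplex_def real_a_side)
      finally show ?thesis using a_pos[of j] by simp
    qed
    then show "y \<in> cbox 0 (\<chi> j. real (side j))" using y by (simp add: mem_box_cart axis_simplex_def)
  qed
  ultimately show ?thesis
    using bounded_subset[OF bounded_cbox] by (simp add: compact_eq_bounded_closed)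
qed

definition facet :: "'d option \<Rightarrow> (real^'d) set" where
  "facet i = (case i of None \<Rightarrow> {y \<in> axis_simplex. normal \<bullet> y = real q} | Some j \<Rightarrow> {y \<in> axis_simplex. y $ j = 0})"

lemma affine_hull_simplex: "affine hull axis_simplex = UNIV"
proof (rule affine_hull_nonempty_interior)
  define U where "U = (\<Inter>j. {y::real^'d. 0 < y $ j}) \<inter> {y. normal \<bullet> y < real q}"
  have "open U" unfolding U_def
    by (intro open_Int open_INT ballI open_Collect_less continuous_intros finite)
  moreover have "U \<subseteq> axis_simplex" by (auto simp: U_def axis_simplex_eq less_imp_le)
  ultimately have "U \<subseteq> interior axis_simplex" by (rule interior_maximal[rotated])
  moreover
  define s where "s = (\<Sum>j\<in>UNIV. real (a j))"
  have s: "s > 0" unfolding s_def using a_pos by (intro sum_pos) auto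
  have "normal \<bullet> (\<chi> j. real q / (2 * s)) = s * (real q / (2 * s))"
    by (simp only: inner_normal vec_lambda_beta s_def sum_distrib_right)
  then have "(\<chi> j. real q / (2 * s)) \<in> U"
    using q_pos s by (simp add: U_def)
  ultimately show "interior axis_simplex \<noteq> {}" by blast
qed

text \<open>The simplex is an irredundant intersection of d + 1 half-spaces, indexed by
  \<open>'d option\<close>, and the facets of such an intersection are cut out by the bounding
  hyperplanes.\<close>

lemma facet_of_simplex_iff: "F facet_of axis_simplex \<longleftrightarrow> F \<in> range facet"
proof -
  define N where "N i = (case i of None \<Rightarrow> normal | Some j \<Rightarrow> - axis j 1)" for i
  define b where "b i = (case i of None \<Rightarrow> real q | Some (j::'d) \<Rightarrow> 0)" for i
  define H where "H i = {y. N i \<bullet> y \<le> b i}" for i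
  have H: "y \<in> H None \<longleftrightarrow> normal \<bullet> y \<le> real q" "y \<in> H (Some j) \<longleftrightarrow> 0 \<le> y $ j" for y j
    by (simp_all add: H_def N_def b_def inner_axis' )
  have S: "axis_simplex = (\<Inter>i. H i)"
  proof (intro equalityI subsetI)
    fix y assume y: "y \<in> axis_simplex"
    have "y \<in> H i" for i using y by (cases i) (simp_all add: H axis_simplex_eq)
    then show "y \<in> (\<Inter>i. H i)" by blast
  next
    fix y assume "y \<in> (\<Inter>i. H i)"
    then have yH: "y \<in> H i" for i by blast
    have "normal \<bullet> y \<le> real q" using yH[of None] by (simp only: H)
    moreover have "0 \<le> y $ j" for j using yH[of "Some j"] by (simp only: H)
    ultimately show "y \<in> axis_simplex" by (simp add: axis_simplex_eq)
  qed
  \<comment> \<open>Witnesses of irredundance: twice a vertex leaves only the slanted half-space,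
    and \<open>- axis j 1\<close> violates only nonnegativity in coordinate
    \<open>j\<close>.\<close>
  define out where "out i = (case i of None \<Rightarrow> 2 *\<^sub>R vertex undefined | Some j \<Rightarrow> - axis j 1)" for i
  have out: "out i \<in> H k \<longleftrightarrow> i \<noteq> k" for i k
  proof (cases i)
    case None
    then show ?thesis using q_pos by (cases k) (auto simp: H out_def normal_vertex vertex_nth)
  next
    case (Some j)
    have "normal \<bullet> axis j 1 \<ge> 0" by (simp add: inner_axis normal_def)
    then show ?thesis using Some q_pos
      by (cases k) (auto simp: H out_def axis_def[of _ "1::real"] inner_minus_right intro: order_trans[of _ 0])
  qed
  have inj: "inj H"
  proof (rule injI)
    fix i k assume "H i = H k"
    then have "out i \<in> H i \<longleftrightarrow> out i \<in> H k" by simp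
    then show "i = k" by (simp add: out)
  qed
  have "F facet_of axis_simplex \<longleftrightarrow> (\<exists>h. h \<in> range H \<and> F = axis_simplex \<inter> {x. N (inv H h) \<bullet> x = b (inv H h)})"
  proof (rule facet_of_polyhedron_explicit)
    show "finite (range H)" by simp
    show "axis_simplex = affine hull axis_simplex \<inter> \<Inter>(range H)" by (simp only: affine_hull_simplex S[symmetric] Int_UNIV_left)
    fix h assume "h \<in> range H"
    then obtain i where h: "h = H i" by blast
    have "N i \<noteq> 0" using a_pos by (cases i) (auto simp: N_def normal_def vec_eq_iff axis_def less_imp_neq[symmetric] intro: exI[of _ undefined])
    then show "N (inv H h) \<noteq> 0 \<and> h = {x. N (inv H h) \<bullet> x \<le> b (inv H h)}"
      by (simp add: h inv_f_f[OF inj]) (simp add: H_def)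
  next
    fix F' assume "F' \<subset> range H"
    then obtain i where i: "H i \<notin> F'" "F' \<subseteq> range H" by blast
    have "out i \<in> \<Inter>F'"
    proof
      fix h assume "h \<in> F'"
      then obtain k where k: "h = H k" "H k \<in> F'" using i by blast
      then have "k \<noteq> i" using i by blast
      then show "out i \<in> h" using out by (simp add: k)
    qed
    moreover have "out i \<notin> axis_simplex" using out[of i i] unfolding S by blast
    moreover have "axis_simplex \<subseteq> \<Inter>F'" unfolding S using i(2) by blast
    ultimately show "axis_simplex \<subset> affine hull axis_simplex \<inter> \<Inter>F'" unfolding affine_hull_simplex by blast
  qed
  also have "\<dots> \<longleftrightarrow> (\<exists>i. F = axis_simplex \<inter> {x. N i \<bullet> x = b i})"
    using inv_f_f[OF inj] by (metis rangeI rangeE)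
  also have "\<dots> \<longleftrightarrow> F \<in> range facet"
  proof -
    have "facet i = axis_simplex \<inter> {x. N i \<bullet> x = b i}" for i
      by (cases i) (auto simp: facet_def N_def b_def inner_axis')
    then show ?thesis by (auto simp: image_iff)
  qed
  finally show ?thesis .
qed

text \<open>Vertex \<open>j\<close> lies on every facet except \<open>Some j\<close>, and the origin
  on every facet except \<open>None\<close>; a facet thus reveals its index.\<close>

lemma inj_facet: "inj facet"
proof (rule injI)
  fix i k assume eq: "facet i = facet k"
  have v: "vertex j \<in> facet i \<longleftrightarrow> i \<noteq> Some j" for i j
    using side_pos by (cases i) (auto simp: facet_def vertex_simplex normal_vertex vertex_nth less_imp_neq[symmetric])
  have z: "0 \<in> facet i \<longleftrightarrow> i \<noteq> None" for i
    using q_pos by (cases i) (auto simp: facet_def zero_simplex)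
  have "(0 \<in> facet i) = (0 \<in> facet k)" by (simp only: eq)
  then have n: "i = None \<longleftrightarrow> k = None" by (simp only: z) blast
  have "(vertex j \<in> facet i) = (vertex j \<in> facet k)" for j by (simp only: eq)
  then have s: "(i = Some j) = (k = Some j)" for j by (simp only: v) blast
  show "i = k"
  proof (cases i)
    case None
    then show ?thesis using n by simp
  next
    case (Some j)
    then show ?thesis using s[of j] by simp
  qed
qed

lemma compact_facet: "compact (facet i)"
proof -
  have "facet i = axis_simplex \<inter> (case i of None \<Rightarrow> {y. normal \<bullet> y = real q} | Some j \<Rightarrow> {y. y $ j = 0})"
    by (cases i) (auto simp: facet_def)
  moreover have "closed (case i of None \<Rightarrow> {y. normal \<bullet> y = real q} | Some j \<Rightarrow> {y. y $ j = 0})"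
    by (cases i) (auto intro!: closed_Collect_eq continuous_intros)
  ultimately show ?thesis by (simp add: compact_Int_closed compact_simplex)
qed

lemma vertex_expansion: "y = (\<Sum>i\<in>UNIV. (y $ i / real (side i)) *\<^sub>R vertex i)"
  using side_pos by (simp add: vec_eq_iff vertex_nth less_imp_neq[symmetric] if_distrib[of "\<lambda>c. _ * c"] cong: if_cong)

lemma direction_space_coordinate: "direction_space (facet (Some j)) = {y. axis j 1 \<bullet> y = 0}"
proof (intro equalityI)
  show "direction_space (facet (Some j)) \<subseteq> {y. axis j 1 \<bullet> y = 0}"
    unfolding direction_space_def
    by (rule span_minimal) (auto simp: facet_def inner_axis' subspace_def)
  show "{y. axis j 1 \<bullet> y = 0} \<subseteq> direction_space (facet (Some j))"
  proof
    fix y :: "real^'d" assume "y \<in> {y. axis j 1 \<bullet> y = 0}"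
    then have yj: "y $ j = 0" by (simp add: inner_axis')
    have "(y $ i / real (side i)) *\<^sub>R vertex i \<in> direction_space (facet (Some j))" for i
    proof (cases "i = j")
      case False
      have "vertex i - 0 \<in> {y - z |y z. y \<in> facet (Some j) \<and> z \<in> facet (Some j)}"
        using False by (intro CollectI exI[of _ "vertex i"] exI[of _ 0] conjI refl)
          (simp_all add: facet_def vertex_simplex zero_simplex vertex_nth)
      then show ?thesis unfolding direction_space_def by (intro span_scale span_base) simp
    qed (simp add: yj direction_space_def span_zero)
    then show "y \<in> direction_space (facet (Some j))"
      by (subst vertex_expansion[of y]) (simp add: direction_space_def span_sum)
  qed
qed

lemma direction_space_slanted: "direction_space (facet None) = {y. normal \<bullet> y = 0}"
proof (intro equalityI)
  show "direction_space (facet None) \<subseteq> {y. normal \<bullet> y = 0}"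
    unfolding direction_space_def
    by (rule span_minimal) (auto simp: facet_def inner_diff_right inner_add_right subspace_def)
  show "{y. normal \<bullet> y = 0} \<subseteq> direction_space (facet None)"
  proof
    fix y assume "y \<in> {y. normal \<bullet> y = 0}"
    then have "0 = (\<Sum>i\<in>UNIV. real (a i) * y $ i)" by (simp add: inner_normal)
    also have "\<dots> = real q * (\<Sum>i\<in>UNIV. y $ i / real (side i))"
      unfolding sum_distrib_left
    proof (intro sum.cong refl)
      fix i
      have "real q / real (side i) = real (a i)"
        using real_a_side[of i] side_pos[of i] by (simp add: field_simps)
      then show "real (a i) * y $ i = real q * (y $ i / real (side i))" by (metis times_divide_eq_left times_divide_eq_right)
    qed
    finally have s0: "(\<Sum>i\<in>UNIV. y $ i / real (side i)) = 0" using q_pos by simp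
    let ?k = "undefined :: 'd"
    \<comment> \<open>The coordinates relative to the vertices sum to 0, so a zero multiple of one
      fixed vertex may be subtracted, which leaves differences of points of the facet.\<close>
    have "y = (\<Sum>i\<in>UNIV. (y $ i / real (side i)) *\<^sub>R vertex i) - (\<Sum>i\<in>UNIV. y $ i / real (side i)) *\<^sub>R vertex ?k"
      unfolding s0 using vertex_expansion[of y] by simp
    also have "\<dots> = (\<Sum>i\<in>UNIV. (y $ i / real (side i)) *\<^sub>R (vertex i - vertex ?k))"
      by (simp add: scaleR_diff_right sum_subtractf scaleR_sum_left)
    also have "\<dots> \<in> direction_space (facet None)"
    proof -
      have "vertex i - vertex ?k \<in> {y - z |y z. y \<in> facet None \<and> z \<in> facet None}" for i
        by (intro CollectI exI[of _ "vertex i"] exI[of _ "vertex ?k"] conjI refl)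
          (simp_all add: facet_def vertex_simplex normal_vertex)
      then show ?thesis unfolding direction_space_def by (intro span_sum span_scale span_base)
    qed
    finally show "y \<in> direction_space (facet None)" .
  qed
qed

lemma prism_coordinate_facet: "prism (facet (Some j)) (axis j 1) = coordinate_prism j"
proof (intro equalityI subsetI)
  have lev: "(\<Sum>i\<in>UNIV. real (a i) * y $ i) = (\<Sum>i\<in>UNIV - {j}. real (a i) * y $ i)" if "y $ j = 0" for y :: "real^'d"
    using that by (subst sum.remove[of _ j]) auto
  {
    fix z assume "z \<in> prism (facet (Some j)) (axis j 1)"
    then obtain y t where y: "y \<in> axis_simplex" "y $ j = 0" and t: "0 \<le> t" "t \<le> 1" and z: "z = y + t *\<^sub>R axis j 1"
      by (auto simp: prism_def facet_def)
    have zi: "z $ i = (if i = j then t else y $ i)" for i using y by (simp add: z axis_def)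
    have "(\<Sum>i\<in>UNIV - {j}. real (a i) * z $ i) = (\<Sum>i\<in>UNIV - {j}. real (a i) * y $ i)"
      by (intro sum.cong refl) (simp add: zi)
    then show "z \<in> coordinate_prism j"
      using y t lev[of y] by (simp add: coordinate_prism_def zi axis_simplex_def)
  next
    fix z assume z: "z \<in> coordinate_prism j"
    let ?y = "\<chi> i. if i = j then 0 else z $ i"
    have "(\<Sum>i\<in>UNIV - {j}. real (a i) * ?y $ i) = (\<Sum>i\<in>UNIV - {j}. real (a i) * z $ i)"
      by (intro sum.cong refl) simp
    then have "?y \<in> facet (Some j)"
      using z lev[of ?y] by (simp add: coordinate_prism_def facet_def axis_simplex_def)
    moreover have "z = ?y + z $ j *\<^sub>R axis j 1" by (simp add: vec_eq_iff axis_def)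
    moreover have "0 \<le> z $ j" "z $ j \<le> 1" using z by (auto simp: coordinate_prism_def)
    ultimately show "z \<in> prism (facet (Some j)) (axis j 1)" unfolding prism_def by blast
  }
qed

text \<open>The shear \<open>f\<close> along \<open>axis j 1\<close> has determinant 1 and moves the
  slanted facet into the hyperplane where coordinate \<open>j\<close> equals \<open>side j\<close>;
  a translation by \<open>vertex j\<close> then gives \<open>coordinate_prism j\<close>.\<close>

lemma measure_prism_slanted_facet:
  "measure lebesgue (prism (facet None) (axis j 1)) = measure lebesgue (coordinate_prism j)"
proof -
  define l :: "real^'d" where "l = (\<chi> i. if i = j then 0 else real (a i) / real (a j))"
  define f where "f x = x + (l \<bullet> x) *\<^sub>R axis j 1" for x
  have aj: "real (a j) > 0" using a_pos by simp
  have lin: "linear f" unfolding f_def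
    by (rule linearI) (simp_all add: inner_add_right scaleR_add_left scaleR_add_right)
  have lx: "real (a j) * (l \<bullet> x) = (\<Sum>i\<in>UNIV - {j}. real (a i) * x $ i)" for x
  proof -
    have "l \<bullet> x = (\<Sum>i\<in>UNIV - {j}. real (a i) / real (a j) * x $ i)"
      unfolding inner_vec_def by (subst sum.remove[of _ j]) (auto simp: l_def intro!: sum.cong)
    then show ?thesis using aj by (simp add: sum_distrib_left)
  qed
  have split: "(\<Sum>i\<in>UNIV. real (a i) * x $ i) = real (a j) * x $ j + (\<Sum>i\<in>UNIV - {j}. real (a i) * x $ i)" for x :: "real^'d"
    by (rule sum.remove) auto
  have on_facet: "y $ j + l \<bullet> y = real (side j)" if "normal \<bullet> y = real q" for y
  proof -
    have "real (a j) * (y $ j + l \<bullet> y) = real (a j) * real (side j)"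
      using that split[of y] by (simp add: inner_normal distrib_left lx real_a_side)
    then show ?thesis using aj by simp
  qed
  have "f ` prism (facet None) (axis j 1) = (+) (vertex j) ` coordinate_prism j"
  proof (intro equalityI subsetI)
    fix z assume "z \<in> f ` prism (facet None) (axis j 1)"
    then obtain y t where y: "y \<in> axis_simplex" "normal \<bullet> y = real q" and t: "0 \<le> t" "t \<le> 1"
      and z: "z = f (y + t *\<^sub>R axis j 1)"
      by (auto simp: prism_def facet_def)
    have la: "l \<bullet> axis j 1 = 0" by (simp add: l_def inner_axis)
    let ?x = "\<chi> i. if i = j then t else y $ i"
    have "z = vertex j + ?x"
    proof -
      have "z = y + (t + l \<bullet> y) *\<^sub>R axis j 1"
        by (simp add: z f_def inner_add_right la scaleR_add_left)
      then show ?thesis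
        using on_facet[OF y(2)] by (auto simp: vec_eq_iff vertex_nth axis_def)
    qed
    moreover have "?x \<in> coordinate_prism j"
    proof -
      have "(\<Sum>i\<in>UNIV - {j}. real (a i) * ?x $ i) = (\<Sum>i\<in>UNIV - {j}. real (a i) * y $ i)"
        by (intro sum.cong refl) simp
      also have "\<dots> \<le> (\<Sum>i\<in>UNIV. real (a i) * y $ i)"
        unfolding split using y by (simp add: axis_simplex_def)
      finally show ?thesis using y t by (simp add: coordinate_prism_def axis_simplex_def)
    qed
    ultimately show "z \<in> (+) (vertex j) ` coordinate_prism j" by blast
  next
    fix z assume "z \<in> (+) (vertex j) ` coordinate_prism j"
    then obtain x where x: "x \<in> coordinate_prism j" and z: "z = vertex j + x" by blast
    let ?y = "\<chi> i. if i = j then real (side j) - l \<bullet> x else x $ i"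
    have ly: "l \<bullet> ?y = l \<bullet> x"
      unfolding inner_vec_def by (intro sum.cong) (auto simp: l_def)
    have "(\<Sum>i\<in>UNIV - {j}. real (a i) * ?y $ i) = (\<Sum>i\<in>UNIV - {j}. real (a i) * x $ i)"
      by (intro sum.cong refl) simp
    then have ny: "normal \<bullet> ?y = real q"
      unfolding inner_normal split by (simp add: right_diff_distrib real_a_side lx)
    have "real (a j) * (l \<bullet> x) \<le> real (a j) * real (side j)"
      using x by (simp add: lx real_a_side coordinate_prism_def)
    then have "l \<bullet> x \<le> real (side j)" using aj by simp
    then have "?y \<in> facet None"
      using x ny by (simp add: facet_def axis_simplex_eq coordinate_prism_def)
    moreover have "0 \<le> x $ j" "x $ j \<le> 1" using x by (auto simp: coordinate_prism_def)
    ultimately have "?y + x $ j *\<^sub>R axis j 1 \<in> prism (facet None) (axis j 1)"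
      unfolding prism_def by blast
    moreover have "z = f (?y + x $ j *\<^sub>R axis j 1)"
    proof -
      have la: "l \<bullet> axis j 1 = 0" by (simp add: l_def inner_axis)
      show ?thesis
        unfolding z f_def inner_add_right inner_scaleR_right la ly
        by (auto simp: vec_eq_iff vertex_nth axis_def)
    qed
    ultimately show "z \<in> f ` prism (facet None) (axis j 1)" by (rule image_eqI[rotated])
  qed
  then have "measure lebesgue (coordinate_prism j) = measure lebesgue (f ` prism (facet None) (axis j 1))"
    by (simp only: measure_translation)
  also have "\<dots> = \<bar>det (matrix f)\<bar> * measure lebesgue (prism (facet None) (axis j 1))"
    by (intro measure_linear_image_det lin lmeasurable_compact compact_prism compact_facet)
  also have "det (matrix f) = 1"
    unfolding f_def[abs_def] by (rule det_coordinate_shear) (simp add: l_def)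
  finally show ?thesis by simp
qed

lemma facet_volume_coordinate:
  "facet_volume (facet (Some j)) = (\<Prod>i\<in>UNIV. real (side i)) / fact (CARD('d) - 1) * (1 / real (side j))"
proof -
  have "facet_volume (facet (Some j)) = measure lebesgue (prism (facet (Some j)) (axis j 1)) / \<bar>axis j 1 $ j\<bar>"
  proof (rule facet_volume_eq[OF int_vec_axis int_vec_axis _ _ direction_space_coordinate compact_facet])
    show "axis j (1::real) \<bullet> axis j 1 = 1" "axis j 1 $ j \<noteq> (0::real)"
      by (simp_all add: inner_axis)
    show "axis j 1 \<bullet> y = 0" if "y \<in> facet (Some j)" for y
      using that by (simp add: facet_def inner_axis')
  qed
  then show ?thesis
    by (simp add: prism_coordinate_facet measure_coordinate_prism)
qed

text \<open>c = normal / g is the primitive normal, and Bezout's identity supplies an integer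
  \<open>w\<close> with c \<bullet> w = 1. Dividing the prism measure by c_j = a_j / g turns the
  factor 1 / side_j into g / q, because a_j side_j = q.\<close>

lemma facet_volume_slanted:
  "facet_volume (facet None) = (\<Prod>i\<in>UNIV. real (side i)) / fact (CARD('d) - 1) * (real (Gcd (range a)) / real q)"
proof -
  define g where "g = Gcd (range a)"
  \<comment> \<open>Any coordinate would do, since all entries of the normal are positive.\<close>
  let ?j = "undefined :: 'd"
  have gd: "g dvd a j" for j by (simp add: g_def)
  then have g_pos: "g > 0" using a_pos by (metis dvd_0_left_iff neq0_conv)
  define c :: "real^'d" where "c = (\<chi> j. real (a j div g))"
  have c: "real g * c $ j = real (a j)" for j
    unfolding c_def using gd[of j] by (simp flip: of_nat_mult)
  have nc: "normal \<bullet> y = real g * (c \<bullet> y)" for y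
    unfolding inner_normal inner_vec_def[of c] by (simp add: sum_distrib_left mult.assoc[symmetric] c)
  have "Gcd (range (\<lambda>j. int (a j))) \<in> {x. \<exists>w :: 'd \<Rightarrow> int. x = (\<Sum>j\<in>UNIV. int (a j) * w j)}"
  proof (rule int_subgroup_Gcd)
    fix x y assume "x \<in> {x. \<exists>w :: 'd \<Rightarrow> int. x = (\<Sum>j\<in>UNIV. int (a j) * w j)}"
      "y \<in> {x. \<exists>w :: 'd \<Rightarrow> int. x = (\<Sum>j\<in>UNIV. int (a j) * w j)}"
    then obtain u w :: "'d \<Rightarrow> int" where "x = (\<Sum>j\<in>UNIV. int (a j) * u j)" "y = (\<Sum>j\<in>UNIV. int (a j) * w j)" by blast
    then show "x + y \<in> {x. \<exists>w :: 'd \<Rightarrow> int. x = (\<Sum>j\<in>UNIV. int (a j) * w j)}"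
      by (intro CollectI exI[of _ "\<lambda>j. u j + w j"]) (simp add: distrib_left sum.distrib)
  next
    fix x assume "x \<in> {x. \<exists>w :: 'd \<Rightarrow> int. x = (\<Sum>j\<in>UNIV. int (a j) * w j)}"
    then obtain u :: "'d \<Rightarrow> int" where "x = (\<Sum>j\<in>UNIV. int (a j) * u j)" by blast
    then show "- x \<in> {x. \<exists>w :: 'd \<Rightarrow> int. x = (\<Sum>j\<in>UNIV. int (a j) * w j)}"
      by (intro CollectI exI[of _ "\<lambda>j. - u j"]) (simp add: sum_negf)
  next
    show "0 \<in> {x. \<exists>w :: 'd \<Rightarrow> int. x = (\<Sum>j\<in>UNIV. int (a j) * w j)}"
      by (intro CollectI exI[of _ "\<lambda>j. 0"]) simp
    show "range (\<lambda>j. int (a j)) \<subseteq> {x. \<exists>w :: 'd \<Rightarrow> int. x = (\<Sum>j\<in>UNIV. int (a j) * w j)}"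
    proof safe
      fix k
      show "\<exists>w :: 'd \<Rightarrow> int. int (a k) = (\<Sum>j\<in>UNIV. int (a j) * w j)"
        by (intro exI[of _ "\<lambda>j. if j = k then 1 else 0"]) (simp add: if_distrib cong: if_cong)
    qed
  qed simp
  moreover have "Gcd (range (\<lambda>j. int (a j))) = int g"
    by (simp add: g_def Gcd_int_def image_image)
  ultimately obtain u :: "'d \<Rightarrow> int" where u: "int g = (\<Sum>j\<in>UNIV. int (a j) * u j)" by auto
  define w :: "real^'d" where "w = (\<chi> j. of_int (u j))"
  have "real g * (c \<bullet> w) = (\<Sum>j\<in>UNIV. real (a j) * of_int (u j))"
    by (simp add: inner_vec_def sum_distrib_left mult.assoc[symmetric] c w_def)
  also have "\<dots> = of_int (int g)" unfolding u by simp
  finally have cw: "c \<bullet> w = 1" using g_pos by simp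
  have cj: "c $ ?j \<noteq> 0" using c[of ?j] a_pos[of ?j] by auto
  have "facet_volume (facet None) = measure lebesgue (prism (facet None) (axis ?j 1)) / \<bar>c $ ?j\<bar>"
  proof (rule facet_volume_eq[OF _ _ cw cj _ compact_facet])
    show "int_vec c" "int_vec w" by (simp_all add: int_vec_def c_def w_def)
    show "direction_space (facet None) = {y. c \<bullet> y = 0}"
      unfolding direction_space_slanted nc using g_pos by simp
    show "c \<bullet> y = real q / real g" if "y \<in> facet None" for y
      using that nc[of y] g_pos by (simp add: facet_def field_simps)
  qed
  also have "\<dots> = (\<Prod>i\<in>UNIV. real (side i)) / fact (CARD('d) - 1) / (real (side ?j) * c $ ?j)"
    unfolding measure_prism_slanted_facet measure_coordinate_prism by (simp add: c_def)
  also have "real (side ?j) * c $ ?j = real q / real g"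
  proof -
    have "real g * (real (side ?j) * c $ ?j) = real (side ?j) * (real g * c $ ?j)" by simp
    also have "\<dots> = real q" unfolding c using real_a_side[of ?j] by (simp add: mult.commute)
    finally show ?thesis using g_pos by (simp add: field_simps)
  qed
  finally show ?thesis by (simp add: g_def)
qed

text \<open>Up to the factor 1/2 this is the closed form of \<open>coeff_ehrhart_second\<close>:
  coordinate facets give the terms 1 / side j, the slanted facet gives gcd / q.\<close>

theorem boundary_volume_simplex:
  "boundary_volume axis_simplex = (\<Prod>i\<in>UNIV. real (side i)) / fact (CARD('d) - 1)
    * ((\<Sum>j\<in>UNIV. 1 / real (side j)) + real (Gcd (range a)) / real q)"
proof -
  have "boundary_volume axis_simplex = (\<Sum>F\<in>range facet. facet_volume F)"
    unfolding boundary_volume_def by (intro sum.cong) (auto simp: facet_of_simplex_iff)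
  also have "\<dots> = (\<Sum>i\<in>UNIV. facet_volume (facet i))"
    by (simp add: sum.reindex inj_facet)
  also have "\<dots> = facet_volume (facet None) + (\<Sum>j\<in>UNIV. facet_volume (facet (Some j)))"
    by (simp add: UNIV_option_conv sum.reindex)
  finally show ?thesis
    by (simp add: facet_volume_slanted facet_volume_coordinate sum_distrib_left distrib_left)
qed

end

lemma poly_eq_sum_coeff:
  fixes f :: "'a::comm_semiring_1 poly"
  assumes "degree f \<le> n"
  shows "poly f y = (\<Sum>j=0..n. coeff f j * y ^ j)"
proof -
  have "poly f y = (\<Sum>j\<le>degree f. coeff f j * y ^ j)" by (rule poly_altdef)
  also have "\<dots> = (\<Sum>j=0..n. coeff f j * y ^ j)"
    using assms by (intro sum.mono_neutral_left) (auto simp: coeff_eq_0)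
  finally show ?thesis .
qed

context lattice_simplex
begin

text \<open>The count is monotone in \<tau>, hence lies between its values at neighbouring integers;
  for \<tau> \<ge> 0 these integers are natural numbers, where \<open>poly_ehrhart\<close> evaluates
  them.\<close>

lemma ehrhart_bounds:
  fixes \<tau> :: real
  shows "0 \<le> \<tau> \<Longrightarrow> poly ehrhart (of_int \<lfloor>\<tau>\<rfloor>) \<le> real (card {n. real (level n) \<le> real q * \<tau>})"
    and "0 \<le> \<tau> \<Longrightarrow> real (card {n. real (level n) \<le> real q * \<tau>}) \<le> poly ehrhart (of_int (\<lfloor>\<tau>\<rfloor> + 1))"
    and "\<tau> \<in> \<nat> \<Longrightarrow> poly ehrhart (of_int \<lfloor>\<tau>\<rfloor>) = real (card {n. real (level n) \<le> real q * \<tau>})"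
proof -
  let ?S = "{n. real (level n) \<le> real q * \<tau>}"
  have pts: "points k = {n. real (level n) \<le> real q * real k}" for k
    unfolding points_def by (simp flip: of_nat_mult)
  {
    assume \<tau>: "0 \<le> \<tau>"
    define k where "k = nat \<lfloor>\<tau>\<rfloor>"
    have k: "\<lfloor>\<tau>\<rfloor> = int k" using \<tau> by (simp add: k_def)
    have "real k \<le> \<tau>" "\<tau> \<le> real (k + 1)" using k by linarith+
    then have "real q * real k \<le> real q * \<tau>" "real q * \<tau> \<le> real q * real (k + 1)"
      by (intro mult_left_mono; simp)+
    then have sub: "points k \<subseteq> ?S" "?S \<subseteq> points (k + 1)"
      unfolding pts by (auto intro: order_trans)
    have fin: "finite ?S" by (rule finite_subset[OF sub(2) card_points(1)])
    show "poly ehrhart (of_int \<lfloor>\<tau>\<rfloor>) \<le> real (card ?S)"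
      using card_mono[OF fin sub(1)] poly_ehrhart[of k] by (simp add: k)
    show "real (card ?S) \<le> poly ehrhart (of_int (\<lfloor>\<tau>\<rfloor> + 1))"
      using card_mono[OF card_points(1) sub(2)] poly_ehrhart[of "k + 1"] by (simp add: k add.commute)
  }
  assume "\<tau> \<in> \<nat>"
  then obtain k where "\<tau> = real k" by (auto elim: Nats_cases)
  then show "poly ehrhart (of_int \<lfloor>\<tau>\<rfloor>) = real (card ?S)"
    using poly_ehrhart[of k] pts[of k] by simp
qed

end

text \<open>The two bounds are stated for r \<ge> e because below the lowest eigenvalue the count is
  0 while the polynomial may be negative: for d = 1 and p = -1 it is k + 1, and the upper bound
  fails once t r < -2. Comparing in the extended reals means that the bounds also assert finiteness
  of the count.\<close>

theorem theorem1p4: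
  fixes A :: "complex^'d^'d" and s :: "'d \<Rightarrow> real" and p :: "'d \<Rightarrow> int" and x :: real and q :: int
  assumes "anti_hermitian A"
    and "eigenvalue_list A (\<lambda>j. \<i> * complex_of_real (s j))"
    and "\<And>j. s j < 0"
    and "\<And>j. s j = of_int (p j) * x"
    and "x > 0"
    and "q = Lcm (range (\<lambda>j. - p j))"
  shows "\<exists>c :: nat \<Rightarrow> real.
    (let N = (\<lambda>r. ereal_of_enat (counting_function (H_graph A) r));
         P = (\<lambda>k::int. \<Sum>j=0..CARD('d). c j * of_int k ^ j);
         e = Re (\<i> / 2 * trace A);
         t = (\<lambda>r. (r - e) * inverse (of_int q * x));
         S = weighted_simplex p q
     in (\<forall>r \<ge> e. ereal (P \<lfloor>t r\<rfloor>) \<le> N r \<and> N r \<le> ereal (P (\<lfloor>t r\<rfloor> + 1))) \<and>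
        (\<forall>r. t r \<in> \<nat> \<longrightarrow> ereal (P \<lfloor>t r\<rfloor>) = N r) \<and>
        c 0 = 1 \<and>
        c (CARD('d)) = measure lebesgue S \<and>
        c (CARD('d) - 1) = 1 / 2 * boundary_volume S)"
proof -
  define a where "a j = nat (- p j)" for j
  have p: "p j < 0" for j
    using assms(3)[of j] assms(4)[of j] \<open>x > 0\<close> by (simp add: mult_less_0_iff)
  have a: "int (a j) = - p j" for j using p[of j] by (simp add: a_def)
  have "q \<noteq> 0"
  proof
    assume "q = 0"
    then have "0 \<in> range (\<lambda>j. - p j)" using assms(6) by (metis Lcm_0_iff finite finite_imageI)
    then show False using p by (auto simp: less_imp_neq)
  qed
  moreover have "q \<ge> 0" unfolding assms(6) by (rule Lcm_int_greater_eq_0)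
  ultimately have q: "q > 0" by simp
  have "- p j dvd q" for j unfolding assms(6) by (rule dvd_Lcm) simp
  then have "a j dvd nat q" for j
    using q by (simp add: a_def nat_dvd_iff p less_imp_le)
  then interpret lattice_simplex a "nat q"
    using q by unfold_locales simp_all
  have ra: "real (a j) = - of_int (p j)" for j
    using arg_cong[OF a[of j], of real_of_int] by simp
  have rq: "real (nat q) = of_int q" using q by simp
  define e where "e = Re (\<i> / 2 * trace A)"
  define t where "t r = (r - e) * inverse (of_int q * x)" for r
  have S: "weighted_simplex p q = axis_simplex"
    unfolding weighted_simplex_def axis_simplex_def rq ra
    by (simp add: sum_negf mult.commute)
  \<comment> \<open>Division by \<open>x\<close> turns the energy condition into a condition on
    \<open>level n\<close>, since - s j = a j x and q t r = (r - e) / x.\<close>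
  have N: "counting_function (H_graph A) r = enat (card {n. real (level n) \<le> real (nat q) * t r})" for r
  proof -
    have "counting_function (H_graph A) r = enat (card {M :: 'd multiset. (\<Sum>j\<in>#M. - s j) \<le> r - e})"
      unfolding counting_function_H_graph[OF assms(1-3)] e_def[symmetric] by (simp add: le_diff_eq add.commute)
    also have "\<dots> = enat (card {n. (\<Sum>j\<in>UNIV. real (n j) * - s j) \<le> r - e})"
      unfolding card_multisets_eq_card_functions ..
    also have "{n. (\<Sum>j\<in>UNIV. real (n j) * - s j) \<le> r - e} = {n. real (level n) \<le> real (nat q) * t r}"
    proof (intro Collect_cong)
      fix n :: "'d \<Rightarrow> nat"
      have "(\<Sum>j\<in>UNIV. real (n j) * - s j) = real (level n) * x"
        by (simp add: level_def ra assms(4) sum_distrib_left sum_distrib_right mult_ac)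
      moreover have "real (nat q) * t r = (r - e) / x"
        using q by (simp add: rq t_def divide_inverse)
      ultimately show "(\<Sum>j\<in>UNIV. real (n j) * - s j) \<le> r - e \<longleftrightarrow> real (level n) \<le> real (nat q) * t r"
        using \<open>x > 0\<close> by (simp only: pos_le_divide_eq)
    qed
    finally show ?thesis .
  qed
  have P: "(\<Sum>j=0..CARD('d). coeff ehrhart j * y ^ j) = poly ehrhart y" for y
    by (rule poly_eq_sum_coeff[OF degree_ehrhart, symmetric])
  have t0: "0 \<le> t r" if "e \<le> r" for r
    using that q \<open>x > 0\<close> by (simp add: t_def)
  show ?thesis
    unfolding Let_def e_def[symmetric] t_def[symmetric] S N
    by (intro exI[of _ "coeff ehrhart"] conjI allI impI)
       (simp_all add: P ehrhart_bounds(1,3) ehrhart_bounds(2)[unfolded of_int_add of_int_1] t0 coeff_ehrhart_0 coeff_ehrhart_top measure_simplex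
          coeff_ehrhart_second[unfolded One_nat_def] boundary_volume_simplex)
qed

end
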